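(* Suppose that $0<s_1\le s_2\le1$ and let $g$ be an analytic function in $\mathbb{D}$. Then: (i) $T_g$ maps $Q_{s_1}$ into $Q_{s_2}$ if and only if $g\in Q_{s_2,\log,1}$. (ii) $I_g$ maps $Q_{s_1}$ into $Q_{s_2}$ if and only if $g\in H^\infty$. (iii) $M_g$ maps $Q_{s_1}$ into $Q_{s_2}$ if and only if $g\in Q_{s_2,\log,1}\cap H^\infty$.
   Context: $\mathbb{D}$ is the open unit disc in $\mathbb{C}$ and $dA$ is the normalized Lebesgue area measure on $\mathbb{D}$. $H^\infty$ is the space of bounded analytic functions in $\mathbb{D}$. For $a\in\mathbb{D}$, $\varphi_a(z)=\frac{a-z}{1-\overline{a}z}$. For $0<s<\infty$, $Q_s$ is the space of all analytic $f$ in $\mathbb{D}$ with $\sup_{a\in\mathbb{D}}\int_{\mathbb{D}}|f'(z)|^2 g(z,a)^s\,dA(z)<\infty$, where $g(z,a)=\log\frac{|1-\overline{a}z|}{|a-z|}$ is the Green function; equivalently (a known fact), $\sup_{a\in\mathbb{D}}\int_{\mathbb{D}}|f'(z)|^2(1-|\varphi_a(z)|^2)^s\,dA(z)<\infty$. For $0<s<\infty$ and $\alpha>0$, $Q_{s,\log,\alpha}$ is the space of all analytic $f$ in $\mathbb{D}$ with $\sup_{a\in\mathbb{D}}\left(\log\frac{2}{1-|a|}\right)^{2\alpha}\int_{\mathbb{D}}|f'(z)|^2(1-|\varphi_a(z)|^2)^s\,dA(z)<\infty$. For $g$ and $f$ analytic in $\mathbb{D}$ and $z\in\mathbb{D}$: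 $T_g(f)(z)=\int_0^z g'(\xi)f(\xi)\,d\xi$, $I_g(f)(z)=\int_0^z g(\xi)f'(\xi)\,d\xi$, $M_g(f)(z)=g(z)f(z)$. An operator $T$ maps $X$ into $Y$ if $T(X)\subset Y$. *)

theory Defs
  imports "HOL-Complex_Analysis.Complex_Analysis"
begin

text \<open>
  Analytic functions on the unit disc \<open>ball 0 1\<close> are represented by total functions
  \<open>complex \<Rightarrow> complex\<close> that are holomorphic on the disc. Their values outside the disc are
  arbitrary, and neither membership in the spaces below nor the values of the operators at points
  of the disc depend on them.
\<close>

definition disc_area :: "complex measure" where
  "disc_area = scale_measure (ennreal (1 / pi)) (restrict_space lborel (ball 0 1))"

definition disc_phi :: "complex \<Rightarrow> complex \<Rightarrow> complex" where
  "disc_phi a z = (a - z) / (1 - cnj a * z)"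

text \<open>
  At the pole \<open>z = a\<close> the right-hand side evaluates to \<open>0\<close> instead of infinity; this concerns a
  single point, hence a null set, and does not affect the integrals below.
\<close>

definition disc_green :: "complex \<Rightarrow> complex \<Rightarrow> real" where
  "disc_green z a = ln (cmod (1 - cnj a * z) / cmod (a - z))"

text \<open>
  Integrals and suprema are taken in \<^typ>\<open>ennreal\<close>, so divergent integrals have the value \<open>\<infinity>\<close>.
\<close>

definition Q_space :: "real \<Rightarrow> (complex \<Rightarrow> complex) set" where
  "Q_space s = {f. f holomorphic_on ball 0 1 \<and>
     (SUP a\<in>ball 0 1. \<integral>\<^sup>+ z. ennreal ((cmod (deriv f z))\<^sup>2 * disc_green z a powr s) \<partial>disc_area) < \<infinity>}"

definition Q_log_space :: "real \<Rightarrow> real \<Rightarrow> (complex \<Rightarrow> complex) set" where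
  "Q_log_space s \<alpha> = {f. f holomorphic_on ball 0 1 \<and>
     (SUP a\<in>ball 0 1. ennreal (ln (2 / (1 - cmod a)) powr (2 * \<alpha>)) *
        (\<integral>\<^sup>+ z. ennreal ((cmod (deriv f z))\<^sup>2 * (1 - (cmod (disc_phi a z))\<^sup>2) powr s) \<partial>disc_area)) < \<infinity>}"

definition H_infinity :: "(complex \<Rightarrow> complex) set" where
  "H_infinity = {f. f holomorphic_on ball 0 1 \<and> bounded (f ` ball 0 1)}"

text \<open>
  The integrals from \<open>0\<close> to \<open>z\<close> are taken along the segment, which lies in the disc; for analytic
  integrands the path is immaterial.
\<close>

definition T_op :: "(complex \<Rightarrow> complex) \<Rightarrow> (complex \<Rightarrow> complex) \<Rightarrow> complex \<Rightarrow> complex" where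
  "T_op g f z = contour_integral (linepath 0 z) (\<lambda>\<xi>. deriv g \<xi> * f \<xi>)"

definition I_op :: "(complex \<Rightarrow> complex) \<Rightarrow> (complex \<Rightarrow> complex) \<Rightarrow> complex \<Rightarrow> complex" where
  "I_op g f z = contour_integral (linepath 0 z) (\<lambda>\<xi>. g \<xi> * deriv f \<xi>)"

definition M_op :: "(complex \<Rightarrow> complex) \<Rightarrow> (complex \<Rightarrow> complex) \<Rightarrow> complex \<Rightarrow> complex" where
  "M_op g f z = g z * f z"

end

theory Submission
  imports Defs
begin

text \<open>
  The space \<open>Q_s\<close> is described by the weights \<open>(1 - |phi_a|\<^sup>2)\<^sup>s\<close> instead of powers of the Green
  function; the two agree up to constants because functions in \<open>Q_s\<close> satisfy a Bloch estimate,
  obtained from the mean value property on Euclidean discs.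

  For the sufficiency of \<open>g \<in> Q_{s,log,1}\<close> one splits \<open>f = f(a) + (f - f(a))\<close> in
  \<open>\<integral> |g' f|\<^sup>2 (1 - |phi_a|\<^sup>2)\<^sup>s\<close>. The first part is controlled by the logarithmic growth of \<open>f\<close>. The
  second is \<open>\<integral> |F|\<^sup>2 |g'|\<^sup>2 (1 - |z|\<^sup>2)\<^sup>s\<close> with \<open>F(z) = (f(z) - f(a)) (1 - cnj a z)\<^sup>-\<^sup>s\<close>, up to the factor
  \<open>(1 - |a|\<^sup>2)\<^sup>s\<close>; here the measure \<open>|g'|\<^sup>2 (1 - |z|\<^sup>2)\<^sup>s\<close> is a Carleson measure for the Dirichlet-type
  space with reproducing kernel \<open>(1 - z cnj w)\<^sup>-\<^sup>s\<close>, by Schur's test: the logarithmic factor makes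
  the dyadic sum in \<open>\<integral> |1 - cnj w z|\<^sup>-\<^sup>s\<close> converge like \<open>\<Sum> 1/k\<^sup>2\<close>.

  For necessity no closed graph theorem is used. If the condition on \<open>g\<close> failed along points
  \<open>a\<^sub>n\<close>, a single function \<open>\<Sum> 2\<^sup>-\<^sup>n f\<^sub>n\<close> with test functions \<open>f\<^sub>n\<close> peaking at \<open>a\<^sub>n\<close> would be mapped out
  of \<open>Q_s\<close>; as the \<open>f\<^sub>n\<close> (or their derivatives) have positive real part, no cancellation between
  the summands can occur.
\<close>

subsection \<open>Lebesgue measure on the plane\<close>

text \<open>The exponent \<open>s1\<close> leaves no trace in the criteria for two reasons. The
  weights are at most 1, so Q_{s1} lies in Q_{s2}; and the test functions belong to Q_s for every 0
  < s \<le> 1, so necessity can start from any \<open>s1\<close>. In the sufficiency part the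
  obstacle is that f - f(a) is unbounded. It grows only logarithmically in 1 / (1 - |phi_a|), hence
  more slowly than any power, so half of the exponent \<open>s\<close> is spent on it; the other
  half still makes the kernels 1 / (1 - cnj a z) uniformly square integrable. In the necessity part
  a logarithmic test function has size log (2 / (1 - |a|)) only near a, so the condition is first
  obtained on the boxes |1 - cnj a z| \<le> 2 (1 - |a|). Passing to the full weight costs a factor
  quadratic in the dyadic index, which the geometric decay of the weight absorbs. The factors 2^-n
  of the test series decide how fast the assumed violation has to grow: 8^n for quantities quadratic
  in f, 4^n for the size of g.\<close>

lemma lborel_complex_pair: "distr lborel borel (\<lambda>(x, y). Complex x y) = lborel"
proof (rule lborel_eqI[symmetric])
  fix l u :: complex
  assume le: "\<And>b. b \<in> Basis \<Longrightarrow> l \<bullet> b \<le> u \<bullet> b"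
  have m: "(\<lambda>(x, y). Complex x y) \<in> borel \<rightarrow>\<^sub>M borel"
    by (intro borel_measurable_continuous_onI) (auto simp: case_prod_beta' Complex_eq intro!: continuous_intros)
  have re: "Re l \<le> Re u" "Im l \<le> Im u" using le[of 1] le[of \<i>] by (auto simp: Basis_complex_def)
  have vi: "(\<lambda>(x, y). Complex x y) -` box l u = box (Re l, Im l) (Re u, Im u)"
    by (auto simp: box_def Basis_complex_def Basis_prod_def)
  have "emeasure (distr lborel borel (\<lambda>(x, y). Complex x y)) (box l u) = emeasure lborel (box (Re l, Im l) (Re u, Im u))"
    using m by (subst emeasure_distr) (auto simp: vi)
  also have "\<dots> = ennreal (\<Prod>b\<in>Basis. ((Re u, Im u) - (Re l, Im l)) \<bullet> b)"
    by (subst emeasure_lborel_box) (auto simp: Basis_prod_def re)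
  also have "(\<Prod>b\<in>Basis. ((Re u, Im u) - (Re l, Im l)) \<bullet> b) = (\<Prod>b\<in>Basis. (u - l) \<bullet> b)"
    by (simp add: Basis_prod_def Basis_complex_def prod.union_disjoint)
  finally show "emeasure (distr lborel borel (\<lambda>(x, y). Complex x y)) (box l u) = ennreal (\<Prod>b\<in>Basis. (u - l) \<bullet> b)" .
qed simp

lemma nn_integral_complex_pair:
  assumes [measurable]: "f \<in> borel_measurable borel"
  shows "(\<integral>\<^sup>+ z. f z \<partial>lborel) = (\<integral>\<^sup>+ x. \<integral>\<^sup>+ y. f (Complex x y) \<partial>lborel \<partial>lborel)"
    and "(\<integral>\<^sup>+ z. f z \<partial>lborel) = (\<integral>\<^sup>+ y. \<integral>\<^sup>+ x. f (Complex x y) \<partial>lborel \<partial>lborel)"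
proof -
  have m[measurable]: "(\<lambda>(x, y). Complex x y) \<in> borel \<Otimes>\<^sub>M borel \<rightarrow>\<^sub>M borel"
    unfolding borel_prod
    by (intro borel_measurable_continuous_onI) (auto simp: case_prod_beta' Complex_eq intro!: continuous_intros)
  have "(\<integral>\<^sup>+ z. f z \<partial>lborel) = (\<integral>\<^sup>+ p. f (case p of (x, y) \<Rightarrow> Complex x y) \<partial>(lborel \<Otimes>\<^sub>M lborel))"
    using m by (subst lborel_complex_pair[symmetric], subst nn_integral_distr) (auto simp: borel_prod lborel_prod)
  also have "\<dots> = (\<integral>\<^sup>+ x. \<integral>\<^sup>+ y. f (Complex x y) \<partial>lborel \<partial>lborel)"
    by (subst lborel.nn_integral_fst[symmetric]) auto
  finally show 1: "(\<integral>\<^sup>+ z. f z \<partial>lborel) = (\<integral>\<^sup>+ x. \<integral>\<^sup>+ y. f (Complex x y) \<partial>lborel \<partial>lborel)" .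
  also have "\<dots> = (\<integral>\<^sup>+ y. \<integral>\<^sup>+ x. f (Complex x y) \<partial>lborel \<partial>lborel)"
    by (rule lborel_pair.Fubini'[symmetric]) measurable
  finally show "(\<integral>\<^sup>+ z. f z \<partial>lborel) = (\<integral>\<^sup>+ y. \<integral>\<^sup>+ x. f (Complex x y) \<partial>lborel \<partial>lborel)" .
qed

lemma nn_integral_translate_real:
  fixes f :: "real \<Rightarrow> ennreal"
  assumes [measurable]: "f \<in> borel_measurable borel"
  shows "(\<integral>\<^sup>+ x. f (x + t) \<partial>lborel) = (\<integral>\<^sup>+ x. f x \<partial>lborel)"
  using nn_integral_real_affine[of f 1 t] by (simp add: add.commute)

text \<open>By Fubini a shear is a translation on each line parallel to a coordinate axis, so
  one-dimensional translation invariance suffices.\<close>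

lemma nn_integral_shear:
  assumes [measurable]: "f \<in> borel_measurable borel"
  shows "(\<integral>\<^sup>+ z. f (Complex (Re z + t * Im z) (Im z)) \<partial>lborel) = (\<integral>\<^sup>+ z. f z \<partial>lborel)"
    and "(\<integral>\<^sup>+ z. f (Complex (Re z) (Im z + t * Re z)) \<partial>lborel) = (\<integral>\<^sup>+ z. f z \<partial>lborel)"
proof -
  have [measurable]: "(\<lambda>z. Complex (Re z + t * Im z) (Im z)) \<in> borel_measurable borel"
       "(\<lambda>z. Complex (Re z) (Im z + t * Re z)) \<in> borel_measurable borel"
       "\<And>x. (\<lambda>y. Complex x y) \<in> borel_measurable borel" "\<And>y. (\<lambda>x. Complex x y) \<in> borel_measurable borel"
    by (intro borel_measurable_continuous_onI; auto simp: Complex_eq intro!: continuous_intros)+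
  show "(\<integral>\<^sup>+ z. f (Complex (Re z + t * Im z) (Im z)) \<partial>lborel) = (\<integral>\<^sup>+ z. f z \<partial>lborel)"
    apply (subst nn_integral_complex_pair(2), measurable)
    apply (subst nn_integral_complex_pair(2), measurable)
    apply simp
    apply (rule nn_integral_cong)
    subgoal for y by (rule nn_integral_translate_real[of "\<lambda>x. f (Complex x y)"]) measurable
    done
  show "(\<integral>\<^sup>+ z. f (Complex (Re z) (Im z + t * Re z)) \<partial>lborel) = (\<integral>\<^sup>+ z. f z \<partial>lborel)"
    apply (subst nn_integral_complex_pair(1), measurable)
    apply (subst nn_integral_complex_pair(1), measurable)
    apply simp
    apply (rule nn_integral_cong)
    subgoal for y by (rule nn_integral_translate_real[of "\<lambda>x. f (Complex y x)"]) measurable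
    done
qed

text \<open>A rotation other than the half turn is a product of three shears.\<close>

lemma nn_integral_rotate:
  assumes [measurable]: "f \<in> borel_measurable borel" and c: "cmod c = 1" "c \<noteq> -1"
  shows "(\<integral>\<^sup>+ z. f (c * z) \<partial>lborel) = (\<integral>\<^sup>+ z. f z \<partial>lborel)"
proof -
  define x y where "x = Re c" and "y = Im c"
  have n: "x\<^sup>2 + y\<^sup>2 = 1" using c(1) by (simp add: cmod_def x_def y_def)
  have x1: "x \<noteq> -1"
  proof
    assume "x = -1"
    with n have "y = 0" by simp
    with \<open>x = -1\<close> c(2) show False by (simp add: complex_eq_iff x_def y_def)
  qed
  \<comment> \<open>For \<open>c = cis \<theta>\<close> this is \<open>- tan (\<theta> / 2)\<close>,
    the parameter of the two outer shears; the middle one has parameter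
    \<open>y = sin \<theta>\<close>. The denominator is where \<open>c \<noteq> -1\<close>
    enters.\<close>
  define t where "t = - y / (1 + x)"
  define S where "S = (\<lambda>z. Complex (Re z + t * Im z) (Im z))"
  define R where "R = (\<lambda>z. Complex (Re z) (Im z + y * Re z))"
  have [measurable]: "S \<in> borel_measurable borel" "R \<in> borel_measurable borel" unfolding S_def R_def
    by (intro borel_measurable_continuous_onI; auto simp: Complex_eq intro!: continuous_intros)+
  have x1': "1 + x \<noteq> 0" using x1 by linarith
  have "y\<^sup>2 = (1 - x) * (1 + x)" using n by (simp add: algebra_simps power2_eq_square)
  hence ty: "t * y = x - 1" using x1' by (simp add: t_def field_simps power2_eq_square)
  have "t * (1 + x) = - y" using x1' by (simp add: t_def)
  hence t2: "t + (t * y + 1) * t = - y" unfolding ty by (simp add: algebra_simps)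
  have SRS: "S (R (S z)) = c * z" for z
  proof (rule complex_eqI)
    have "Re (S (R (S z))) = Re z + t * Im z + t * (Im z + y * (Re z + t * Im z))"
      by (simp add: S_def R_def)
    also have "\<dots> = (1 + t * y) * Re z + (t + (t * y + 1) * t) * Im z" by (simp add: algebra_simps)
    also have "\<dots> = Re (c * z)" unfolding t2 unfolding ty by (simp add: x_def y_def)
    finally show "Re (S (R (S z))) = Re (c * z)" .
    have "Im (S (R (S z))) = y * Re z + (1 + t * y) * Im z"
      by (simp add: S_def R_def algebra_simps)
    also have "\<dots> = Im (c * z)" unfolding ty by (simp add: x_def y_def)
    finally show "Im (S (R (S z))) = Im (c * z)" .
  qed
  have Sz: "Complex (Re z + t * Im z) (Im z) = S z" for z by (simp add: S_def)
  have Rz: "Complex (Re z) (Im z + y * Re z) = R z" for z by (simp add: R_def)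
  have "(\<integral>\<^sup>+ z. f (c * z) \<partial>lborel) = (\<integral>\<^sup>+ z. f (S (R (S z))) \<partial>lborel)" by (simp add: SRS)
  also have "\<dots> = (\<integral>\<^sup>+ z. f (S (R z)) \<partial>lborel)"
    by (rule nn_integral_shear(1)[of "\<lambda>z. f (S (R z))" t, unfolded Sz]) measurable
  also have "\<dots> = (\<integral>\<^sup>+ z. f (S z) \<partial>lborel)"
    by (rule nn_integral_shear(2)[of "\<lambda>z. f (S z)" y, unfolded Rz]) measurable
  also have "\<dots> = (\<integral>\<^sup>+ z. f z \<partial>lborel)"
    by (rule nn_integral_shear(1)[of f t, unfolded Sz]) measurable
  finally show ?thesis .
qed

lemma lborel_distr_rotate:
  assumes c: "cmod c = 1" "c \<noteq> -1"
  shows "distr lborel borel (\<lambda>z. c * z) = lborel"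
proof (rule measure_eqI)
  fix A assume A: "A \<in> sets (distr lborel borel (\<lambda>z. c * z))"
  hence [measurable]: "A \<in> sets borel" by simp
  have "emeasure (distr lborel borel (\<lambda>z. c * z)) A = (\<integral>\<^sup>+ z. indicator A z \<partial>distr lborel borel (\<lambda>z. c * z))" by simp
  also have "\<dots> = (\<integral>\<^sup>+ z. indicator A (c * z) \<partial>lborel)" by (subst nn_integral_distr) auto
  also have "\<dots> = emeasure lborel A" by (subst nn_integral_rotate[OF _ c]) auto
  finally show "emeasure (distr lborel borel (\<lambda>z. c * z)) A = emeasure lborel A" .
qed simp

lemma integral_rotate:
  fixes f :: "complex \<Rightarrow> complex"
  assumes [measurable]: "f \<in> borel_measurable borel" and c: "cmod c = 1" "c \<noteq> -1"
  shows "(\<integral> z. f (c * z) \<partial>lborel) = (\<integral> z. f z \<partial>lborel)"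
  by (subst (2) lborel_distr_rotate[OF c, symmetric], subst integral_distr) auto

subsection \<open>Area integrals of powers\<close>

lemma space_disc_area [simp]: "space disc_area = ball 0 1"
  by (simp add: disc_area_def space_scale_measure space_restrict_space)

lemma sets_disc_area [measurable_cong, simp]: "sets disc_area = sets (restrict_space borel (ball 0 1))"
  by (simp add: disc_area_def sets_restrict_space)

lemma measurable_disc_areaI:
  "continuous_on (ball 0 1) f \<Longrightarrow> f \<in> borel_measurable disc_area"
  using borel_measurable_continuous_on_restrict by (simp cong: measurable_cong_sets)

lemma measurable_disc_area_borel [measurable_dest]:
  "f \<in> borel_measurable borel \<Longrightarrow> f \<in> borel_measurable disc_area"
  by (simp add: measurable_restrict_space1 cong: measurable_cong_sets)

lemma nn_integral_disc_area:
  assumes "f \<in> borel_measurable disc_area"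
  shows "(\<integral>\<^sup>+ z. f z \<partial>disc_area) = ennreal (1 / pi) * (\<integral>\<^sup>+ z. f z * indicator (ball 0 1) z \<partial>lborel)"
proof -
  have "f \<in> borel_measurable (restrict_space lborel (ball 0 1))"
    using assms by (simp cong: measurable_cong_sets add: sets_restrict_space)
  then show ?thesis
    by (simp add: disc_area_def nn_integral_scale_measure nn_integral_restrict_space)
qed

lemma emeasure_disc_area:
  assumes "A \<in> sets borel" "A \<subseteq> ball 0 1"
  shows "emeasure disc_area A = ennreal (1 / pi) * emeasure lborel A"
  using assms by (simp add: disc_area_def emeasure_restrict_space)

lemma emeasure_disc_area_ball_le:
  assumes "A \<in> sets borel" "A \<subseteq> ball 0 1" "A \<subseteq> ball c r" "r \<ge> 0"
  shows "emeasure disc_area A \<le> ennreal (r\<^sup>2)"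
proof -
  have "emeasure disc_area A \<le> ennreal (1 / pi) * emeasure lborel (ball c r)"
    using assms by (simp add: emeasure_disc_area mult_left_mono emeasure_mono)
  also have "\<dots> = ennreal (1 / pi * (pi * r\<^sup>2))"
    using assms by (simp add: emeasure_ball unit_ball_vol_2 ennreal_mult'[symmetric])
  finally show ?thesis by simp
qed

text \<open>The factor \<open>1\<close> is kept so that the bound has the shape
  \<open>K * t\<^sup>2\<close> expected by the dyadic integral estimates.\<close>

lemma sublevel_disc_area:
  "t > 0 \<Longrightarrow> emeasure disc_area {z\<in>space disc_area. cmod (z - a) < t} \<le> ennreal (1 * t\<^sup>2)"
  unfolding space_disc_area mult_1
  by (rule emeasure_disc_area_ball_le[where c = a]) (measurable, auto simp: dist_norm norm_minus_commute)

text \<open>If |a| \<ge> 1/2, the set lies in the disc of radius 2t about 1 / cnj a. If |a| < 1/2,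
  the kernel denominator is at least 1/2 on the disc, so the set is empty for t \<le> 1/2, and for
  larger t the total area 1 is already below 4 t^2. The constant does not depend on a.\<close>

lemma sublevel_disc_area_kernel:
  assumes a: "cmod a < 1" and t: "t > 0"
  shows "emeasure disc_area {z\<in>space disc_area. cmod (1 - cnj a * z) < t} \<le> ennreal (4 * t\<^sup>2)"
proof -
  have m: "{z\<in>ball 0 1. cmod (1 - cnj a * z) < t} \<in> sets borel" by measurable
  show ?thesis
  proof (cases "cmod a < 1/2")
    case True
    show ?thesis
    proof (cases "t \<le> 1/2")
      case t: True
      have "cmod (1 - cnj a * z) \<ge> t" if "cmod z < 1" for z
      proof -
        have "cmod (cnj a * z) \<le> 1/2 * 1" unfolding norm_mult using True that by (intro mult_mono) auto
        thus ?thesis using norm_triangle_ineq2[of 1 "cnj a * z"] t by simp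
      qed
      hence "{z\<in>space disc_area. cmod (1 - cnj a * z) < t} = {}" by force
      thus ?thesis by (simp only: emeasure_empty zero_le)
    next
      case t: False
      have "emeasure disc_area {z\<in>ball 0 1. cmod (1 - cnj a * z) < t} \<le> ennreal (1\<^sup>2)"
        by (rule emeasure_disc_area_ball_le[OF m, where c = 0]) auto
      also have "\<dots> \<le> ennreal (4 * t\<^sup>2)" using t power_mono[of "1/2" t 2]
        by (intro ennreal_leI) (auto simp: power2_eq_square)
      finally show ?thesis by simp
    qed
  next
    case False
    hence a0: "cmod a \<ge> 1/2" "a \<noteq> 0" by auto
    have "cmod (z - 1 / cnj a) < 2 * t" if "cmod (1 - cnj a * z) < t" for z
    proof -
      have "1 - cnj a * z = - cnj a * (z - 1 / cnj a)" using a0 by (simp add: field_simps)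
      hence "cmod (1 - cnj a * z) = cmod a * cmod (z - 1 / cnj a)" by (simp only: norm_mult norm_minus_cancel complex_mod_cnj)
      also have "\<dots> \<ge> 1/2 * cmod (z - 1 / cnj a)" using a0 by (intro mult_right_mono) auto
      finally show ?thesis using that by simp
    qed
    hence "emeasure disc_area {z\<in>ball 0 1. cmod (1 - cnj a * z) < t} \<le> ennreal ((2 * t)\<^sup>2)"
      using t by (intro emeasure_disc_area_ball_le[OF m, where c = "1 / cnj a"]) (auto simp: dist_norm norm_minus_commute)
    thus ?thesis by (simp add: power2_eq_square)
  qed
qed

section \<open>Integrals of powers by dyadic decomposition\<close>

lemma ennreal_le_suminf:
  fixes f :: "nat \<Rightarrow> ennreal"
  shows "f k \<le> (\<Sum>n. f n)"
  using sum_le_suminf[of f "{k}"] by simp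

text \<open>The common frame of all dyadic estimates: the pieces \<open>g k\<close> only have to
  dominate \<open>f\<close> in sum, so a covering by overlapping shells serves as well as a
  partition.\<close>

lemma nn_integral_le_suminf:
  assumes "\<And>k. g k \<in> borel_measurable M"
    and "\<And>x. x \<in> space M \<Longrightarrow> f x \<le> (\<Sum>k. g k x)"
    and "\<And>k. (\<integral>\<^sup>+ x. g k x \<partial>M) \<le> ennreal (c k)" "\<And>k. c k \<ge> 0" "summable c"
  shows "(\<integral>\<^sup>+ x. f x \<partial>M) \<le> ennreal (\<Sum>k. c k)"
proof -
  have "(\<integral>\<^sup>+ x. f x \<partial>M) \<le> (\<integral>\<^sup>+ x. (\<Sum>k. g k x) \<partial>M)" by (intro nn_integral_mono assms)
  also have "\<dots> = (\<Sum>k. \<integral>\<^sup>+ x. g k x \<partial>M)" by (intro nn_integral_suminf assms)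
  also have "\<dots> \<le> (\<Sum>k. ennreal (c k))" by (intro suminf_le assms summableI)
  also have "\<dots> = ennreal (\<Sum>k. c k)" by (intro suminf_ennreal2 assms)
  finally show ?thesis .
qed

lemma dyadic_above:
  fixes v d :: real
  assumes "0 < d" "d \<le> v"
  obtains k :: nat where "2 ^ k * d \<le> v" "v < 2 ^ Suc k * d"
proof -
  obtain n :: nat where n: "v / d < 2 ^ n" using real_arch_pow[of 2 "v / d"] by auto
  define m where "m = (LEAST n::nat. v / d < 2 ^ n)"
  have m: "v / d < 2 ^ m" using LeastI[of "\<lambda>n. v / d < 2 ^ n", OF n] by (simp add: m_def)
  have "m \<noteq> 0"
  proof
    assume "m = 0" thus False using m assms by (simp add: field_simps)
  qed
  then obtain k where k: "m = Suc k" by (cases m) auto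
  have "\<not> v / d < 2 ^ k" using not_less_Least[of k "\<lambda>n. v / d < 2 ^ n"] k by (simp add: m_def)
  thus ?thesis using m k assms by (intro that[of k]) (auto simp: field_simps)
qed

lemma dyadic_below:
  fixes v d :: real
  assumes "0 < v" "v < d"
  obtains k :: nat where "d / 2 ^ Suc k \<le> v" "v < d / 2 ^ k"
proof -
  obtain n :: nat where n: "d / v \<le> 2 ^ n" using real_arch_pow[of 2 "d / v"] less_imp_le by auto
  define m where "m = (LEAST n::nat. d / v \<le> 2 ^ n)"
  have m: "d / v \<le> 2 ^ m" using LeastI[of "\<lambda>n. d / v \<le> 2 ^ n", OF n] by (simp add: m_def)
  have "m \<noteq> 0"
  proof
    assume "m = 0" thus False using m assms by (simp add: field_simps)
  qed
  then obtain k where k: "m = Suc k" by (cases m) auto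
  have "\<not> d / v \<le> 2 ^ k" using not_less_Least[of k "\<lambda>n. d / v \<le> 2 ^ n"] k by (simp add: m_def)
  thus ?thesis using m k assms by (intro that[of k]) (auto simp: field_simps)
qed

text \<open>On the shell \<open>d / 2 ^ Suc k \<le> v < d / 2 ^ k\<close> the integrand is at most
  its value at the inner radius, because \<open>p \<le> 2\<close>, and the shell has measure at most
  \<open>K * (d / 2 ^ k)\<^sup>2\<close>. The products form a geometric series of ratio
  \<open>2 powr - p\<close>.\<close>

lemma nn_integral_power_near:
  fixes v :: "'a \<Rightarrow> real"
  assumes [measurable]: "v \<in> borel_measurable M" and v0: "\<And>x. x \<in> space M \<Longrightarrow> v x \<ge> 0"
    and sub: "\<And>t. t > 0 \<Longrightarrow> emeasure M {x \<in> space M. v x < t} \<le> ennreal (K * t\<^sup>2)"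
    and K: "K \<ge> 0" and p: "0 < p" "p \<le> 2" and d: "d > 0"
  shows "(\<integral>\<^sup>+ x. ennreal (v x powr (p - 2)) * indicator {x. v x < d} x \<partial>M)
      \<le> ennreal (4 * K / (1 - 2 powr - p) * d powr p)"
proof -
  define c where "c k = K * d powr p * 2 powr (2 - p) * (2 powr (- p)) ^ k" for k :: nat
  define g where "g k x = ennreal ((d / 2 ^ Suc k) powr (p - 2)) * indicator {x\<in>space M. v x < d / 2 ^ k} x" for k :: nat and x
  have q: "2 powr (- p) < (1::real)" using p powr_less_mono[of "- p" 0 2] by simp
  have 1: "(\<integral>\<^sup>+ x. ennreal (v x powr (p - 2)) * indicator {x. v x < d} x \<partial>M) \<le> ennreal (\<Sum>k. c k)"
  proof (rule nn_integral_le_suminf)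
    show "g k \<in> borel_measurable M" for k unfolding g_def by measurable
    show "summable c" unfolding c_def using q by (intro summable_mult summable_geometric) auto
    show "c k \<ge> 0" for k using K by (simp add: c_def)
    show "(\<integral>\<^sup>+ x. g k x \<partial>M) \<le> ennreal (c k)" for k
    proof -
      have "(\<integral>\<^sup>+ x. g k x \<partial>M) = ennreal ((d / 2 ^ Suc k) powr (p - 2)) * emeasure M {x\<in>space M. v x < d / 2 ^ k}"
        unfolding g_def by (subst nn_integral_cmult_indicator) auto
      also have "\<dots> \<le> ennreal ((d / 2 ^ Suc k) powr (p - 2)) * ennreal (K * (d / 2 ^ k)\<^sup>2)"
        using d by (intro mult_left_mono sub) auto
      also have "\<dots> = ennreal ((d / 2 ^ Suc k) powr (p - 2) * (K * (d / 2 ^ k)\<^sup>2))"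
        using K by (intro ennreal_mult[symmetric]) auto
      also have "(d / 2 ^ Suc k) powr (p - 2) * (K * (d / 2 ^ k)\<^sup>2) = c k"
      proof -
        have e1: "d / 2 ^ k = d * 2 powr (- real k)" using d
          by (simp add: powr_minus powr_realpow field_simps)
        have e2: "d / 2 ^ Suc k = d * 2 powr (- real k - 1)" using d
          by (simp add: powr_diff powr_minus powr_realpow field_simps)
        have e3: "(d * 2 powr (- real k))\<^sup>2 = d powr 2 * 2 powr (- 2 * real k)"
        proof -
          have "(2 powr (- real k))\<^sup>2 = (2::real) powr (- real k + - real k)" by (simp only: power2_eq_square powr_add)
          thus ?thesis using d by (simp add: power_mult_distrib)
        qed
        have e4: "(2 powr (- p)) ^ k = (2::real) powr (- p * real k)" by (simp add: powr_powr flip: powr_realpow)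
        have "(d * 2 powr (- real k - 1)) powr (p - 2) = d powr (p - 2) * 2 powr ((- real k - 1) * (p - 2))"
          using d by (simp add: powr_mult powr_powr)
        hence "(d / 2 ^ Suc k) powr (p - 2) * (K * (d / 2 ^ k)\<^sup>2) =
           K * (d powr (p - 2) * d powr 2) * (2 powr ((- real k - 1) * (p - 2)) * 2 powr (- 2 * real k))"
          unfolding e1 e2 e3 by simp
        also have "\<dots> = K * d powr p * 2 powr ((2 - p) + - p * real k)"
          by (simp add: powr_add[symmetric] algebra_simps)
        also have "\<dots> = c k" unfolding c_def e4 powr_add by simp
        finally show ?thesis .
      qed
      finally show ?thesis .
    qed
    show "ennreal (v x powr (p - 2)) * indicator {x. v x < d} x \<le> (\<Sum>k. g k x)" if x: "x \<in> space M" for x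
    proof (cases "0 < v x \<and> v x < d")
      case True
      then obtain k where k: "d / 2 ^ Suc k \<le> v x" "v x < d / 2 ^ k" using dyadic_below[of "v x" d] by auto
      have "v x powr (p - 2) \<le> (d / 2 ^ Suc k) powr (p - 2)"
        using k d p by (intro powr_mono2') auto
      hence "ennreal (v x powr (p - 2)) * indicator {x. v x < d} x \<le> g k x"
        using k True x by (simp add: g_def ennreal_leI)
      also have "\<dots> \<le> (\<Sum>k. g k x)" by (rule ennreal_le_suminf)
      finally show ?thesis .
    next
      \<comment> \<open>Either \<open>v x \<ge> d\<close> and the indicator vanishes, or
        \<open>v x = 0\<close> and the convention \<open>0 powr y = 0\<close> makes the left-hand
        side zero.\<close>
      case False
      thus ?thesis using v0[OF x] by (auto simp: indicator_def)
    qed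
  qed
  have "(\<Sum>k. c k) = K * d powr p * 2 powr (2 - p) * (1 / (1 - 2 powr (- p)))"
    unfolding c_def using q by (subst suminf_mult) (auto intro!: summable_geometric simp: suminf_geometric)
  also have "\<dots> \<le> K * d powr p * 4 * (1 / (1 - 2 powr (- p)))"
    using K q p powr_mono[of "2 - p" 2 2] by (intro mult_right_mono mult_left_mono) auto
  also have "\<dots> = 4 * K / (1 - 2 powr - p) * d powr p" by simp
  finally have "ennreal (\<Sum>k. c k) \<le> ennreal (4 * K / (1 - 2 powr - p) * d powr p)" by (rule ennreal_leI)
  with 1 show ?thesis by (rule order_trans)
qed

text \<open>The counterpart at large \<open>v\<close>: on the shell
  \<open>2 ^ k * d \<le> v < 2 ^ Suc k * d\<close> the measure grows like 4^k while the integrand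
  decays like 2^(-(2 + p) k), leaving the ratio \<open>2 powr - p\<close>.\<close>

lemma nn_integral_power_far:
  fixes v :: "'a \<Rightarrow> real"
  assumes [measurable]: "v \<in> borel_measurable M"
    and sub: "\<And>t. t > 0 \<Longrightarrow> emeasure M {x \<in> space M. v x < t} \<le> ennreal (K * t\<^sup>2)"
    and K: "K \<ge> 0" and p: "0 < p" and d: "d > 0"
  shows "(\<integral>\<^sup>+ x. ennreal (v x powr (- 2 - p)) * indicator {x. d \<le> v x} x \<partial>M)
      \<le> ennreal (4 * K / (1 - 2 powr - p) * d powr - p)"
proof -
  define c where "c k = 4 * K * d powr (- p) * (2 powr (- p)) ^ k" for k :: nat
  define g where "g k x = ennreal ((2 ^ k * d) powr (- 2 - p)) * indicator {x\<in>space M. v x < 2 ^ Suc k * d} x" for k :: nat and x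
  have q: "2 powr (- p) < (1::real)" using p powr_less_mono[of "- p" 0 2] by simp
  have 1: "(\<integral>\<^sup>+ x. ennreal (v x powr (- 2 - p)) * indicator {x. d \<le> v x} x \<partial>M) \<le> ennreal (\<Sum>k. c k)"
  proof (rule nn_integral_le_suminf)
    show "g k \<in> borel_measurable M" for k unfolding g_def by measurable
    show "summable c" unfolding c_def using q by (intro summable_mult summable_geometric) auto
    show "c k \<ge> 0" for k using K by (simp add: c_def)
    show "(\<integral>\<^sup>+ x. g k x \<partial>M) \<le> ennreal (c k)" for k
    proof -
      have "(\<integral>\<^sup>+ x. g k x \<partial>M) = ennreal ((2 ^ k * d) powr (- 2 - p)) * emeasure M {x\<in>space M. v x < 2 ^ Suc k * d}"
        unfolding g_def by (subst nn_integral_cmult_indicator) auto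
      also have "\<dots> \<le> ennreal ((2 ^ k * d) powr (- 2 - p)) * ennreal (K * (2 ^ Suc k * d)\<^sup>2)"
        using d by (intro mult_left_mono sub) auto
      also have "\<dots> = ennreal ((2 ^ k * d) powr (- 2 - p) * (K * (2 ^ Suc k * d)\<^sup>2))"
        using K by (intro ennreal_mult[symmetric]) auto
      also have "(2 ^ k * d) powr (- 2 - p) * (K * (2 ^ Suc k * d)\<^sup>2) = c k"
      proof -
        have e0: "(2 ^ Suc k * d)\<^sup>2 = 4 * (2 ^ k * d) powr 2" using d by (simp add: power_mult_distrib)
        have "(2 ^ k * d) powr (- 2 - p) * (K * (2 ^ Suc k * d)\<^sup>2) = 4 * K * ((2 ^ k * d) powr (- 2 - p) * (2 ^ k * d) powr 2)"
          unfolding e0 by simp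
        also have "(2 ^ k * d) powr (- 2 - p) * (2 ^ k * d) powr 2 = (2 ^ k * d) powr (- p)"
          by (simp only: powr_add[symmetric]) simp
        also have "\<dots> = (2 powr (- p)) ^ k * d powr (- p)"
          using d by (simp add: powr_mult powr_powr mult.commute flip: powr_realpow)
        finally show ?thesis unfolding c_def by (simp only: mult_ac)
      qed
      finally show ?thesis .
    qed
    show "ennreal (v x powr (- 2 - p)) * indicator {x. d \<le> v x} x \<le> (\<Sum>k. g k x)" if x: "x \<in> space M" for x
    proof (cases "d \<le> v x")
      case True
      then obtain k where k: "2 ^ k * d \<le> v x" "v x < 2 ^ Suc k * d" using dyadic_above[of d "v x"] d by auto
      have "v x powr (- 2 - p) \<le> (2 ^ k * d) powr (- 2 - p)"
        using k d p by (intro powr_mono2') auto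
      hence "ennreal (v x powr (- 2 - p)) * indicator {x. d \<le> v x} x \<le> g k x"
        using k True x by (simp add: g_def ennreal_leI)
      also have "\<dots> \<le> (\<Sum>k. g k x)" by (rule ennreal_le_suminf)
      finally show ?thesis .
    qed auto
  qed
  have "(\<Sum>k. c k) = 4 * K * d powr (- p) * (1 / (1 - 2 powr (- p)))"
    unfolding c_def using q by (subst suminf_mult) (auto intro!: summable_geometric simp: suminf_geometric)
  with 1 show ?thesis by simp
qed

subsection \<open>Moebius weights\<close>

abbreviation disc_weight :: "complex \<Rightarrow> complex \<Rightarrow> real" where
  "disc_weight a z \<equiv> 1 - (cmod (disc_phi a z))\<^sup>2"

text \<open>The function \<open>h\<close> stands in the place of f'. Leaving it arbitrary allows the
  same notation for derivatives, for products such as \<open>deriv g z * f z\<close>, and for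
  kernels.\<close>

definition qint :: "real \<Rightarrow> (complex \<Rightarrow> complex) \<Rightarrow> complex \<Rightarrow> ennreal" where
  "qint s h a = (\<integral>\<^sup>+ z. ennreal ((cmod (h z))\<^sup>2 * disc_weight a z powr s) \<partial>disc_area)"

lemma norm_one_minus_cnj_mult:
  assumes "cmod a < 1" "cmod z < 1"
  shows "1 - cmod a \<le> cmod (1 - cnj a * z)" "1 - cmod z \<le> cmod (1 - cnj a * z)"
    "0 < cmod (1 - cnj a * z)" "1 - cnj a * z \<noteq> 0" "cmod (1 - cnj a * z) < 2"
proof -
  have n: "cmod (cnj a * z) = cmod a * cmod z" by (simp add: norm_mult)
  have "cmod a * cmod z \<le> cmod a" "cmod a * cmod z \<le> cmod z"
    using assms by (auto intro: mult_left_le mult_left_le_one_le)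
  thus "1 - cmod a \<le> cmod (1 - cnj a * z)" "1 - cmod z \<le> cmod (1 - cnj a * z)"
    using norm_triangle_ineq2[of 1 "cnj a * z"] n by auto
  thus p: "0 < cmod (1 - cnj a * z)" using assms by linarith
  thus "1 - cnj a * z \<noteq> 0" by auto
  have "cmod a * cmod z \<le> cmod z" using assms by (intro mult_left_le_one_le) auto
  thus "cmod (1 - cnj a * z) < 2"
    using norm_triangle_ineq4[of 1 "cnj a * z"] n assms by auto
qed

lemma Re_one_minus_cnj_mult_pos:
  assumes "cmod a < 1" "cmod z < 1"
  shows "Re (1 - cnj a * z) > 0"
proof -
  have "Re (cnj a * z) \<le> cmod (cnj a * z)" by (rule complex_Re_le_cmod)
  also have "\<dots> \<le> cmod a * 1" unfolding norm_mult complex_mod_cnj using assms by (intro mult_left_mono) auto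
  also have "\<dots> < 1" using assms by simp
  finally show ?thesis by simp
qed

lemma norm_diff_disc_phi_identity:
  "(cmod (1 - cnj a * z))\<^sup>2 - (cmod (a - z))\<^sup>2 = (1 - (cmod a)\<^sup>2) * (1 - (cmod z)\<^sup>2)"
  unfolding cmod_power2 by (simp add: algebra_simps power2_eq_square)

lemma one_minus_disc_phi:
  assumes "cmod a < 1" "cmod z < 1"
  shows "1 - (cmod (disc_phi a z))\<^sup>2 = (1 - (cmod a)\<^sup>2) * (1 - (cmod z)\<^sup>2) / (cmod (1 - cnj a * z))\<^sup>2"
  using norm_diff_disc_phi_identity[of a z] norm_one_minus_cnj_mult(3)[OF assms]
  by (simp add: disc_phi_def norm_divide power_divide field_simps)

lemma one_minus_norm_square:
  assumes "cmod z < 1"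
  shows "0 < 1 - (cmod z)\<^sup>2" "1 - cmod z \<le> 1 - (cmod z)\<^sup>2" "1 - (cmod z)\<^sup>2 \<le> 2 * (1 - cmod z)" "1 - (cmod z)\<^sup>2 \<le> 1"
proof -
  have e: "1 - (cmod z)\<^sup>2 = (1 - cmod z) * (1 + cmod z)" by (simp add: power2_eq_square algebra_simps)
  show "0 < 1 - (cmod z)\<^sup>2" unfolding e using assms by (intro mult_pos_pos) (auto simp: add_pos_nonneg)
  have "(1 - cmod z) * 1 \<le> (1 - cmod z) * (1 + cmod z)" using assms by (intro mult_left_mono) auto
  thus "1 - cmod z \<le> 1 - (cmod z)\<^sup>2" unfolding e by simp
  have "(1 - cmod z) * (1 + cmod z) \<le> (1 - cmod z) * 2" using assms by (intro mult_left_mono) auto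
  thus "1 - (cmod z)\<^sup>2 \<le> 2 * (1 - cmod z)" unfolding e by simp
qed simp

lemma continuous_on_radial_weight:
  "continuous_on (ball 0 1) (\<lambda>z::complex. (1 - (cmod z)\<^sup>2) powr s)"
  using one_minus_norm_square(1) by (intro continuous_intros) force

lemma one_minus_disc_phi_bounds:
  assumes "cmod a < 1" "cmod z < 1"
  shows "0 < 1 - (cmod (disc_phi a z))\<^sup>2" "1 - (cmod (disc_phi a z))\<^sup>2 \<le> 1" "cmod (disc_phi a z) < 1"
proof -
  show p: "0 < 1 - (cmod (disc_phi a z))\<^sup>2"
    unfolding one_minus_disc_phi[OF assms]
    using one_minus_norm_square(1)[OF assms(1)] one_minus_norm_square(1)[OF assms(2)] norm_one_minus_cnj_mult(3)[OF assms]
    by simp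
  thus "cmod (disc_phi a z) < 1" by (simp add: abs_square_less_1)
qed simp

lemma continuous_on_disc_phi:
  assumes "cmod a < 1"
  shows "continuous_on (ball 0 1) (disc_phi a)"
  unfolding disc_phi_def using norm_one_minus_cnj_mult(4)[OF assms]
  by (intro continuous_intros) auto

lemma continuous_on_weight:
  assumes "cmod a < 1"
  shows "continuous_on (ball 0 1) (\<lambda>z. disc_weight a z powr s)"
  using one_minus_disc_phi_bounds(1)[OF assms]
  by (intro continuous_intros continuous_on_disc_phi assms) force

lemma measurable_weight:
  assumes "cmod a < 1"
  shows "(\<lambda>z. disc_weight a z powr s) \<in> borel_measurable disc_area"
  by (intro measurable_disc_areaI continuous_on_weight assms)

lemma weight_eq:
  assumes "cmod a < 1" "cmod z < 1"
  shows "disc_weight a z powr s =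
    (1 - (cmod a)\<^sup>2) powr s * (1 - (cmod z)\<^sup>2) powr s * cmod (1 - cnj a * z) powr (- 2 * s)"
proof -
  let ?u = "1 - (cmod a)\<^sup>2" and ?v = "1 - (cmod z)\<^sup>2" and ?y = "cmod (1 - cnj a * z)"
  have "(?u * ?v / ?y\<^sup>2) powr s = (?u * ?v) powr s / (?y\<^sup>2) powr s"
    by (rule powr_divide)
  also have "(?y\<^sup>2) powr s = ?y powr (2 * s)"
    using norm_one_minus_cnj_mult(3)[OF assms] by (simp add: powr_powr flip: powr_numeral)
  also have "(?u * ?v) powr s = ?u powr s * ?v powr s"
    by (rule powr_mult)
  also have "?u powr s * ?v powr s / ?y powr (2 * s) = ?u powr s * ?v powr s * ?y powr (- 2 * s)"
    by (simp add: powr_minus_divide)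
  finally show ?thesis unfolding one_minus_disc_phi[OF assms] .
qed

lemma qint_mono:
  assumes "\<And>z. cmod z < 1 \<Longrightarrow> cmod (h z) \<le> c * cmod (k z)" "c \<ge> 0" "cmod a < 1"
    "k \<in> borel_measurable disc_area"
  shows "qint s h a \<le> ennreal (c\<^sup>2) * qint s k a"
proof -
  note [measurable] = measurable_weight[OF assms(3)] assms(4)
  have "qint s h a \<le> (\<integral>\<^sup>+ z. ennreal (c\<^sup>2) * ennreal ((cmod (k z))\<^sup>2 * disc_weight a z powr s) \<partial>disc_area)"
    unfolding qint_def
  proof (intro nn_integral_mono)
    fix z assume "z \<in> space disc_area"
    hence z: "cmod z < 1" by simp
    have "(cmod (h z))\<^sup>2 \<le> (c * cmod (k z))\<^sup>2" using assms(1)[OF z] by (intro power_mono) auto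
    hence "(cmod (h z))\<^sup>2 * disc_weight a z powr s \<le> c\<^sup>2 * ((cmod (k z))\<^sup>2 * disc_weight a z powr s)"
      by (simp add: power_mult_distrib mult.assoc[symmetric] mult_right_mono)
    thus "ennreal ((cmod (h z))\<^sup>2 * disc_weight a z powr s)
       \<le> ennreal (c\<^sup>2) * ennreal ((cmod (k z))\<^sup>2 * disc_weight a z powr s)"
      by (simp add: ennreal_mult'[symmetric] ennreal_leI)
  qed
  also have "\<dots> = ennreal (c\<^sup>2) * qint s k a"
    unfolding qint_def by (rule nn_integral_cmult) measurable
  finally show ?thesis .
qed

text \<open>The Moebius weight lies in (0, 1], so a larger exponent makes it smaller; this is the
  source of the inclusion of Q_{s1} in Q_{s2}.\<close>

lemma qint_exponent_mono:
  assumes "s1 \<le> s2" "cmod a < 1"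
  shows "qint s2 h a \<le> qint s1 h a"
  unfolding qint_def
proof (intro nn_integral_mono ennreal_leI mult_left_mono)
  fix z assume "z \<in> space disc_area"
  hence z: "cmod z < 1" by simp
  show "disc_weight a z powr s2 \<le> disc_weight a z powr s1"
    using one_minus_disc_phi_bounds[OF assms(2) z] assms(1) by (intro powr_mono') auto
qed auto

lemma sum_square_le: "(x + y)\<^sup>2 \<le> 2 * x\<^sup>2 + 2 * (y::real)\<^sup>2"
  using sum_squares_bound[of x y] by (simp add: power2_sum)

lemma qint_add:
  assumes "\<And>z. cmod z < 1 \<Longrightarrow> cmod (h z) \<le> cmod (k z) + cmod (l z)" "cmod a < 1"
    "k \<in> borel_measurable disc_area" "l \<in> borel_measurable disc_area"
  shows "qint s h a \<le> 2 * qint s k a + 2 * qint s l a"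
proof -
  note [measurable] = measurable_weight[OF assms(2)] assms(3,4)
  let ?w = "\<lambda>z. disc_weight a z powr s"
  have "qint s h a \<le> (\<integral>\<^sup>+ z. 2 * ennreal ((cmod (k z))\<^sup>2 * ?w z) + 2 * ennreal ((cmod (l z))\<^sup>2 * ?w z) \<partial>disc_area)"
    unfolding qint_def
  proof (intro nn_integral_mono)
    fix z assume "z \<in> space disc_area"
    hence z: "cmod z < 1" by simp
    have "(cmod (h z))\<^sup>2 \<le> (cmod (k z) + cmod (l z))\<^sup>2" using assms(1)[OF z] by (intro power_mono) auto
    also note sum_square_le
    finally have "(cmod (h z))\<^sup>2 * ?w z \<le> (2 * (cmod (k z))\<^sup>2 + 2 * (cmod (l z))\<^sup>2) * ?w z"
      by (rule mult_right_mono) simp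
    also have "\<dots> = 2 * ((cmod (k z))\<^sup>2 * ?w z) + 2 * ((cmod (l z))\<^sup>2 * ?w z)" by (simp add: algebra_simps)
    finally have "ennreal ((cmod (h z))\<^sup>2 * ?w z) \<le> ennreal (2 * ((cmod (k z))\<^sup>2 * ?w z) + 2 * ((cmod (l z))\<^sup>2 * ?w z))"
      by (rule ennreal_leI)
    also have "\<dots> = 2 * ennreal ((cmod (k z))\<^sup>2 * ?w z) + 2 * ennreal ((cmod (l z))\<^sup>2 * ?w z)"
      by (subst ennreal_plus) (auto simp: ennreal_mult')
    finally show "ennreal ((cmod (h z))\<^sup>2 * ?w z) \<le> 2 * ennreal ((cmod (k z))\<^sup>2 * ?w z) + 2 * ennreal ((cmod (l z))\<^sup>2 * ?w z)" .
  qed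
  also have "\<dots> = 2 * qint s k a + 2 * qint s l a"
    unfolding qint_def by (simp add: nn_integral_add nn_integral_cmult)
  finally show ?thesis .
qed

text \<open>The product of two kernels is reduced to powers of one distance at a time. Up to
  constants the weight is (d w / y^2)^s with w = 1 - |z|^2 \<le> 2 min(x, y). If x \<le> y, the
  bound w \<le> 2x is used, and then y is replaced by the larger of d and x, which gives the first
  two terms. If y < x, the bounds w \<le> 2y and x^-2 \<le> y^-2 leave only y. The constant 4 comes
  from w \<le> 2x (or 2y) and 1 - |b|^2 \<le> 2d.\<close>

lemma kernel_weight_le:
  assumes s: "0 < s" "s \<le> 2" and a: "cmod a < 1" and b: "cmod b < 1" and z: "cmod z < 1"
  defines "x \<equiv> cmod (1 - cnj a * z)" and "y \<equiv> cmod (1 - cnj b * z)" and "d \<equiv> 1 - cmod b"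
  shows "x powr - 2 * disc_weight b z powr s \<le>
     4 powr s * (d powr - s * (if x < d then x powr (s - 2) else 0) +
       d powr s * (if d \<le> x then x powr (- 2 - s) else 0) + d powr s * (if d \<le> y then y powr (- 2 - s) else 0))"
proof -
  define w where "w = 1 - (cmod z)\<^sup>2"
  have x0: "x > 0" and y0: "y > 0" and yd: "d \<le> y" and d0: "d > 0"
    using norm_one_minus_cnj_mult[OF a z] norm_one_minus_cnj_mult[OF b z] b by (auto simp: x_def y_def d_def)
  have w0: "w > 0" and wx: "w \<le> 2 * x" and wy: "w \<le> 2 * y" and db: "1 - (cmod b)\<^sup>2 \<le> 2 * d"
    using norm_one_minus_cnj_mult(2)[OF a z] norm_one_minus_cnj_mult(2)[OF b z]
      one_minus_norm_square[OF z] one_minus_norm_square[OF b] by (auto simp: x_def y_def d_def w_def)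
  let ?R = "\<lambda>t. (2 * d) powr s * (2 * t) powr s * y powr (- 2 * s)"
  have le: "disc_weight b z powr s \<le> ?R t" if "w \<le> 2 * t" for t
  proof -
    have "disc_weight b z powr s = (1 - (cmod b)\<^sup>2) powr s * w powr s * y powr (- 2 * s)"
      unfolding weight_eq[OF b z] w_def y_def ..
    also have "\<dots> \<le> ?R t"
      using db that s w0 one_minus_norm_square(1)[OF b] by (intro mult_right_mono mult_mono powr_mono2) auto
    finally show ?thesis .
  qed
  have R: "?R t = 4 powr s * d powr s * t powr s * y powr (- 2 * s)" if "t > 0" for t
  proof -
    have "(4::real) powr s = (2 * 2) powr s" by simp
    also have "\<dots> = 2 powr s * 2 powr s" by (subst powr_mult) auto
    finally show ?thesis using d0 that by (simp add: powr_mult)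
  qed
  show ?thesis
  proof (cases "x \<le> y")
    case True
    have "x powr - 2 * disc_weight b z powr s \<le> x powr - 2 * ?R x"
      using le[OF wx] by (intro mult_left_mono) auto
    also have "\<dots> = 4 powr s * d powr s * (x powr -2 * x powr s) * y powr (- 2 * s)" unfolding R[OF x0] by simp
    also have "x powr -2 * x powr s = x powr (s - 2)" by (simp only: powr_add[symmetric]) simp
    finally have 1: "x powr - 2 * disc_weight b z powr s \<le> 4 powr s * d powr s * x powr (s - 2) * y powr (- 2 * s)" .
    show ?thesis
    proof (cases "x < d")
      case xd: True
      have "y powr (- 2 * s) \<le> d powr (- 2 * s)" using yd d0 s by (intro powr_mono2') auto
      hence "4 powr s * d powr s * x powr (s - 2) * y powr (- 2 * s) \<le> 4 powr s * d powr s * x powr (s - 2) * d powr (- 2 * s)"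
        by (intro mult_left_mono) auto
      also have "\<dots> = 4 powr s * (d powr s * d powr (- 2 * s) * x powr (s - 2))" by simp
      also have "d powr s * d powr (- 2 * s) = d powr - s" by (simp only: powr_add[symmetric]) simp
      finally have "4 powr s * d powr s * x powr (s - 2) * y powr (- 2 * s) \<le> 4 powr s * (d powr - s * x powr (s - 2))" .
      also have "\<dots> \<le> 4 powr s * (d powr - s * x powr (s - 2) + d powr s * (if d \<le> y then y powr (- 2 - s) else 0))"
        by (intro mult_left_mono) auto
      finally have 2: "4 powr s * d powr s * x powr (s - 2) * y powr (- 2 * s) \<le>
        4 powr s * (d powr - s * x powr (s - 2) + d powr s * (if d \<le> y then y powr (- 2 - s) else 0))" .
      have "(x < d) = True" "(d \<le> x) = False" using xd by auto
      thus ?thesis using order_trans[OF 1 2] by (simp only: if_True if_False mult_zero_right add_0_right)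
    next
      case xd: False
      have "y powr (- 2 * s) \<le> x powr (- 2 * s)" using True x0 s by (intro powr_mono2') auto
      hence "4 powr s * d powr s * x powr (s - 2) * y powr (- 2 * s) \<le> 4 powr s * d powr s * x powr (s - 2) * x powr (- 2 * s)"
        by (intro mult_left_mono) auto
      also have "\<dots> = 4 powr s * (d powr s * (x powr (s - 2) * x powr (- 2 * s)))" by simp
      also have "x powr (s - 2) * x powr (- 2 * s) = x powr (- 2 - s)" by (simp only: powr_add[symmetric]) (rule arg_cong[where f = "\<lambda>t. x powr t"], simp)
      finally have "4 powr s * d powr s * x powr (s - 2) * y powr (- 2 * s) \<le> 4 powr s * (d powr s * x powr (- 2 - s))" .
      also have "\<dots> \<le> 4 powr s * (d powr s * x powr (- 2 - s) + d powr s * (if d \<le> y then y powr (- 2 - s) else 0))"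
        by (intro mult_left_mono) auto
      finally have 2: "4 powr s * d powr s * x powr (s - 2) * y powr (- 2 * s) \<le>
        4 powr s * (d powr s * x powr (- 2 - s) + d powr s * (if d \<le> y then y powr (- 2 - s) else 0))" .
      have "(x < d) = False" "(d \<le> x) = True" using xd by auto
      thus ?thesis using order_trans[OF 1 2] by (simp only: if_True if_False mult_zero_right add_0_left)
    qed
  next
    case False
    have "x powr - 2 * disc_weight b z powr s \<le> y powr - 2 * ?R y"
      using le[OF wy] False y0 by (intro mult_mono powr_mono2') auto
    also have "\<dots> = 4 powr s * (d powr s * (y powr -2 * y powr s * y powr (- 2 * s)))" unfolding R[OF y0] by simp
    also have "y powr -2 * y powr s * y powr (- 2 * s) = y powr (- 2 - s)" by (simp only: powr_add[symmetric]) (rule arg_cong[where f = "\<lambda>t. y powr t"], simp)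
    also have "4 powr s * (d powr s * y powr (- 2 - s)) \<le> 4 powr s * (d powr - s * (if x < d then x powr (s - 2) else 0) +
       d powr s * (if d \<le> x then x powr (- 2 - s) else 0) + d powr s * (if d \<le> y then y powr (- 2 - s) else 0))"
      using yd by (intro mult_left_mono) auto
    finally show ?thesis .
  qed
qed

text \<open>After the pointwise reduction the near part integrates to a multiple of d^s and the two
  far parts to multiples of d^-s, exactly compensating the prefactors, so nothing depends on a or b.
  Up to a bounded factor the integrand is the derivative of a logarithmic test function.\<close>

lemma qint_kernel_le:
  assumes s: "0 < s" "s \<le> 2"
  obtains C where "C \<ge> 0"
    "\<And>a b. cmod a < 1 \<Longrightarrow> cmod b < 1 \<Longrightarrow> qint s (\<lambda>z. 1 / (1 - cnj a * z)) b \<le> ennreal C"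
proof -
  define K where "K = 4 * 4 / (1 - 2 powr - s)"
  have "2 powr (- s) < (1::real)" using s powr_less_mono[of "- s" 0 2] by simp
  hence K: "K \<ge> 0" by (simp add: K_def)
  have aux: "ennreal m * (ennreal t * ennreal u + ennreal v * ennreal w + ennreal x * ennreal y) = ennreal (m * (t * u + v * w + x * y))"
    if "m \<ge> 0" "t \<ge> 0" "u \<ge> 0" "v \<ge> 0" "w \<ge> 0" "x \<ge> 0" "y \<ge> 0" for m t u v w x y
    using that by (simp add: ennreal_mult)
  have aux2: "p * (K * q) + q * (K * p) + q * (K * p) = 3 * (K * (p * q))" for p q :: real
    by (simp add: algebra_simps)
  have main: "qint s (\<lambda>z. 1 / (1 - cnj a * z)) b \<le> ennreal (4 powr s * (3 * K))" if a: "cmod a < 1" and b: "cmod b < 1" for a b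
  proof -
    define x where "x = (\<lambda>z. cmod (1 - cnj a * z))"
    define y where "y = (\<lambda>z. cmod (1 - cnj b * z))"
    define d where "d = 1 - cmod b"
    have d: "d > 0" using b by (simp add: d_def)
    have mx[measurable]: "x \<in> borel_measurable disc_area" and my[measurable]: "y \<in> borel_measurable disc_area"
      unfolding x_def y_def by (intro measurable_disc_areaI continuous_intros)+
    have subx: "emeasure disc_area {z \<in> space disc_area. x z < t} \<le> ennreal (4 * t\<^sup>2)"
      and suby: "emeasure disc_area {z \<in> space disc_area. y z < t} \<le> ennreal (4 * t\<^sup>2)" if "t > 0" for t
      unfolding x_def y_def using sublevel_disc_area_kernel[OF a that] sublevel_disc_area_kernel[OF b that] by auto
    let ?A = "\<lambda>z. ennreal (x z powr (s - 2)) * indicator {z. x z < d} z"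
    let ?B = "\<lambda>z. ennreal (x z powr (- 2 - s)) * indicator {z. d \<le> x z} z"
    let ?C = "\<lambda>z. ennreal (y z powr (- 2 - s)) * indicator {z. d \<le> y z} z"
    have A: "(\<integral>\<^sup>+ z. ?A z \<partial>disc_area) \<le> ennreal (K * d powr s)" unfolding K_def
      by (rule nn_integral_power_near[OF mx _ subx]) (use s d in \<open>auto simp: x_def\<close>)
    have B: "(\<integral>\<^sup>+ z. ?B z \<partial>disc_area) \<le> ennreal (K * d powr - s)" unfolding K_def
      by (rule nn_integral_power_far[OF mx subx]) (use s d in auto)
    have C: "(\<integral>\<^sup>+ z. ?C z \<partial>disc_area) \<le> ennreal (K * d powr - s)" unfolding K_def
      by (rule nn_integral_power_far[OF my suby]) (use s d in auto)
    have "qint s (\<lambda>z. 1 / (1 - cnj a * z)) b \<le>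
       (\<integral>\<^sup>+ z. ennreal (4 powr s) * (ennreal (d powr - s) * ?A z + ennreal (d powr s) * ?B z + ennreal (d powr s) * ?C z) \<partial>disc_area)"
      unfolding qint_def
    proof (intro nn_integral_mono)
      fix z assume "z \<in> space disc_area"
      hence z: "cmod z < 1" by simp
      have x0: "x z > 0" using norm_one_minus_cnj_mult[OF a z] by (simp add: x_def)
      have e: "(cmod (1 / (1 - cnj a * z)))\<^sup>2 = x z powr - 2"
        using x0 by (simp add: x_def norm_divide power_divide powr_minus_divide)
      have "(cmod (1 / (1 - cnj a * z)))\<^sup>2 * disc_weight b z powr s \<le>
          4 powr s * (d powr - s * (if x z < d then x z powr (s - 2) else 0) +
       d powr s * (if d \<le> x z then x z powr (- 2 - s) else 0) + d powr s * (if d \<le> y z then y z powr (- 2 - s) else 0))"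
        unfolding e unfolding x_def y_def d_def by (rule kernel_weight_le[OF s a b z])
      hence "ennreal ((cmod (1 / (1 - cnj a * z)))\<^sup>2 * disc_weight b z powr s) \<le>
          ennreal (4 powr s * (d powr - s * (if x z < d then x z powr (s - 2) else 0) +
       d powr s * (if d \<le> x z then x z powr (- 2 - s) else 0) + d powr s * (if d \<le> y z then y z powr (- 2 - s) else 0)))"
        by (rule ennreal_leI)
      also have "\<dots> = ennreal (4 powr s) * (ennreal (d powr - s) * ?A z + ennreal (d powr s) * ?B z + ennreal (d powr s) * ?C z)"
        by (simp add: ennreal_mult indicator_def)
      finally show "ennreal ((cmod (1 / (1 - cnj a * z)))\<^sup>2 * disc_weight b z powr s) \<le>
         ennreal (4 powr s) * (ennreal (d powr - s) * ?A z + ennreal (d powr s) * ?B z + ennreal (d powr s) * ?C z)" .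
    qed
    also have "\<dots> = ennreal (4 powr s) * (ennreal (d powr - s) * (\<integral>\<^sup>+ z. ?A z \<partial>disc_area)
       + ennreal (d powr s) * (\<integral>\<^sup>+ z. ?B z \<partial>disc_area) + ennreal (d powr s) * (\<integral>\<^sup>+ z. ?C z \<partial>disc_area))"
      by (simp add: nn_integral_cmult nn_integral_add)
    also have "\<dots> \<le> ennreal (4 powr s) * (ennreal (d powr - s) * ennreal (K * d powr s)
       + ennreal (d powr s) * ennreal (K * d powr - s) + ennreal (d powr s) * ennreal (K * d powr - s))"
      by (intro mult_left_mono add_mono A B C) auto
    also have "\<dots> = ennreal (4 powr s * (d powr - s * (K * d powr s) + d powr s * (K * d powr - s) + d powr s * (K * d powr - s)))"
      using K by (intro aux) auto
    also have "d powr - s * (K * d powr s) + d powr s * (K * d powr - s) + d powr s * (K * d powr - s) = 3 * (K * (d powr - s * d powr s))"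
      by (rule aux2)
    also have "d powr - s * d powr s = 1" using d by (simp only: powr_add[symmetric]) simp
    finally show ?thesis by simp
  qed
  show ?thesis by (rule that[of "4 powr s * (3 * K)"]) (use main K in auto)
qed

subsection \<open>Parseval's identity for radial weights\<close>

lemma norm_powser_partial_sum_le:
  fixes a :: "nat \<Rightarrow> complex"
  assumes "summable (\<lambda>n. cmod (a n) * \<rho> ^ n)" "cmod z \<le> \<rho>"
  shows "cmod (\<Sum>n<K. a n * z ^ n) \<le> (\<Sum>n. cmod (a n) * \<rho> ^ n)"
proof -
  have \<rho>: "\<rho> \<ge> 0" using assms(2) norm_ge_zero order_trans by blast
  have "cmod (\<Sum>n<K. a n * z ^ n) \<le> (\<Sum>n<K. cmod (a n * z ^ n))" by (rule norm_sum)
  also have "\<dots> \<le> (\<Sum>n<K. cmod (a n) * \<rho> ^ n)" using assms(2)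
    by (intro sum_mono) (auto simp: norm_mult norm_power intro!: mult_left_mono power_mono)
  also have "\<dots> \<le> (\<Sum>n. cmod (a n) * \<rho> ^ n)" using \<rho> by (intro sum_le_suminf assms(1)) auto
  finally show ?thesis .
qed

text \<open>Radial symmetry makes the monomials orthogonal with respect to W. The support in
  \<open>cball 0 \<rho>\<close>, with \<rho> below the radius of holomorphy in the applications,
  gives absolute convergence of the power series and finite integrals. The instances are the
  indicator of a disc, for the mean value inequality, and a truncation of (1 - |z|^2)^s.\<close>

locale radial_weight =
  fixes W :: "complex \<Rightarrow> real" and \<rho> B :: real
  assumes \<rho>_nonneg: "0 \<le> \<rho>"
    and W_measurable [measurable]: "W \<in> borel_measurable borel"
    and W_nonneg: "0 \<le> W z" and W_le: "W z \<le> B"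
    and W_support: "\<rho> < cmod z \<Longrightarrow> W z = 0"
    and W_radial: "cmod c = 1 \<Longrightarrow> W (c * z) = W z"
begin

lemma integrable_W:
  fixes h :: "complex \<Rightarrow> 'a::{banach, second_countable_topology}"
  assumes "h \<in> borel_measurable borel" "\<And>z. cmod z \<le> \<rho> \<Longrightarrow> norm (h z) \<le> C"
  shows "integrable lborel (\<lambda>z. W z *\<^sub>R h z)"
proof (rule integrableI_bounded_set[where A = "cball 0 \<rho>" and B = "B * C"])
  show "emeasure lborel (cball 0 \<rho> :: complex set) < \<infinity>"
    using emeasure_lborel_cball_finite[of "0::complex" \<rho>] by simp
  show "AE z in lborel. z \<in> cball 0 \<rho> \<longrightarrow> norm (W z *\<^sub>R h z) \<le> B * C"
  proof (intro AE_I2 impI)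
    fix z :: complex assume "z \<in> cball 0 \<rho>"
    hence "norm (h z) \<le> C" using assms(2) by simp
    moreover have "0 \<le> B" using W_nonneg[of z] W_le[of z] by linarith
    ultimately show "norm (W z *\<^sub>R h z) \<le> B * C"
      using W_nonneg[of z] W_le[of z] by (auto intro!: mult_mono)
  qed
qed (use assms(1) W_support in auto)

lemma integral_monomials:
  assumes "n \<noteq> m"
  shows "(\<integral>z. W z *\<^sub>R (z ^ n * cnj z ^ m) \<partial>lborel) = 0"
proof -
  define k where "k = (if n > m then n - m else m - n)"
  have k: "k > 0" using assms by (auto simp: k_def)
  \<comment> \<open>The angle is chosen so that \<open>c ^ k = \<i>\<close>: the substitution z to c
    z then multiplies the integral by \<i> or its conjugate, which forces it to vanish. Being at
    most pi/2, the angle also keeps c away from the excluded half turn -1.\<close>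
  define c where "c = cis (pi / (2 * real k))"
  have c1: "cmod c = 1" by (simp add: c_def)
  have "real k * (pi / (2 * real k)) = pi / 2" using k by simp
  hence ck: "c ^ k = \<i>" by (simp only: c_def Complex.DeMoivre cis_pi_half)
  have "pi / (2 * real k) \<le> pi / 2" using k by (intro divide_left_mono) auto
  moreover have "pi / (2 * real k) \<ge> - (pi / 2)" by (rule order_trans[of _ 0]) auto
  ultimately have "Re c \<ge> 0" unfolding c_def by (simp add: cos_ge_zero)
  hence c2: "c \<noteq> -1" by auto
  define f where "f z = W z *\<^sub>R (z ^ n * cnj z ^ m)" for z
  have [measurable]: "f \<in> borel_measurable borel"
    unfolding f_def by (intro borel_measurable_scaleR W_measurable borel_measurable_continuous_onI continuous_intros)
  have cc: "c * cnj c = 1" using c1 by (simp flip: complex_norm_square)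
  define u where "u = c ^ n * cnj c ^ m"
  have u: "u \<noteq> 1"
  proof (cases "n > m")
    case True
    hence "u = c ^ k * (c * cnj c) ^ m" unfolding u_def k_def power_mult_distrib by (simp flip: power_add)
    thus ?thesis unfolding cc ck by (simp add: complex_eq_iff)
  next
    case False
    hence "u = cnj (c ^ k) * (c * cnj c) ^ n" unfolding u_def k_def power_mult_distrib by (simp flip: power_add)
    thus ?thesis unfolding cc ck by (simp add: complex_eq_iff)
  qed
  have fc: "f (c * z) = u * f z" for z
    unfolding f_def W_radial[OF c1] u_def by (simp add: power_mult_distrib scaleR_conv_of_real)
  have "(\<integral>z. f z \<partial>lborel) = (\<integral>z. f (c * z) \<partial>lborel)"
    by (rule integral_rotate[symmetric, OF _ c1 c2]) measurable
  also have "\<dots> = u * (\<integral>z. f z \<partial>lborel)" unfolding fc by simp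
  finally have "(u - 1) * (\<integral>z. f z \<partial>lborel) = 0" by (simp add: algebra_simps)
  thus ?thesis using u by (simp add: f_def)
qed

lemma integral_polynomial:
  fixes a :: "nat \<Rightarrow> complex"
  shows "(\<integral>z. W z * (cmod (\<Sum>n<K. a n * z ^ n))\<^sup>2 \<partial>lborel) =
    (\<Sum>n<K. (cmod (a n))\<^sup>2 * (\<integral>z. W z * cmod z ^ (2 * n) \<partial>lborel))"
proof -
  have int: "integrable lborel (\<lambda>z. W z *\<^sub>R (z ^ n * cnj z ^ m))" for n m
  proof (rule integrable_W[where C = "\<bar>\<rho>\<bar> ^ (n + m)"])
    show "cmod (z ^ n * cnj z ^ m) \<le> \<bar>\<rho>\<bar> ^ (n + m)" if "cmod z \<le> \<rho>" for z
      using that by (auto simp: norm_mult norm_power simp flip: power_add intro!: power_mono)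
  qed (intro borel_measurable_continuous_onI continuous_intros)
  have diag: "(\<integral>z. W z *\<^sub>R (z ^ n * cnj z ^ n) \<partial>lborel) = of_real (\<integral>z. W z * cmod z ^ (2 * n) \<partial>lborel)" for n
  proof -
    have "W z *\<^sub>R (z ^ n * cnj z ^ n) = of_real (W z * cmod z ^ (2 * n))" for z
      by (simp add: scaleR_conv_of_real power_mult flip: power_mult_distrib complex_norm_square)
    thus ?thesis by (simp only: integral_complex_of_real)
  qed
  have "of_real (\<integral>z. W z * (cmod (\<Sum>n<K. a n * z ^ n))\<^sup>2 \<partial>lborel) =
      (\<integral>z. complex_of_real (W z * (cmod (\<Sum>n<K. a n * z ^ n))\<^sup>2) \<partial>lborel)"
    by (rule integral_complex_of_real[symmetric])
  also have "\<dots> = (\<integral>z. (\<Sum>n<K. \<Sum>m<K. (a n * cnj (a m)) * (W z *\<^sub>R (z ^ n * cnj z ^ m))) \<partial>lborel)"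
  proof (rule Bochner_Integration.integral_cong[OF refl])
    fix z
    have "complex_of_real ((cmod (\<Sum>n<K. a n * z ^ n))\<^sup>2) = (\<Sum>n<K. a n * z ^ n) * cnj (\<Sum>n<K. a n * z ^ n)"
      by (rule complex_norm_square)
    also have "\<dots> = (\<Sum>n<K. \<Sum>m<K. (a n * z ^ n) * (cnj (a m) * cnj z ^ m))"
      by (simp add: sum_product)
    finally show "complex_of_real (W z * (cmod (\<Sum>n<K. a n * z ^ n))\<^sup>2) =
        (\<Sum>n<K. \<Sum>m<K. (a n * cnj (a m)) * (W z *\<^sub>R (z ^ n * cnj z ^ m)))"
      by (simp add: scaleR_conv_of_real sum_distrib_left mult_ac)
  qed
  also have "\<dots> = (\<Sum>n<K. \<Sum>m<K. (a n * cnj (a m)) * (\<integral>z. W z *\<^sub>R (z ^ n * cnj z ^ m) \<partial>lborel))"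
    by (simp only: int integrable_mult_right Bochner_Integration.integrable_sum Bochner_Integration.integral_sum integral_mult_right_zero)
  also have "\<dots> = (\<Sum>n<K. \<Sum>m<K. if m = n then (a n * cnj (a n)) * of_real (\<integral>z. W z * cmod z ^ (2 * n) \<partial>lborel) else 0)"
    by (intro sum.cong refl) (auto simp: integral_monomials diag)
  also have "\<dots> = (\<Sum>n<K. of_real ((cmod (a n))\<^sup>2) * of_real (\<integral>z. W z * cmod z ^ (2 * n) \<partial>lborel))"
    by (simp add: sum.delta flip: complex_norm_square)
  also have "\<dots> = of_real (\<Sum>n<K. (cmod (a n))\<^sup>2 * (\<integral>z. W z * cmod z ^ (2 * n) \<partial>lborel))" by simp
  finally show ?thesis by (simp only: of_real_eq_iff)
qed

text \<open>The identity for polynomials passes to the limit by dominated convergence: on the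
  support of W all partial sums are bounded by the absolute sum S at radius \<rho>, so W times the
  square of S is an integrable majorant.\<close>

lemma parseval:
  fixes a :: "nat \<Rightarrow> complex"
  assumes G: "\<And>z. cmod z \<le> \<rho> \<Longrightarrow> (\<lambda>n. a n * z ^ n) sums G z"
    and abs: "summable (\<lambda>n. cmod (a n) * \<rho> ^ n)"
  shows "(\<lambda>n. (cmod (a n))\<^sup>2 * (\<integral>z. W z * cmod z ^ (2 * n) \<partial>lborel)) sums (\<integral>z. W z * (cmod (G z))\<^sup>2 \<partial>lborel)"
    and "integrable lborel (\<lambda>z. W z * (cmod (G z))\<^sup>2)"
proof -
  define S where "S = (\<Sum>n. cmod (a n) * \<rho> ^ n)"
  define P where "P K z = (\<Sum>n<K. a n * z ^ n)" for K z
  have PS: "cmod (P K z) \<le> S" if "cmod z \<le> \<rho>" for K z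
    unfolding P_def S_def by (rule norm_powser_partial_sum_le[OF abs that])
  have [measurable]: "P K \<in> borel_measurable borel" for K
    unfolding P_def by (intro borel_measurable_continuous_onI continuous_intros)
  have lim: "(\<lambda>K. W z * (cmod (P K z))\<^sup>2) \<longlonglongrightarrow> W z * (cmod (G z))\<^sup>2" for z
  proof (cases "cmod z \<le> \<rho>")
    case True
    have "(\<lambda>K. P K z) \<longlonglongrightarrow> G z" using G[OF True] by (simp add: P_def sums_def)
    thus ?thesis by (intro tendsto_intros)
  next
    case False
    thus ?thesis using W_support by simp
  qed
  have Gm: "(\<lambda>z. W z * (cmod (G z))\<^sup>2) \<in> borel_measurable lborel"
    by (rule borel_measurable_LIMSEQ_real[OF lim]) measurable
  have dom: "integrable lborel (\<lambda>z. W z *\<^sub>R (S\<^sup>2))"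
    by (rule integrable_W[where C = "\<bar>S\<^sup>2\<bar>"]) auto
  have bd: "norm (W z * (cmod (P K z))\<^sup>2) \<le> W z *\<^sub>R (S\<^sup>2)" for K z
  proof (cases "cmod z \<le> \<rho>")
    case True
    thus ?thesis using PS[OF True] W_nonneg[of z] by (auto simp: abs_mult intro!: mult_left_mono power_mono)
  qed (use W_support in simp)
  have "(\<lambda>K. \<integral>z. W z * (cmod (P K z))\<^sup>2 \<partial>lborel) \<longlonglongrightarrow> (\<integral>z. W z * (cmod (G z))\<^sup>2 \<partial>lborel)"
    by (rule integral_dominated_convergence[OF Gm _ dom]) (use lim bd in auto)
  thus "(\<lambda>n. (cmod (a n))\<^sup>2 * (\<integral>z. W z * cmod z ^ (2 * n) \<partial>lborel)) sums (\<integral>z. W z * (cmod (G z))\<^sup>2 \<partial>lborel)"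
    unfolding sums_def P_def integral_polynomial .
  show "integrable lborel (\<lambda>z. W z * (cmod (G z))\<^sup>2)"
    by (rule integrable_dominated_convergence[OF Gm _ dom, where s = "\<lambda>K z. W z * (cmod (P K z))\<^sup>2"]) (use lim bd in auto)
qed

lemma bessel:
  assumes G: "G holomorphic_on ball 0 R" and R: "\<rho> < R"
  shows "(\<Sum>n<K. (cmod ((deriv ^^ n) G 0 / fact n))\<^sup>2 * (\<integral>z. W z * cmod z ^ (2 * n) \<partial>lborel))
      \<le> (\<integral>z. W z * (cmod (G z))\<^sup>2 \<partial>lborel)"
    and "integrable lborel (\<lambda>z. W z * (cmod (G z))\<^sup>2)"
proof -
  let ?a = "\<lambda>n. (deriv ^^ n) G 0 / fact n"
  have sm: "(\<lambda>n. ?a n * z ^ n) sums G z" if "cmod z < R" for z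
    using holomorphic_power_series[OF G, of z] that by simp
  have ab: "summable (\<lambda>n. cmod (?a n) * \<rho> ^ n)"
  proof -
    define r where "r = (\<rho> + R) / 2"
    have r: "\<rho> < r" "r < R" using R by (auto simp: r_def)
    have "summable (\<lambda>n. ?a n * of_real r ^ n)"
      using sums_summable[OF sm, of "of_real r"] r \<rho>_nonneg by simp
    hence "summable (\<lambda>n. cmod (?a n * of_real \<rho> ^ n))"
      by (rule powser_insidea) (use r \<rho>_nonneg in auto)
    thus ?thesis using \<rho>_nonneg by (simp only: norm_mult norm_power norm_of_real abs_of_nonneg)
  qed
  note p = parseval[OF sm ab]
  have s: "(\<lambda>n. (cmod (?a n))\<^sup>2 * (\<integral>z. W z * cmod z ^ (2 * n) \<partial>lborel)) sums (\<integral>z. W z * (cmod (G z))\<^sup>2 \<partial>lborel)"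
    by (rule p(1)) (use R in auto)
  have nn: "(cmod (?a n))\<^sup>2 * (\<integral>z. W z * cmod z ^ (2 * n) \<partial>lborel) \<ge> 0" for n
    using W_nonneg by (intro mult_nonneg_nonneg integral_nonneg_AE) auto
  show "(\<Sum>n<K. (cmod (?a n))\<^sup>2 * (\<integral>z. W z * cmod z ^ (2 * n) \<partial>lborel)) \<le> (\<integral>z. W z * (cmod (G z))\<^sup>2 \<partial>lborel)"
    unfolding sums_unique[OF s] by (rule sum_le_suminf[OF sums_summable[OF s]]) (use nn in auto)
  show "integrable lborel (\<lambda>z. W z * (cmod (G z))\<^sup>2)" by (rule p(2)) (use R in auto)
qed

end

section \<open>The mean value inequality on Euclidean discs\<close>

lemma nn_integral_translate:
  fixes f :: "complex \<Rightarrow> ennreal"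
  assumes [measurable]: "f \<in> borel_measurable borel"
  shows "(\<integral>\<^sup>+ z. f (a + z) \<partial>lborel) = (\<integral>\<^sup>+ z. f z \<partial>lborel)"
  by (subst (2) lborel_distr_plus[of a, symmetric], subst nn_integral_distr) auto

lemma nn_integral_translate_ball:
  fixes f :: "complex \<Rightarrow> real"
  assumes "continuous_on (ball a r) f"
  shows "(\<integral>\<^sup>+ z. ennreal (f (a + z)) * indicator (ball 0 r) z \<partial>lborel) = (\<integral>\<^sup>+ z. ennreal (f z) * indicator (ball a r) z \<partial>lborel)"
proof -
  have [measurable]: "(\<lambda>z. indicator (ball a r) z *\<^sub>R f z) \<in> borel_measurable borel"
    by (intro borel_measurable_continuous_on_indicator assms) auto
  have e: "ennreal (f z) * indicator (ball a r) z = ennreal (indicator (ball a r) z *\<^sub>R f z)" for z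
    by (auto simp: indicator_def)
  have "(\<integral>\<^sup>+ z. ennreal (f (a + z)) * indicator (ball 0 r) z \<partial>lborel) =
     (\<integral>\<^sup>+ z. ennreal (indicator (ball a r) (a + z) *\<^sub>R f (a + z)) \<partial>lborel)"
    by (intro nn_integral_cong) (auto simp: indicator_def dist_norm)
  also have "\<dots> = (\<integral>\<^sup>+ z. ennreal (indicator (ball a r) z *\<^sub>R f z) \<partial>lborel)"
    by (rule nn_integral_translate) measurable
  finally show ?thesis unfolding e .
qed

text \<open>Bessel's inequality with the single coefficient n = 0, for the translate
  \<open>G (a + z)\<close> and the indicator of \<open>ball 0 r\<close> as weight. Its integral
  \<open>pi * r\<^sup>2\<close> loses the factor pi to the normalization of
  \<open>disc_area\<close>.\<close>

lemma mean_value_square_le: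
  assumes G: "G holomorphic_on ball 0 1" and a: "cmod a < 1" and r: "0 < r" "r < 1 - cmod a"
  shows "ennreal ((cmod (G a))\<^sup>2 * r\<^sup>2) \<le> (\<integral>\<^sup>+ z. ennreal ((cmod (G z))\<^sup>2) * indicator (ball a r) z \<partial>disc_area)"
proof -
  define W where "W z = (indicator (ball 0 r) z :: real)" for z :: complex
  interpret radial_weight W r 1
  proof
    show "W \<in> borel_measurable borel" unfolding W_def[abs_def]
      by (rule borel_measurable_indicator) simp
  qed (use r in \<open>auto simp: W_def indicator_def norm_mult\<close>)
  define H where "H z = G (a + z)" for z
  have sub: "ball a r \<subseteq> ball 0 1"
  proof
    fix z assume "z \<in> ball a r"
    hence "cmod (z - a) < r" by (simp add: dist_norm norm_minus_commute)
    thus "z \<in> ball 0 1" using norm_triangle_ineq[of a "z - a"] r by simp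
  qed
  have H: "H holomorphic_on ball 0 (1 - cmod a)"
    unfolding H_def
  proof (rule holomorphic_on_compose_gen[of "\<lambda>z. a + z" _ G "ball 0 1", unfolded o_def])
    show "(\<lambda>z. a + z) ` ball 0 (1 - cmod a) \<subseteq> ball 0 1"
    proof clarify
      fix z :: complex assume "z \<in> ball 0 (1 - cmod a)"
      thus "a + z \<in> ball 0 1" using norm_triangle_ineq[of a z] by simp
    qed
  qed (auto intro: holomorphic_intros G)
  have "(\<Sum>n<1. (cmod ((deriv ^^ n) H 0 / fact n))\<^sup>2 * (\<integral>z. W z * cmod z ^ (2 * n) \<partial>lborel))
      \<le> (\<integral>z. W z * (cmod (H z))\<^sup>2 \<partial>lborel)"
    by (rule bessel(1)[OF H r(2)])
  moreover have "(\<integral>z. W z \<partial>lborel) = pi * r\<^sup>2"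
    unfolding W_def using r by (simp add: content_ball unit_ball_vol_2)
  ultimately have 1: "(cmod (G a))\<^sup>2 * (pi * r\<^sup>2) \<le> (\<integral>z. W z * (cmod (H z))\<^sup>2 \<partial>lborel)"
    by (simp add: H_def)
  have "ennreal ((cmod (G a))\<^sup>2 * (pi * r\<^sup>2)) \<le> ennreal (\<integral>z. W z * (cmod (H z))\<^sup>2 \<partial>lborel)"
    using 1 by (rule ennreal_leI)
  also have "\<dots> = (\<integral>\<^sup>+ z. ennreal (W z * (cmod (H z))\<^sup>2) \<partial>lborel)"
    by (rule nn_integral_eq_integral[symmetric]) (use bessel(2)[OF H r(2)] W_nonneg in auto)
  also have "\<dots> = (\<integral>\<^sup>+ z. ennreal ((cmod (G (a + z)))\<^sup>2) * indicator (ball 0 r) z \<partial>lborel)"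
    by (intro nn_integral_cong) (auto simp: W_def H_def indicator_def)
  also have "\<dots> = (\<integral>\<^sup>+ z. ennreal ((cmod (G z))\<^sup>2) * indicator (ball a r) z \<partial>lborel)"
    by (rule nn_integral_translate_ball)
       (intro continuous_intros holomorphic_on_imp_continuous_on holomorphic_on_subset[OF G sub])
  finally have 2: "ennreal ((cmod (G a))\<^sup>2 * (pi * r\<^sup>2)) \<le> (\<integral>\<^sup>+ z. ennreal ((cmod (G z))\<^sup>2) * indicator (ball a r) z \<partial>lborel)" .
  have m1: "(\<lambda>z. ennreal ((cmod (G z))\<^sup>2)) \<in> borel_measurable disc_area"
    by (intro measurable_compose[OF _ measurable_ennreal] measurable_disc_areaI continuous_intros holomorphic_on_imp_continuous_on G)
  have m2: "(\<lambda>z. indicator (ball a r) z :: ennreal) \<in> borel_measurable disc_area"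
    by (rule measurable_disc_area_borel, rule borel_measurable_indicator) simp
  have "ennreal ((cmod (G a))\<^sup>2 * r\<^sup>2) = ennreal (1 / pi) * ennreal ((cmod (G a))\<^sup>2 * (pi * r\<^sup>2))"
    by (simp add: ennreal_mult'[symmetric])
  also have "\<dots> \<le> ennreal (1 / pi) * (\<integral>\<^sup>+ z. ennreal ((cmod (G z))\<^sup>2) * indicator (ball a r) z \<partial>lborel)"
    by (intro mult_left_mono 2) auto
  also have "(\<integral>\<^sup>+ z. ennreal ((cmod (G z))\<^sup>2) * indicator (ball a r) z \<partial>lborel) =
      (\<integral>\<^sup>+ z. (ennreal ((cmod (G z))\<^sup>2) * indicator (ball a r) z) * indicator (ball 0 1) z \<partial>lborel)"
    using sub by (intro nn_integral_cong) (auto simp: indicator_def)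
  also have "ennreal (1 / pi) * \<dots> = (\<integral>\<^sup>+ z. ennreal ((cmod (G z))\<^sup>2) * indicator (ball a r) z \<partial>disc_area)"
    by (rule nn_integral_disc_area[symmetric]) (intro borel_measurable_times_ennreal m1 m2)
  finally show ?thesis .
qed

subsection \<open>Moments and the Dirichlet-type norm\<close>

text \<open>The disc of radius sqrt x has normalized area x, so |z|^2 is uniformly distributed on
  (0, 1). This turns radial integrals over the disc into one-dimensional ones.\<close>

lemma distr_disc_area_square:
  "distr disc_area borel (\<lambda>z. (cmod z)\<^sup>2) = density lborel (indicator {0<..<1})"
proof (rule measure_eqI_lessThan)
  fix x :: real
  have m: "(\<lambda>z. (cmod z)\<^sup>2) \<in> borel_measurable disc_area"
    by (intro measurable_disc_areaI continuous_intros)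
  have L: "emeasure (distr disc_area borel (\<lambda>z. (cmod z)\<^sup>2)) {x<..} = emeasure disc_area {z \<in> ball 0 1. x < (cmod z)\<^sup>2}"
    using m by (subst emeasure_distr) (auto simp: vimage_def Int_def conj_commute)
  have R: "emeasure (density lborel (indicator {0<..<1})) {x<..} = emeasure lborel ({0<..<1} \<inter> {x<..})"
    by (subst emeasure_restricted) auto
  have total: "emeasure disc_area (ball 0 1) = 1"
    by (subst emeasure_disc_area) (auto simp: emeasure_ball unit_ball_vol_2 ennreal_mult'[symmetric])
  consider "x < 0" | "0 \<le> x" "x < 1" | "1 \<le> x" by linarith
  hence eq: "emeasure disc_area {z \<in> ball 0 1. x < (cmod z)\<^sup>2} = emeasure lborel ({0<..<1} \<inter> {x<..})"
  proof cases
    case 1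
    have "{z \<in> ball 0 1. x < (cmod z)\<^sup>2} = (ball 0 1 :: complex set)" "{0<..<1} \<inter> {x<..} = {0<..<1}"
      using 1 by (auto intro: less_le_trans)
    thus ?thesis using total by simp
  next
    case 2
    have key: "x < (cmod z)\<^sup>2 \<longleftrightarrow> sqrt x < cmod z" for z
      using real_sqrt_less_iff[of x "(cmod z)\<^sup>2"] by simp
    have e1: "{z \<in> ball 0 1. x < (cmod z)\<^sup>2} = ball 0 1 - cball 0 (sqrt x)"
      unfolding key by auto
    have e2: "{0<..<1} \<inter> {x<..} = {x<..<1}" using 2 by auto
    have sq: "sqrt x < 1" using 2 by simp
    have sub: "cball 0 (sqrt x) \<subseteq> (ball 0 1 :: complex set)"
    proof
      fix z :: complex assume "z \<in> cball 0 (sqrt x)"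
      hence "cmod z \<le> sqrt x" by simp
      hence "cmod z < 1" using sq by (rule le_less_trans)
      thus "z \<in> ball 0 1" by simp
    qed
    have cb: "emeasure disc_area (cball 0 (sqrt x)) = ennreal x"
      using sub 2 by (subst emeasure_disc_area) (auto simp: emeasure_cball unit_ball_vol_2 ennreal_mult'[symmetric])
    have "emeasure disc_area (ball 0 1 - cball 0 (sqrt x)) = emeasure disc_area (ball 0 1) - emeasure disc_area (cball 0 (sqrt x))"
      using sub cb by (intro emeasure_Diff) (auto simp: sets_restrict_space_iff)
    also note cb
    also have "emeasure disc_area (ball 0 1) - ennreal x = ennreal (1 - x)"
      unfolding total using 2 by (simp add: ennreal_minus flip: ennreal_1)
    finally show ?thesis unfolding e1 e2 using 2 by simp
  next
    case 3
    have "{z \<in> ball 0 1. x < (cmod z)\<^sup>2} = {}"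
    proof -
      have "(cmod z)\<^sup>2 < 1" if "cmod z < 1" for z using that by (simp add: abs_square_less_1)
      thus ?thesis using 3 by fastforce
    qed
    moreover have "{0<..<1} \<inter> {x<..} = {}" using 3 by auto
    ultimately show ?thesis by (simp only: emeasure_empty)
  qed
  show "emeasure (distr disc_area borel (\<lambda>z. (cmod z)\<^sup>2)) {x<..} = emeasure (density lborel (indicator {0<..<1})) {x<..}"
    unfolding L R eq ..
  have "emeasure lborel ({0<..<1} \<inter> {x<..}) \<le> emeasure lborel {0<..<1::real}" by (intro emeasure_mono) auto
  also have "\<dots> < \<infinity>" by simp
  finally show "emeasure (distr disc_area borel (\<lambda>z. (cmod z)\<^sup>2)) {x<..} < \<infinity>" unfolding L eq .
qed auto

text \<open>With t = |z|^2 uniform on (0, 1) the moment is Euler's Beta integral.\<close>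

lemma nn_integral_moment:
  assumes s: "s > 0"
  shows "(\<integral>\<^sup>+ z. ennreal (cmod z ^ (2 * n) * (1 - (cmod z)\<^sup>2) powr s) \<partial>disc_area) = ennreal (Beta (real n + 1) (s + 1))"
proof -
  have m: "(\<lambda>z. (cmod z)\<^sup>2) \<in> disc_area \<rightarrow>\<^sub>M borel"
    by (intro measurable_disc_areaI continuous_intros)
  have "(\<integral>\<^sup>+ z. ennreal (cmod z ^ (2 * n) * (1 - (cmod z)\<^sup>2) powr s) \<partial>disc_area) =
     (\<integral>\<^sup>+ t. ennreal (t ^ n * (1 - t) powr s) \<partial>distr disc_area borel (\<lambda>z. (cmod z)\<^sup>2))"
    by (subst nn_integral_distr[OF m]) (auto simp: power_mult)
  also have "\<dots> = (\<integral>\<^sup>+ t. ennreal (t ^ n * (1 - t) powr s) * indicator {0<..<1} t \<partial>lborel)"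
    unfolding distr_disc_area_square by (subst nn_integral_density) (auto simp: mult.commute)
  also have "\<dots> = (\<integral>\<^sup>+ t. ennreal (t powr (real n + 1 - 1) * (1 - t) powr (s + 1 - 1)) * indicator {0<..<1} t \<partial>lborel)"
    by (intro nn_integral_cong) (auto simp: indicator_def powr_realpow)
  also have "\<dots> = ennreal (Beta (real n + 1) (s + 1))"
  proof (rule nn_integral_has_integral_lebesgue')
    show "((\<lambda>t. t powr (real n + 1 - 1) * (1 - t) powr (s + 1 - 1)) has_integral Beta (real n + 1) (s + 1)) {0<..<1}"
      using has_integral_Beta_real[of "real n + 1" "s + 1"] s by (simp add: has_integral_Icc_iff_Ioo del: add_diff_cancel_right')
  qed auto
  finally show ?thesis .
qed

lemma Beta_Suc_pochhammer:
  fixes s :: real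
  assumes s: "s > 0"
  shows "Beta (real n + 1) (s + 1) = fact n / pochhammer (s + 1) (Suc n)"
proof -
  have "pochhammer (s + 1) (Suc n) = Gamma (s + 1 + of_nat (Suc n)) / Gamma (s + 1)"
    by (rule pochhammer_Gamma) (use s in \<open>auto elim!: nonpos_Ints_cases\<close>)
  moreover have "Gamma (1 + real n) = fact n" by (rule Gamma_fact)
  moreover have "Gamma (s + 1) > 0" by (rule Gamma_real_pos) (use s in simp)
  ultimately show ?thesis by (simp add: Beta_def add_ac)
qed

text \<open>The left-hand side is the weight of the coefficient of index n + 1 in the norm dual to
  the kernel (1 - x)^-s, and (n + 1)^2 times the Beta value is its weight in the integral of |F'|^2
  (1 - |z|^2)^s. Their quotient is (s + n + 1) / (s (n + 1)), which is at most (1 + s) / s.\<close>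

lemma dirichlet_coefficient_le:
  fixes s :: real
  assumes s: "s > 0"
  shows "fact (Suc n) / pochhammer s (Suc n) \<le> (1 + s) / s * ((real (Suc n))\<^sup>2 * Beta (real n + 1) (s + 1))"
proof -
  define p where "p = pochhammer (s + 1) (Suc n)"
  have p: "p > 0" unfolding p_def by (rule pochhammer_pos) (use s in auto)
  have e: "pochhammer s (Suc n) * (s + real (Suc n)) = s * p"
    unfolding p_def using pochhammer_rec[of s "Suc n"] pochhammer_rec'[of s "Suc n"] by (simp add: algebra_simps)
  hence q: "pochhammer s (Suc n) = s * p / (s + real (Suc n))" using s by (simp add: field_simps)
  have "fact (Suc n) / pochhammer s (Suc n) = (s + real (Suc n)) / s * (fact (Suc n) / p)"
    unfolding q using s p by (simp add: field_simps)
  also have "\<dots> \<le> ((1 + s) / s * real (Suc n)) * (fact (Suc n) / p)"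
    using s p by (intro mult_right_mono) (auto simp: field_simps intro!: divide_right_mono)
  also have "\<dots> = (1 + s) / s * ((real (Suc n))\<^sup>2 * (fact n / p))"
    using s p by (simp add: field_simps power2_eq_square)
  finally show ?thesis unfolding Beta_Suc_pochhammer[OF s] p_def .
qed

lemma disc_phi_0 [simp]: "disc_phi 0 z = - z" by (simp add: disc_phi_def)

text \<open>Monotone convergence over growing discs; it carries bounds obtained for compactly
  supported weights over to the whole disc.\<close>

lemma nn_integral_disc_area_exhaust:
  fixes p :: "complex \<Rightarrow> ennreal"
  assumes p: "p \<in> borel_measurable disc_area"
    and le: "\<And>r. 0 \<le> r \<Longrightarrow> r < 1 \<Longrightarrow> (\<integral>\<^sup>+ z. p z * indicator (ball 0 r) z \<partial>disc_area) \<le> C"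
  shows "(\<integral>\<^sup>+ z. p z \<partial>disc_area) \<le> C"
proof -
  define r where "r k = 1 - 1 / (real k + 2)" for k :: nat
  have r: "0 \<le> r k" "r k < 1" for k by (auto simp: r_def field_simps)
  have pk: "(\<lambda>z. p z * indicator (ball 0 (r k)) z) \<in> borel_measurable disc_area" for k
    by (intro borel_measurable_times_ennreal p measurable_disc_area_borel borel_measurable_indicator) simp
  have inc: "incseq (\<lambda>k z. p z * indicator (ball 0 (r k)) z)"
  proof (rule incseq_SucI, rule le_funI)
    fix k z
    have "r k \<le> r (Suc k)" by (auto simp: r_def field_simps)
    thus "p z * indicator (ball 0 (r k)) z \<le> p z * indicator (ball 0 (r (Suc k))) z"
      by (auto simp: indicator_def)
  qed
  have "(\<integral>\<^sup>+ z. p z \<partial>disc_area) \<le> (\<integral>\<^sup>+ z. (SUP k. p z * indicator (ball 0 (r k)) z) \<partial>disc_area)"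
  proof (rule nn_integral_mono)
    fix z assume "z \<in> space disc_area"
    hence z: "cmod z < 1" by simp
    obtain k :: nat where "1 / (1 - cmod z) < real k" using reals_Archimedean2 by blast
    hence "cmod z < r k" using z by (auto simp: r_def field_simps)
    hence "p z = p z * indicator (ball 0 (r k)) z" by simp
    also have "\<dots> \<le> (SUP k. p z * indicator (ball 0 (r k)) z)" by (rule SUP_upper) auto
    finally show "p z \<le> (SUP k. p z * indicator (ball 0 (r k)) z)" .
  qed
  also have "\<dots> = (SUP k. \<integral>\<^sup>+ z. p z * indicator (ball 0 (r k)) z \<partial>disc_area)"
    by (rule nn_integral_monotone_convergence_SUP[OF inc pk])
  also have "\<dots> \<le> C" by (intro SUP_least le r)
  finally show ?thesis .
qed

text \<open>The weight has to be truncated to \<open>ball 0 r\<close> to be a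
  \<open>radial_weight\<close>, but the truncated moments are not explicit. So the truncated Bessel
  inequality is kept in the form of an integral of the diagonal sum \<open>p\<close>, bounded by
  \<open>J\<close> for every r; the Beta values appear only after r has tended to 1.\<close>

lemma bessel_disc:
  assumes G: "G holomorphic_on ball 0 1" and s: "s > 0" and J: "qint s G 0 \<le> ennreal J" "J \<ge> 0"
  shows "(\<Sum>n<K. (cmod ((deriv ^^ n) G 0 / fact n))\<^sup>2 * Beta (real n + 1) (s + 1)) \<le> J"
proof -
  let ?b = "\<lambda>n. (deriv ^^ n) G 0 / fact n"
  define w where "w z = (1 - (cmod z)\<^sup>2) powr s" for z
  define p where "p z = (\<Sum>n<K. (cmod (?b n))\<^sup>2 * cmod z ^ (2 * n)) * w z" for z
  have cw: "continuous_on (ball 0 1) w"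
    unfolding w_def by (rule continuous_on_radial_weight)
  have cG: "continuous_on (ball 0 1) G" by (rule holomorphic_on_imp_continuous_on[OF G])
  have cp: "continuous_on (ball 0 1) p"
    unfolding p_def by (intro continuous_intros cw)
  have [measurable]: "p \<in> borel_measurable disc_area" by (rule measurable_disc_areaI[OF cp])
  have w: "0 \<le> w z" "cmod z < 1 \<Longrightarrow> w z \<le> 1" for z
    unfolding w_def using s one_minus_norm_square[of z] by (auto intro!: powr_le1)
  have mpk: "(\<lambda>z. ennreal (p z) * indicator (ball 0 r) z) \<in> borel_measurable disc_area" for r
    by (intro borel_measurable_times_ennreal measurable_compose[OF _ measurable_ennreal] measurable_disc_area_borel
        borel_measurable_indicator measurable_disc_areaI cp) simp
  have p0: "p z \<ge> 0" for z unfolding p_def using w by (intro mult_nonneg_nonneg sum_nonneg) auto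
  have step: "(\<integral>\<^sup>+ z. ennreal (p z) * indicator (ball 0 r) z \<partial>disc_area) \<le> ennreal J" if r: "0 \<le> r" "r < 1" for r
  proof -
    define W where "W z = indicator (ball 0 r) z *\<^sub>R w z" for z
    interpret radial_weight W r 1
    proof
      show "W \<in> borel_measurable borel" unfolding W_def
        by (intro borel_measurable_continuous_on_indicator continuous_on_subset[OF cw]) (use r in auto)
      show "W z \<le> 1" for z using w(2)[of z] r by (auto simp: W_def indicator_def)
    qed (use r w in \<open>auto simp: W_def indicator_def w_def norm_mult\<close>)
    have int: "integrable lborel (\<lambda>z. W z * cmod z ^ (2 * n))" for n
    proof -
      have "integrable lborel (\<lambda>z. W z *\<^sub>R cmod z ^ (2 * n))"
        by (rule integrable_W[where C = "r ^ (2 * n)"]) (auto intro!: power_mono)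
      thus ?thesis by simp
    qed
    have sub: "ennreal (h z) * indicator (ball 0 r) z * indicator (ball 0 1) z = ennreal (h z) * indicator (ball 0 r) z" for h z
      using r by (auto simp: indicator_def)
    have "(\<integral>\<^sup>+ z. ennreal (p z) * indicator (ball 0 r) z \<partial>disc_area) =
       ennreal (1 / pi) * (\<integral>\<^sup>+ z. ennreal (p z) * indicator (ball 0 r) z \<partial>lborel)"
      by (subst nn_integral_disc_area) (use mpk in \<open>auto simp: sub\<close>)
    also have "(\<integral>\<^sup>+ z. ennreal (p z) * indicator (ball 0 r) z \<partial>lborel) =
        (\<integral>\<^sup>+ z. ennreal (\<Sum>n<K. (cmod (?b n))\<^sup>2 * (W z * cmod z ^ (2 * n))) \<partial>lborel)"
      by (intro nn_integral_cong) (auto simp: p_def W_def indicator_def sum_distrib_left sum_distrib_right mult_ac)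
    also have "\<dots> = ennreal (\<integral>z. (\<Sum>n<K. (cmod (?b n))\<^sup>2 * (W z * cmod z ^ (2 * n))) \<partial>lborel)"
      by (rule nn_integral_eq_integral)
         (auto intro!: Bochner_Integration.integrable_sum integrable_mult_right int sum_nonneg mult_nonneg_nonneg W_nonneg)
    also have "(\<integral>z. (\<Sum>n<K. (cmod (?b n))\<^sup>2 * (W z * cmod z ^ (2 * n))) \<partial>lborel) =
       (\<Sum>n<K. (cmod (?b n))\<^sup>2 * (\<integral>z. W z * cmod z ^ (2 * n) \<partial>lborel))"
      by (simp only: int integrable_mult_right Bochner_Integration.integral_sum integral_mult_right_zero)
    also have "ennreal \<dots> \<le> ennreal (\<integral>z. W z * (cmod (G z))\<^sup>2 \<partial>lborel)"
      by (intro ennreal_leI bessel(1)[OF G r(2)])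
    also have "\<dots> = (\<integral>\<^sup>+ z. ennreal (W z * (cmod (G z))\<^sup>2) \<partial>lborel)"
      by (rule nn_integral_eq_integral[symmetric]) (use bessel(2)[OF G r(2)] W_nonneg in auto)
    also have "\<dots> \<le> (\<integral>\<^sup>+ z. ennreal ((cmod (G z))\<^sup>2 * w z) * indicator (ball 0 1) z \<partial>lborel)"
      using r by (intro nn_integral_mono) (auto simp: W_def indicator_def mult_ac)
    also have "ennreal (1 / pi) * \<dots> = (\<integral>\<^sup>+ z. ennreal ((cmod (G z))\<^sup>2 * w z) \<partial>disc_area)"
      by (rule nn_integral_disc_area[symmetric])
         (intro measurable_compose[OF _ measurable_ennreal] measurable_disc_areaI continuous_intros cG cw)
    also have "\<dots> = qint s G 0" by (simp add: qint_def w_def)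
    also note J(1)
    finally show ?thesis by (simp add: mult_left_mono)
  qed
  have 1: "(\<integral>\<^sup>+ z. ennreal (p z) \<partial>disc_area) \<le> ennreal J"
    by (rule nn_integral_disc_area_exhaust[OF _ step])
       (intro measurable_compose[OF _ measurable_ennreal] measurable_disc_areaI cp)
  have mm: "(\<lambda>z. ennreal (cmod z ^ (2 * n) * w z)) \<in> borel_measurable disc_area" for n
    by (intro measurable_compose[OF _ measurable_ennreal] measurable_disc_areaI continuous_intros cw)
  have "(\<integral>\<^sup>+ z. ennreal (p z) \<partial>disc_area) =
     (\<integral>\<^sup>+ z. (\<Sum>n<K. ennreal ((cmod (?b n))\<^sup>2) * ennreal (cmod z ^ (2 * n) * w z)) \<partial>disc_area)"
    by (intro nn_integral_cong)
       (simp add: p_def sum_distrib_right mult.assoc ennreal_mult'[symmetric] w)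
  also have "\<dots> = (\<Sum>n<K. ennreal ((cmod (?b n))\<^sup>2) * ennreal (Beta (real n + 1) (s + 1)))"
    using mm by (simp add: nn_integral_sum nn_integral_cmult w_def nn_integral_moment[OF s])
  also have "\<dots> = ennreal (\<Sum>n<K. (cmod (?b n))\<^sup>2 * Beta (real n + 1) (s + 1))"
  proof -
    have "Beta (real n + 1) (s + 1) \<ge> 0" for n
      unfolding Beta_Suc_pochhammer[OF s] using s by (intro divide_nonneg_pos pochhammer_pos) auto
    thus ?thesis by (simp add: ennreal_mult'[symmetric] sum_ennreal)
  qed
  finally show ?thesis using 1 J(2) by (simp add: ennreal_le_iff)
qed

subsection \<open>Bloch estimates\<close>

text \<open>On the disc of radius r = (1 - |a|) / 2 about a the weight is bounded below: 1 - |a|^2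
  \<ge> 2r, 1 - |z|^2 \<ge> r and |1 - cnj a z| \<le> 5r give at least 2/25. The mean value
  inequality on this disc then bounds |h(a)|, and the factor 4 is ((1 - |a|) / r)^2.\<close>

lemma qint_imp_bloch:
  assumes h: "h holomorphic_on ball 0 1" and s: "s > 0" and a: "cmod a < 1"
    and q: "qint s h a \<le> ennreal C" "C \<ge> 0"
  shows "(cmod (h a) * (1 - cmod a))\<^sup>2 \<le> 4 * (25 / 2) powr s * C"
proof -
  define r where "r = (1 - cmod a) / 2"
  have r: "0 < r" "r < 1 - cmod a" "1 - cmod a = 2 * r" using a by (auto simp: r_def)
  have "ennreal ((cmod (h a))\<^sup>2 * r\<^sup>2) \<le> (\<integral>\<^sup>+ z. ennreal ((cmod (h z))\<^sup>2) * indicator (ball a r) z \<partial>disc_area)"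
    by (rule mean_value_square_le[OF h a r(1,2)])
  also have "\<dots> \<le> (\<integral>\<^sup>+ z. ennreal ((25 / 2) powr s) * ennreal ((cmod (h z))\<^sup>2 * disc_weight a z powr s) \<partial>disc_area)"
  proof (rule nn_integral_mono)
    fix z assume "z \<in> space disc_area"
    hence z: "cmod z < 1" by simp
    show "ennreal ((cmod (h z))\<^sup>2) * indicator (ball a r) z \<le>
       ennreal ((25 / 2) powr s) * ennreal ((cmod (h z))\<^sup>2 * disc_weight a z powr s)"
    proof (cases "z \<in> ball a r")
      case True
      hence d: "cmod (a - z) < r" by (simp add: dist_norm)
      have z1: "1 - cmod z \<ge> r" using norm_triangle_ineq2[of z a] d r by (simp add: norm_minus_commute)
      have e: "1 - cnj a * z = of_real (1 - (cmod a)\<^sup>2) + cnj a * (a - z)"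
        using complex_norm_square[of a] by (simp add: algebra_simps)
      have "cmod (1 - cnj a * z) \<le> (1 - (cmod a)\<^sup>2) + cmod a * cmod (a - z)"
        unfolding e using norm_triangle_ineq[of "of_real (1 - (cmod a)\<^sup>2)" "cnj a * (a - z)"] one_minus_norm_square(1)[OF a]
        by (simp only: norm_mult complex_mod_cnj norm_of_real)
      also have "\<dots> \<le> 4 * r + 1 * r"
        using one_minus_norm_square(3)[OF a] r a d by (intro add_mono mult_mono) auto
      finally have y: "cmod (1 - cnj a * z) \<le> 5 * r" by simp
      have y0: "cmod (1 - cnj a * z) > 0" by (rule norm_one_minus_cnj_mult(3)[OF a z])
      have "2 * r * r \<le> (1 - (cmod a)\<^sup>2) * (1 - (cmod z)\<^sup>2)"
        using one_minus_norm_square(2)[OF a] one_minus_norm_square(2)[OF z] z1 r by (intro mult_mono) auto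
      moreover have "(cmod (1 - cnj a * z))\<^sup>2 \<le> (5 * r)\<^sup>2" using y y0 by (intro power_mono) auto
      moreover have "0 \<le> (1 - (cmod a)\<^sup>2) * (1 - (cmod z)\<^sup>2)"
        using one_minus_norm_square(1)[OF a] one_minus_norm_square(1)[OF z] by simp
      ultimately have "2 * r * r / (5 * r)\<^sup>2 \<le> 1 - (cmod (disc_phi a z))\<^sup>2"
        unfolding one_minus_disc_phi[OF a z] using y0 r by (intro frac_le) auto
      moreover have "2 * r * r / (5 * r)\<^sup>2 = 2 / 25" using r by (simp add: power2_eq_square)
      ultimately have "1 \<le> (25 / 2) * disc_weight a z" by simp
      hence "1 \<le> ((25 / 2) * disc_weight a z) powr s" using s by (simp add: ge_one_powr_ge_zero)
      hence "1 \<le> (25 / 2) powr s * disc_weight a z powr s"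
        by (simp only: powr_mult)
      hence "(cmod (h z))\<^sup>2 * 1 \<le> (cmod (h z))\<^sup>2 * ((25 / 2) powr s * disc_weight a z powr s)"
        by (intro mult_left_mono) auto
      thus ?thesis using True by (simp add: ennreal_mult'[symmetric] ennreal_leI mult_ac)
    qed simp
  qed
  also have "\<dots> = ennreal ((25 / 2) powr s) * qint s h a"
    unfolding qint_def
    by (rule nn_integral_cmult)
       (intro measurable_compose[OF _ measurable_ennreal] measurable_disc_areaI continuous_intros
          holomorphic_on_imp_continuous_on h continuous_on_weight a)
  also have "\<dots> \<le> ennreal ((25 / 2) powr s) * ennreal C" by (intro mult_left_mono q) auto
  also have "\<dots> = ennreal ((25 / 2) powr s * C)" using q by (simp add: ennreal_mult)
  finally have "(cmod (h a))\<^sup>2 * r\<^sup>2 \<le> (25 / 2) powr s * C" using q by (subst (asm) ennreal_le_iff) auto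
  thus ?thesis unfolding r(3) by (simp add: power_mult_distrib)
qed

lemma bloch_growth:
  assumes f: "f holomorphic_on ball 0 1" and B: "\<And>z. cmod z < 1 \<Longrightarrow> cmod (deriv f z) * (1 - cmod z) \<le> B"
    and z: "cmod z < 1"
  shows "cmod (f z - f 0) \<le> B * ln (1 / (1 - cmod z))"
proof -
  have in_ball: "cmod (of_real t * z) < 1" "t * cmod z < 1" if "0 \<le> t" "t \<le> 1" for t
  proof -
    have "t * cmod z \<le> 1 * cmod z" using that by (intro mult_right_mono) auto
    thus "t * cmod z < 1" using z by simp
    thus "cmod (of_real t * z) < 1" using that by (simp add: norm_mult)
  qed
  have fd: "(f has_field_derivative deriv f w) (at w)" if "cmod w < 1" for w
    using holomorphic_derivI[OF f, of w] that by simp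
  have "norm (f (of_real 1 * z) - f (of_real 0 * z)) \<le> - B * ln (1 - 1 * cmod z) - (- B * ln (1 - 0 * cmod z))"
  proof (rule differentiable_bound_general[of 0 1 "\<lambda>t. f (of_real t * z)" "\<lambda>t. - B * ln (1 - t * cmod z)"
        "\<lambda>t. z * deriv f (of_real t * z)" "\<lambda>t. B * cmod z / (1 - t * cmod z)"])
    show "continuous_on {0..1} (\<lambda>t. f (of_real t * z))"
      by (rule continuous_on_compose2[OF holomorphic_on_imp_continuous_on[OF f]])
         (use in_ball in \<open>auto intro!: continuous_intros\<close>)
    show "continuous_on {0..1} (\<lambda>t. - B * ln (1 - t * cmod z))"
      using in_ball by (intro continuous_intros) force
    fix t :: real assume t: "0 < t" "t < 1"
    have "((\<lambda>t. of_real t * z) has_vector_derivative z) (at t)"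
      by (auto intro!: derivative_eq_intros)
    from field_vector_diff_chain_at[OF this fd[OF in_ball(1)]] t
    show "((\<lambda>t. f (of_real t * z)) has_vector_derivative z * deriv f (of_real t * z)) (at t)"
      by (simp add: o_def)
    have p: "1 - t * cmod z > 0" using in_ball(2)[of t] t by simp
    show "((\<lambda>t. - B * ln (1 - t * cmod z)) has_vector_derivative B * cmod z / (1 - t * cmod z)) (at t)"
      unfolding has_real_derivative_iff_has_vector_derivative[symmetric]
      using p by (auto intro!: derivative_eq_intros simp: divide_simps)
    have "cmod (deriv f (of_real t * z)) * (1 - t * cmod z) \<le> B"
      using B[OF in_ball(1)[of t]] t by (simp add: norm_mult)
    hence "cmod (deriv f (of_real t * z)) \<le> B / (1 - t * cmod z)" using p by (simp add: pos_le_divide_eq)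
    hence "cmod z * cmod (deriv f (of_real t * z)) \<le> cmod z * (B / (1 - t * cmod z))" by (rule mult_left_mono) simp
    thus "norm (z * deriv f (of_real t * z)) \<le> B * cmod z / (1 - t * cmod z)"
      by (simp add: norm_mult mult_ac)
  qed simp
  thus ?thesis using z by (simp add: ln_div)
qed

section \<open>Moebius-invariant growth of Bloch functions\<close>

lemma disc_phi_involution:
  assumes "cmod a < 1" "cmod z < 1"
  shows "disc_phi a (disc_phi a z) = z"
proof -
  have nz: "1 - cnj a * z \<noteq> 0" by (rule norm_one_minus_cnj_mult(4)[OF assms])
  have "1 - cnj a * a \<noteq> 0" by (rule norm_one_minus_cnj_mult(4)[OF assms(1) assms(1)])
  moreover have "a - disc_phi a z = z * (1 - cnj a * a) / (1 - cnj a * z)"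
    using nz by (simp add: disc_phi_def field_simps)
  moreover have "1 - cnj a * disc_phi a z = (1 - cnj a * a) / (1 - cnj a * z)"
    using nz by (simp add: disc_phi_def field_simps)
  ultimately show ?thesis using nz unfolding disc_phi_def[of a "disc_phi a z"] by simp
qed

lemma has_field_derivative_disc_phi:
  assumes "cmod a < 1" "cmod z < 1"
  shows "(disc_phi a has_field_derivative - (1 - cnj a * a) / (1 - cnj a * z)\<^sup>2) (at z)"
  unfolding disc_phi_def[abs_def] using norm_one_minus_cnj_mult(4)[OF assms]
  by (auto intro!: derivative_eq_intros simp: field_simps power2_eq_square)

text \<open>The radial estimate is applied to f composed with \<open>disc_phi a\<close>, at the
  point \<open>disc_phi a z\<close>. By the Schwarz-Pick identity the composition has Bloch constant
  at most 2B; the 2 comes from passing between 1 - |p| and 1 - |p|^2.\<close>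

lemma bloch_growth_invariant:
  assumes f: "f holomorphic_on ball 0 1" and B: "\<And>z. cmod z < 1 \<Longrightarrow> cmod (deriv f z) * (1 - cmod z) \<le> B"
    and a: "cmod a < 1" and z: "cmod z < 1"
  shows "cmod (f z - f a) \<le> 2 * B * ln (1 / (1 - cmod (disc_phi a z)))"
proof -
  define h where "h w = f (disc_phi a w)" for w
  have der: "(h has_field_derivative deriv f (disc_phi a w) * (- (1 - cnj a * a) / (1 - cnj a * w)\<^sup>2)) (at w)" if w: "cmod w < 1" for w
    unfolding h_def
    by (rule DERIV_chain2[OF holomorphic_derivI[OF f open_ball] has_field_derivative_disc_phi[OF a w]])
       (use one_minus_disc_phi_bounds(3)[OF a w] in simp)
  have h: "h holomorphic_on ball 0 1"
    unfolding holomorphic_on_open[OF open_ball]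
  proof
    fix w :: complex assume "w \<in> ball 0 1"
    hence "cmod w < 1" by simp
    from der[OF this] show "\<exists>f'. (h has_field_derivative f') (at w)" by blast
  qed
  have Bh: "cmod (deriv h w) * (1 - cmod w) \<le> 2 * B" if w: "cmod w < 1" for w
  proof -
    let ?p = "disc_phi a w"
    have p: "cmod ?p < 1" by (rule one_minus_disc_phi_bounds(3)[OF a w])
    have ca: "cmod (1 - cnj a * a) = 1 - (cmod a)\<^sup>2"
    proof -
      have "1 - cnj a * a = of_real (1 - (cmod a)\<^sup>2)" using complex_norm_square[of a] by (simp add: mult.commute)
      thus ?thesis using one_minus_norm_square(1)[OF a] by (simp only: norm_of_real)
    qed
    have "cmod (deriv h w) * (1 - cmod w) = cmod (deriv f ?p) * ((1 - (cmod a)\<^sup>2) * (1 - cmod w) / (cmod (1 - cnj a * w))\<^sup>2)"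
      unfolding DERIV_imp_deriv[OF der[OF w]] norm_mult norm_divide norm_minus_cancel norm_power ca by simp
    also have "\<dots> \<le> cmod (deriv f ?p) * (1 - (cmod ?p)\<^sup>2)"
      unfolding one_minus_disc_phi[OF a w]
      using one_minus_norm_square[OF a] one_minus_norm_square[OF w] by (intro mult_left_mono divide_right_mono) auto
    also have "\<dots> \<le> cmod (deriv f ?p) * (2 * (1 - cmod ?p))"
      using one_minus_norm_square(3)[OF p] by (intro mult_left_mono) auto
    also have "\<dots> = 2 * (cmod (deriv f ?p) * (1 - cmod ?p))" by (simp add: algebra_simps)
    also have "\<dots> \<le> 2 * B" using B[OF p] by (intro mult_left_mono) auto
    finally show ?thesis .
  qed
  have "cmod (h (disc_phi a z) - h 0) \<le> 2 * B * ln (1 / (1 - cmod (disc_phi a z)))"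
    by (rule bloch_growth[OF h Bh one_minus_disc_phi_bounds(3)[OF a z]])
  thus ?thesis by (simp add: h_def disc_phi_involution[OF a z]) (simp add: disc_phi_def)
qed

text \<open>The logarithm is traded for the power s/4, so that the square costs exactly half of the
  exponent s. Then ln x \<le> (4/s) x^(s/4) turns the constant 2B into 8B/s.\<close>

lemma bloch_growth_power:
  assumes f: "f holomorphic_on ball 0 1" and B: "\<And>z. cmod z < 1 \<Longrightarrow> cmod (deriv f z) * (1 - cmod z) \<le> B"
    and a: "cmod a < 1" and z: "cmod z < 1" and s: "0 < s"
  shows "(cmod (f z - f a))\<^sup>2 \<le> (8 * B / s)\<^sup>2 * 2 powr (s / 2) * disc_weight a z powr - (s / 2)"
proof -
  let ?p = "cmod (disc_phi a z)"
  have p: "?p < 1" by (rule one_minus_disc_phi_bounds(3)[OF a z])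
  have B0: "B \<ge> 0" using B[of 0] by (auto intro: order_trans[rotated])
  define x where "x = 1 / (1 - ?p)"
  have x: "x \<ge> 1" using p by (simp add: x_def)
  have l: "ln x \<le> x powr (s / 4) / (s / 4)" using ln_powr_bound[of x "s / 4"] x s by simp
  have l0: "ln x \<ge> 0" using x by simp
  have "cmod (f z - f a) \<le> 2 * B * ln x"
    unfolding x_def by (rule bloch_growth_invariant[OF f B a z])
  also have "\<dots> \<le> 2 * B * (x powr (s / 4) / (s / 4))" using l B0 by (intro mult_left_mono) auto
  also have "\<dots> = 8 * B / s * x powr (s / 4)" by simp
  finally have "(cmod (f z - f a))\<^sup>2 \<le> (8 * B / s * x powr (s / 4))\<^sup>2" by (rule power_mono) simp
  also have "\<dots> = (8 * B / s)\<^sup>2 * (x powr (s / 4))\<^sup>2" by (rule power_mult_distrib)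
  also have "(x powr (s / 4))\<^sup>2 = x powr (s / 2)" by (simp add: power2_eq_square flip: powr_add)
  also have "x powr (s / 2) \<le> (2 / (1 - ?p\<^sup>2)) powr (s / 2)"
    using s one_minus_norm_square[OF p] p by (intro powr_mono2) (auto simp: x_def field_simps)
  also have "(2 / (1 - ?p\<^sup>2)) powr (s / 2) = 2 powr (s / 2) * (1 - ?p\<^sup>2) powr - (s / 2)"
    by (simp add: powr_divide powr_minus_divide)
  finally show ?thesis by (simp add: mult_left_mono mult.assoc)
qed

subsection \<open>Equivalence of the two descriptions of the Q spaces\<close>

lemma SUP_less_top_iff:
  fixes I :: "'a \<Rightarrow> ennreal"
  shows "(SUP a\<in>D. I a) < \<infinity> \<longleftrightarrow> (\<exists>C\<ge>0. \<forall>a\<in>D. I a \<le> ennreal C)"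
proof
  assume fin: "(SUP a\<in>D. I a) < \<infinity>"
  have "I a \<le> ennreal (enn2real (SUP a\<in>D. I a))" if "a \<in> D" for a
    using fin SUP_upper[OF that, of I] by (simp add: ennreal_enn2real)
  thus "\<exists>C\<ge>0. \<forall>a\<in>D. I a \<le> ennreal C" by (intro exI[of _ "enn2real (SUP a\<in>D. I a)"]) auto
next
  assume "\<exists>C\<ge>0. \<forall>a\<in>D. I a \<le> ennreal C"
  then obtain C where "\<forall>a\<in>D. I a \<le> ennreal C" by blast
  hence "(SUP a\<in>D. I a) \<le> ennreal C" by (intro SUP_least) auto
  thus "(SUP a\<in>D. I a) < \<infinity>" using ennreal_less_top[of C] by (auto intro: le_less_trans)
qed

lemma disc_green_eq:
  "disc_green z a = ln (1 / cmod (disc_phi a z))"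
  by (simp add: disc_green_def disc_phi_def norm_divide)

lemma AE_disc_area_neq: "AE z in disc_area. z \<noteq> a"
proof (rule AE_I[where N = "{a} \<inter> ball 0 1"])
  show "emeasure disc_area ({a} \<inter> ball 0 1) = 0"
  proof (cases "a \<in> ball 0 1")
    case True
    hence "{a} \<inter> ball 0 1 = {a}" by auto
    thus ?thesis using True by (simp add: emeasure_disc_area)
  qed auto
  show "{a} \<inter> ball 0 1 \<in> sets disc_area" by (simp add: sets_restrict_space_iff)
qed auto

text \<open>A condition on a function in the place of the derivative, so that products like
  \<open>deriv g z * f z\<close> can be tested without naming an antiderivative.\<close>

definition in_Q :: "real \<Rightarrow> (complex \<Rightarrow> complex) \<Rightarrow> bool" where
  "in_Q s h \<longleftrightarrow> (\<exists>C\<ge>0. \<forall>a. cmod a < 1 \<longrightarrow> qint s h a \<le> ennreal C)"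

lemma in_QE:
  assumes "in_Q s h" obtains C where "C \<ge> 0" "\<And>a. cmod a < 1 \<Longrightarrow> qint s h a \<le> ennreal C"
proof -
  from assms obtain C where "C \<ge> 0" "\<forall>a. cmod a < 1 \<longrightarrow> qint s h a \<le> ennreal C"
    unfolding in_Q_def by blast
  thus thesis by (intro that[of C]) auto
qed

lemma in_Q_bloch:
  assumes h: "h holomorphic_on ball 0 1" and s: "s > 0" and q: "in_Q s h"
  obtains B where "B \<ge> 0" "\<And>z. cmod z < 1 \<Longrightarrow> cmod (h z) * (1 - cmod z) \<le> B"
proof -
  obtain C where C: "C \<ge> 0" "\<And>a. cmod a < 1 \<Longrightarrow> qint s h a \<le> ennreal C"
    using in_QE[OF q] by blast
  show ?thesis
  proof
    show "sqrt (4 * (25 / 2) powr s * C) \<ge> 0" using C by simp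
    show "cmod (h z) * (1 - cmod z) \<le> sqrt (4 * (25 / 2) powr s * C)" if "cmod z < 1" for z
      using qint_imp_bloch[OF h s that C(2)[OF that] C(1)] by (rule real_le_rsqrt)
  qed
qed

text \<open>Here c stands for |f'(z)|. Where |phi_a(z)| < 1/2, all relevant quantities are
  comparable to d = 1 - |a|^2: |1 - cnj a z| \<le> 2d and 1 - |z| \<ge> 3d/32, so the Bloch bound
  yields c \<le> 32B/(3d). Since s \<le> 1, the power of the Green function is at most 1/|phi_a(z)|
  \<le> 2d/|z - a|. The product has the constant 2048/9 < 228. The exponent is written
  \<open>1 - 2\<close> to match \<open>p - 2\<close> with p = 1 in the dyadic estimate.\<close>

lemma green_near_pole_le:
  assumes s: "0 < s" "s \<le> 1" and a: "cmod a < 1" and z: "cmod z < 1"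
    and B: "c * (1 - cmod z) \<le> B" and c: "c \<ge> 0" and x: "cmod (disc_phi a z) < 1 / 2"
  shows "c\<^sup>2 * disc_green z a powr s \<le> 228 * B\<^sup>2 / (1 - (cmod a)\<^sup>2) * cmod (z - a) powr (1 - 2)"
    and "cmod (z - a) < 1 - (cmod a)\<^sup>2"
proof -
  define d where "d = 1 - (cmod a)\<^sup>2"
  have d: "d > 0" using one_minus_norm_square[OF a] by (simp add: d_def)
  define y where "y = cmod (1 - cnj a * z)"
  have y0: "y > 0" unfolding y_def by (rule norm_one_minus_cnj_mult(3)[OF a z])
  have az: "2 * cmod (a - z) < y" using x y0 by (simp add: disc_phi_def norm_divide y_def field_simps)
  have e: "1 - cnj a * z = of_real d + cnj a * (a - z)"
    using complex_norm_square[of a] by (simp add: algebra_simps d_def)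
  have "y \<le> d + cmod a * cmod (a - z)"
    unfolding y_def e using norm_triangle_ineq[of "of_real d" "cnj a * (a - z)"] d
    by (simp only: norm_mult complex_mod_cnj norm_of_real)
  also have "cmod a * cmod (a - z) \<le> 1 * cmod (a - z)" using a by (intro mult_right_mono) auto
  finally have y: "y \<le> d + cmod (a - z)" by simp
  hence y2: "y \<le> 2 * d" and azd: "cmod (a - z) < d" using az by auto
  show "cmod (z - a) < 1 - (cmod a)\<^sup>2" using azd by (simp add: d_def norm_minus_commute)
  have yl: "d / 2 \<le> y" using norm_one_minus_cnj_mult(1)[OF a z] one_minus_norm_square(3)[OF a] by (simp add: y_def d_def)
  have "d * (1 - (cmod z)\<^sup>2) = y\<^sup>2 - (cmod (a - z))\<^sup>2"
    unfolding y_def d_def by (rule norm_diff_disc_phi_identity[symmetric])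
  also have "(cmod (a - z))\<^sup>2 \<le> (y / 2)\<^sup>2" using az by (intro power_mono) auto
  hence "y\<^sup>2 - (cmod (a - z))\<^sup>2 \<ge> 3 / 4 * y\<^sup>2" by (simp add: power_divide)
  finally have "d * (1 - (cmod z)\<^sup>2) \<ge> 3 / 4 * y\<^sup>2" .
  moreover have "y\<^sup>2 \<ge> (d / 2)\<^sup>2" using yl d by (intro power_mono) auto
  ultimately have "d * (1 - (cmod z)\<^sup>2) \<ge> d * (3 / 16 * d)" by (simp add: power2_eq_square)
  hence "1 - (cmod z)\<^sup>2 \<ge> 3 / 16 * d" using d by simp
  hence z1: "1 - cmod z \<ge> 3 / 32 * d" using one_minus_norm_square(3)[OF z] by simp
  have "c * (3 / 32 * d) \<le> B" using mult_left_mono[OF z1 c] B by linarith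
  hence "c \<le> 32 / 3 * B / d" using d by (simp add: field_simps)
  hence c2: "c\<^sup>2 \<le> (32 / 3 * B / d)\<^sup>2" using c by (intro power_mono) auto
  have B0: "B \<ge> 0" using B c z by (meson diff_ge_0_iff_ge less_imp_le mult_nonneg_nonneg order_trans)
  show "c\<^sup>2 * disc_green z a powr s \<le> 228 * B\<^sup>2 / (1 - (cmod a)\<^sup>2) * cmod (z - a) powr (1 - 2)"
  proof (cases "z = a")
    case True
    thus ?thesis by (simp add: disc_green_def)
  next
    case False
    define t where "t = cmod (disc_phi a z)"
    have t: "0 < t" "t < 1 / 2" using False x y0 by (auto simp: t_def disc_phi_def y_def)
    have t1: "1 / t \<ge> 1" using t by simp
    have "ln (1 / t) \<le> 1 / t - 1" using t by (intro ln_le_minus_one) auto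
    hence "ln (1 / t) powr s \<le> (1 / t) powr s" using t1 t s by (intro powr_mono2) auto
    also have "\<dots> \<le> (1 / t) powr 1" using t1 s by (intro powr_mono) auto
    also have "\<dots> = y / cmod (z - a)" using t by (simp add: t_def disc_phi_def norm_divide y_def norm_minus_commute)
    also have "\<dots> \<le> 2 * d / cmod (z - a)" using y2 by (intro divide_right_mono) auto
    finally have g: "disc_green z a powr s \<le> 2 * d / cmod (z - a)" by (simp add: disc_green_eq t_def)
    have "c\<^sup>2 * disc_green z a powr s \<le> (32 / 3 * B / d)\<^sup>2 * (2 * d / cmod (z - a))"
      using c2 g d by (intro mult_mono) auto
    also have "\<dots> = 2048 / 9 * B\<^sup>2 / d * (1 / cmod (z - a))" using d by (simp add: power2_eq_square field_simps)
    also have "\<dots> \<le> 228 * B\<^sup>2 / d * (1 / cmod (z - a))" using d by (intro mult_right_mono divide_right_mono) auto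
    finally show ?thesis using False by (simp add: d_def powr_minus_divide)
  qed
qed

text \<open>With t = |phi_a(z)| the bound 1 - t^2 \<le> 2 ln (1/t) holds on the whole disc away from
  the pole, but ln (1/t) \<le> 2 (1 - t^2) only for t \<ge> 1/2. For smaller t the converse
  direction relies on the Bloch bound that \<open>in_Q\<close> itself provides.\<close>

lemma Q_space_iff:
  assumes s: "0 < s" "s \<le> 1"
  shows "f \<in> Q_space s \<longleftrightarrow> f holomorphic_on ball 0 1 \<and> in_Q s (deriv f)"
proof (cases "f holomorphic_on ball 0 1")
  case hol: True
  have dh: "deriv f holomorphic_on ball 0 1" by (rule holomorphic_deriv[OF hol open_ball])
  have dc: "continuous_on (ball 0 1) (deriv f)" by (rule holomorphic_on_imp_continuous_on[OF dh])
  define I where "I a = (\<integral>\<^sup>+ z. ennreal ((cmod (deriv f z))\<^sup>2 * disc_green z a powr s) \<partial>disc_area)" for a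
  have phim: "(\<lambda>z. (cmod (deriv f z))\<^sup>2 * disc_weight a z powr s) \<in> borel_measurable disc_area" if "cmod a < 1" for a
    by (intro measurable_disc_areaI continuous_intros dc continuous_on_weight that)
  have le1: "qint s (deriv f) a \<le> ennreal (2 powr s) * I a" if a: "cmod a < 1" for a
  proof -
    have gm: "(\<lambda>z. disc_green z a powr s) \<in> borel_measurable disc_area"
      unfolding disc_green_def by (rule measurable_disc_area_borel) measurable
    have fm: "(\<lambda>z. (cmod (deriv f z))\<^sup>2) \<in> borel_measurable disc_area"
      by (intro measurable_disc_areaI continuous_intros dc)
    have "qint s (deriv f) a \<le> (\<integral>\<^sup>+ z. ennreal (2 powr s) * ennreal ((cmod (deriv f z))\<^sup>2 * disc_green z a powr s) \<partial>disc_area)"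
      unfolding qint_def
    \<comment> \<open>At z = a the weight is 1 while \<open>disc_green\<close> evaluates to 0 by
      convention, so the comparison can only hold almost everywhere.\<close>
    proof (rule nn_integral_mono_AE)
      show "AE z in disc_area. ennreal ((cmod (deriv f z))\<^sup>2 * disc_weight a z powr s)
          \<le> ennreal (2 powr s) * ennreal ((cmod (deriv f z))\<^sup>2 * disc_green z a powr s)"
        using AE_disc_area_neq[of a]
      proof (rule AE_mp, intro AE_I2 impI)
        fix z assume "z \<in> space disc_area" and za: "z \<noteq> a"
        hence z: "cmod z < 1" by simp
        define t where "t = cmod (disc_phi a z)"
        have t: "0 < t" "t < 1"
          using za norm_one_minus_cnj_mult(4)[OF a z] one_minus_disc_phi_bounds(3)[OF a z] by (auto simp: t_def disc_phi_def)
        have "ln t \<le> t - 1" using t by (intro ln_le_minus_one) auto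
        hence "2 * (1 - t) \<le> 2 * disc_green z a" using t by (simp add: disc_green_eq t_def[symmetric] ln_div)
        moreover have "1 - t\<^sup>2 \<le> 2 * (1 - t)" using one_minus_norm_square(3)[of "of_real t"] t by simp
        ultimately have "1 - t\<^sup>2 \<le> 2 * disc_green z a" by (rule order_trans[rotated])
        hence "(1 - t\<^sup>2) powr s \<le> (2 * disc_green z a) powr s"
          using s one_minus_norm_square(1)[of "of_real t"] t by (intro powr_mono2) auto
        hence "(1 - t\<^sup>2) powr s \<le> 2 powr s * disc_green z a powr s" by (simp only: powr_mult)
        hence "(cmod (deriv f z))\<^sup>2 * (1 - t\<^sup>2) powr s \<le> (cmod (deriv f z))\<^sup>2 * (2 powr s * disc_green z a powr s)"
          by (intro mult_left_mono) auto
        thus "ennreal ((cmod (deriv f z))\<^sup>2 * disc_weight a z powr s)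
          \<le> ennreal (2 powr s) * ennreal ((cmod (deriv f z))\<^sup>2 * disc_green z a powr s)"
          by (simp add: t_def ennreal_mult'[symmetric] ennreal_leI mult_ac)
      qed
    qed
    also have "\<dots> = ennreal (2 powr s) * I a"
      unfolding I_def by (intro nn_integral_cmult measurable_compose[OF _ measurable_ennreal] borel_measurable_times fm gm)
    finally show ?thesis .
  qed
  have le2: "I a \<le> ennreal (2 powr s) * qint s (deriv f) a + ennreal (228 * 8 * B\<^sup>2)"
    if a: "cmod a < 1" and B: "\<And>z. cmod z < 1 \<Longrightarrow> cmod (deriv f z) * (1 - cmod z) \<le> B" for a B
  proof -
    define d where "d = 1 - (cmod a)\<^sup>2"
    have d: "d > 0" using one_minus_norm_square[OF a] by (simp add: d_def)
    have mza: "(\<lambda>z. cmod (z - a)) \<in> borel_measurable disc_area"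
      by (intro measurable_disc_areaI continuous_intros)
    let ?N = "\<lambda>z. ennreal (cmod (z - a) powr (1 - 2)) * indicator {z. cmod (z - a) < d} z"
    have Nm: "?N \<in> borel_measurable disc_area"
      by (rule measurable_disc_area_borel) measurable
    have "I a \<le> (\<integral>\<^sup>+ z. ennreal (2 powr s) * ennreal ((cmod (deriv f z))\<^sup>2 * disc_weight a z powr s)
          + ennreal (228 * B\<^sup>2 / d) * ?N z \<partial>disc_area)"
      unfolding I_def
    proof (rule nn_integral_mono)
      fix z assume "z \<in> space disc_area"
      hence z: "cmod z < 1" by simp
      let ?t = "cmod (disc_phi a z)"
      show "ennreal ((cmod (deriv f z))\<^sup>2 * disc_green z a powr s)
         \<le> ennreal (2 powr s) * ennreal ((cmod (deriv f z))\<^sup>2 * (1 - ?t\<^sup>2) powr s) + ennreal (228 * B\<^sup>2 / d) * ?N z"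
      proof (cases "?t < 1 / 2")
        case True
        have "ennreal ((cmod (deriv f z))\<^sup>2 * disc_green z a powr s) \<le> ennreal (228 * B\<^sup>2 / d * cmod (z - a) powr (1 - 2))"
          unfolding d_def by (intro ennreal_leI green_near_pole_le(1)[OF s a z B[OF z] _ True]) simp
        also have "\<dots> = ennreal (228 * B\<^sup>2 / d) * ennreal (cmod (z - a) powr (1 - 2))"
          using d by (intro ennreal_mult) auto
        also have "ennreal (cmod (z - a) powr (1 - 2)) = ?N z"
          using green_near_pole_le(2)[OF s a z B[OF z] _ True] by (simp add: d_def)
        finally show ?thesis by (rule order_trans) simp
      next
        case False
        have t: "?t < 1" by (rule one_minus_disc_phi_bounds(3)[OF a z])
        have t1: "1 / ?t \<ge> 1" using t False by (intro iffD2[OF le_divide_eq_1_pos]) auto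
        have "ln (1 / ?t) \<le> 1 / ?t - 1" using False by (intro ln_le_minus_one) auto
        also have "\<dots> = (1 - ?t) / ?t" using False by (simp add: diff_divide_distrib) auto
        also have "\<dots> \<le> (1 - ?t) / (1 / 2)" using False t by (intro divide_left_mono) auto
        also have "\<dots> \<le> 2 * (1 - ?t\<^sup>2)" using one_minus_norm_square(2)[OF t] by simp
        finally have "disc_green z a powr s \<le> (2 * (1 - ?t\<^sup>2)) powr s"
          unfolding disc_green_eq using t1 s by (intro powr_mono2 ln_ge_zero) auto
        hence "disc_green z a powr s \<le> 2 powr s * (1 - ?t\<^sup>2) powr s" by (simp only: powr_mult)
        hence "(cmod (deriv f z))\<^sup>2 * disc_green z a powr s \<le> (cmod (deriv f z))\<^sup>2 * (2 powr s * (1 - ?t\<^sup>2) powr s)"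
          by (intro mult_left_mono) auto
        hence "ennreal ((cmod (deriv f z))\<^sup>2 * disc_green z a powr s)
           \<le> ennreal (2 powr s) * ennreal ((cmod (deriv f z))\<^sup>2 * (1 - ?t\<^sup>2) powr s)"
          by (simp add: ennreal_mult'[symmetric] ennreal_leI mult_ac)
        thus ?thesis by (rule order_trans) simp
      qed
    qed
    also have "\<dots> = ennreal (2 powr s) * qint s (deriv f) a + ennreal (228 * B\<^sup>2 / d) * (\<integral>\<^sup>+ z. ?N z \<partial>disc_area)"
      using phim[OF a] Nm unfolding qint_def
      by (subst nn_integral_add) (auto simp: nn_integral_cmult)
    \<comment> \<open>The integral of 1/|z - a| over |z - a| < d is of order d, which cancels the
      factor 1/d from the Bloch estimate and makes the bound uniform in a.\<close>
    also have "(\<integral>\<^sup>+ z. ?N z \<partial>disc_area) \<le> ennreal (4 * 1 / (1 - 2 powr - 1) * d powr 1)"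
      by (rule nn_integral_power_near[OF mza _ sublevel_disc_area]) (use d in auto)
    also have "4 * 1 / (1 - 2 powr - 1) * d powr 1 = 8 * d" using d by (simp add: powr_minus_divide)
    also have "ennreal (228 * B\<^sup>2 / d) * ennreal (8 * d) = ennreal (228 * 8 * B\<^sup>2)"
      using d by (simp add: ennreal_mult'[symmetric])
    finally show ?thesis by (simp add: add_left_mono mult_left_mono)
  qed
  have "f \<in> Q_space s \<longleftrightarrow> (\<exists>C\<ge>0. \<forall>a\<in>ball 0 1. I a \<le> ennreal C)"
    unfolding Q_space_def I_def SUP_less_top_iff[symmetric] using hol by simp
  also have "\<dots> \<longleftrightarrow> in_Q s (deriv f)"
  proof
    assume "\<exists>C\<ge>0. \<forall>a\<in>ball 0 1. I a \<le> ennreal C"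
    then obtain C where C: "C \<ge> 0" "\<And>a. cmod a < 1 \<Longrightarrow> I a \<le> ennreal C" by auto
    have "qint s (deriv f) a \<le> ennreal (2 powr s * C)" if a: "cmod a < 1" for a
    proof -
      have "qint s (deriv f) a \<le> ennreal (2 powr s) * ennreal C"
        using le1[OF a] C(2)[OF a] by (meson mult_left_mono order_trans zero_le)
      thus ?thesis using C by (simp add: ennreal_mult)
    qed
    thus "in_Q s (deriv f)" unfolding in_Q_def using C by (intro exI[of _ "2 powr s * C"]) auto
  next
    assume q: "in_Q s (deriv f)"
    from in_Q_bloch[OF dh s(1) q] obtain B where B: "\<And>z. cmod z < 1 \<Longrightarrow> cmod (deriv f z) * (1 - cmod z) \<le> B" by blast
    obtain C where C: "C \<ge> 0" "\<And>a. cmod a < 1 \<Longrightarrow> qint s (deriv f) a \<le> ennreal C"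
      using in_QE[OF q] by blast
    have "I a \<le> ennreal (2 powr s * C + 228 * 8 * B\<^sup>2)" if a: "cmod a < 1" for a
    proof -
      have "I a \<le> ennreal (2 powr s) * ennreal C + ennreal (228 * 8 * B\<^sup>2)"
        using le2[OF a B] C(2)[OF a] by (meson add_right_mono mult_left_mono order_trans zero_le)
      thus ?thesis using C by (simp add: ennreal_mult ennreal_plus)
    qed
    thus "\<exists>C\<ge>0. \<forall>a\<in>ball 0 1. I a \<le> ennreal C" using C
      by (intro exI[of _ "2 powr s * C + 228 * 8 * B\<^sup>2"]) auto
  qed
  finally show ?thesis using hol by simp
qed (simp add: Q_space_def)

subsection \<open>A Carleson embedding\<close>

lemma norm_powr_of_real:
  assumes "z \<noteq> 0"
  shows "cmod (z powr of_real x) = cmod z powr x"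
  using assms by (simp add: powr_def norm_exp_eq_Re)

lemma binomial_kernel_sums:
  assumes "cmod x < 1"
  shows "(\<lambda>n. of_real (pochhammer s n / fact n) * x ^ n) sums ((1 - x) powr of_real (- s))"
proof -
  have "(\<lambda>n. (of_real (- s) gchoose n) * (- x) ^ n) sums (1 + - x) powr of_real (- s)"
    by (rule gen_binomial_complex) (use assms in simp)
  moreover have "(of_real (- s) gchoose n) * (- x) ^ n = of_real (pochhammer s n / fact n) * x ^ n" for n
  proof -
    have m: "(-1) ^ n * (-1) ^ n = (1::complex)" by (simp flip: power_mult_distrib)
    have "(of_real (- s) gchoose n) * (- x) ^ n = ((-1) ^ n * (pochhammer (of_real s) n / fact n)) * ((-1) ^ n * x ^ n)"
      unfolding power_minus[of x] by (simp add: gbinomial_pochhammer)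
    also have "\<dots> = ((-1) ^ n * (-1) ^ n) * ((pochhammer (of_real s) n / fact n) * x ^ n)"
      by (simp only: mult_ac)
    finally show ?thesis unfolding m by (simp add: pochhammer_of_real)
  qed
  ultimately show ?thesis by simp
qed

text \<open>The coefficients are nonnegative, so for |x| \<le> r the tail of the series is at most
  its tail at r, which serves as E. Finite sums can thus be used in the duality argument while the
  bound is in terms of the modulus of the closed kernel.\<close>

lemma binomial_kernel_partial_sum:
  assumes s: "s > 0" and r: "0 \<le> r" "r < 1"
  obtains E where "E \<longlonglongrightarrow> 0" "\<And>N. E N \<ge> 0"
    "\<And>N x. cmod x \<le> r \<Longrightarrow> cmod (\<Sum>n<N. of_real (pochhammer s n / fact n) * x ^ n) \<le> cmod (1 - x) powr - s + E N"
proof -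
  define c where "c n = pochhammer s n / fact n" for n
  have c: "c n \<ge> 0" for n unfolding c_def using s by (intro divide_nonneg_pos less_imp_le pochhammer_pos) auto
  have smr: "summable (\<lambda>n. c n * r ^ n)"
  proof -
    have "summable (\<lambda>n. of_real (c n) * of_real r ^ n :: complex)"
      using binomial_kernel_sums[of "of_real r" s] r unfolding c_def by (intro sums_summable) auto
    from summable_Re[OF this] show ?thesis by (simp flip: of_real_power of_real_mult)
  qed
  define E where "E N = (\<Sum>n. c (n + N) * r ^ (n + N))" for N
  have E0: "E N \<ge> 0" for N
    unfolding E_def using c r by (intro suminf_nonneg summable_ignore_initial_segment[OF smr, of N]) auto
  have Elim: "E \<longlonglongrightarrow> 0"
  proof -
    have "E = (\<lambda>N. (\<Sum>n. c n * r ^ n) - (\<Sum>n<N. c n * r ^ n))"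
      unfolding E_def by (rule ext) (rule suminf_minus_initial_segment[OF smr])
    moreover have "(\<lambda>N. (\<Sum>n. c n * r ^ n) - (\<Sum>n<N. c n * r ^ n)) \<longlonglongrightarrow> (\<Sum>n. c n * r ^ n) - (\<Sum>n. c n * r ^ n)"
      by (intro tendsto_diff tendsto_const summable_LIMSEQ[OF smr])
    ultimately show ?thesis by simp
  qed
  show thesis
  proof (rule that[OF Elim E0])
    fix N and x :: complex assume x: "cmod x \<le> r"
    let ?f = "\<lambda>n. of_real (c n) * x ^ n"
    have x1: "cmod x < 1" using x r by simp
    have sums: "?f sums ((1 - x) powr of_real (- s))" using binomial_kernel_sums[OF x1, of s] by (simp add: c_def)
    have le: "norm (?f n) \<le> c n * r ^ n" for n
      using c x by (auto simp: norm_mult norm_power intro!: mult_left_mono power_mono)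
    have "(1 - x) powr of_real (- s) - (\<Sum>n<N. ?f n) = (\<Sum>n. ?f (n + N))"
      using suminf_minus_initial_segment[OF sums_summable[OF sums], of N] sums_unique[OF sums] by simp
    also have "norm \<dots> \<le> (\<Sum>n. norm (?f (n + N)))"
      by (rule summable_norm, rule summable_comparison_test'[OF summable_ignore_initial_segment[OF smr, of N], of 0])
         (use le in auto)
    also have "\<dots> \<le> E N" unfolding E_def
      by (intro suminf_le le summable_comparison_test'[OF summable_ignore_initial_segment[OF smr, of N], of 0]
            summable_ignore_initial_segment[OF smr]) (use le in auto)
    finally have "cmod ((1 - x) powr of_real (- s) - (\<Sum>n<N. ?f n)) \<le> E N" .
    moreover have "1 - x \<noteq> 0" using x1 by auto
    ultimately have "cmod (\<Sum>n<N. ?f n) \<le> cmod (1 - x) powr - s + E N"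
      using norm_triangle_ineq3[of "(1 - x) powr of_real (- s)" "\<Sum>n<N. ?f n"] norm_powr_of_real[of "1 - x" "- s"] by simp
    thus "cmod (\<Sum>n<N. of_real (pochhammer s n / fact n) * x ^ n) \<le> cmod (1 - x) powr - s + E N" by (simp add: c_def)
  qed
qed

text \<open>
  The kernel \<open>(1 - z * cnj w) powr - s\<close> reproduces the space normed by the coefficient sum, so the
  embedding follows from Schur's test for its modulus.
\<close>

lemma carleson_embedding:
  assumes M: "finite_measure M" and sets: "sets M = sets disc_area"
    and supp: "AE z in M. cmod z \<le> \<rho>" and \<rho>: "0 \<le> \<rho>" "\<rho> < 1" and s: "s > 0"
    and K: "K \<ge> 0" "\<And>w. cmod w < 1 \<Longrightarrow> (\<integral>\<^sup>+ z. ennreal (cmod (1 - cnj w * z) powr - s) \<partial>M) \<le> ennreal K"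
    and F: "F holomorphic_on ball 0 1"
    and S: "\<And>N. (\<Sum>n<N. (cmod ((deriv ^^ n) F 0 / fact n))\<^sup>2 / (pochhammer s n / fact n)) \<le> S"
  shows "(\<integral>\<^sup>+ z. ennreal ((cmod (F z))\<^sup>2) \<partial>M) \<le> ennreal (K * S)"
proof -
  interpret finite_measure M by (rule M)
  interpret MM: pair_sigma_finite M M ..
  define a where "a n = (deriv ^^ n) F 0 / fact n" for n
  define c where "c n = pochhammer s n / fact n" for n
  have c: "c n > 0" for n unfolding c_def using s by (intro divide_pos_pos pochhammer_pos) auto
  have sp: "space M = ball 0 1" using sets_eq_imp_space_eq[OF sets] by simp
  have meas: "h \<in> borel_measurable M" if "continuous_on (ball 0 1) h" for h :: "complex \<Rightarrow> 'b::topological_space"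
    using measurable_disc_areaI[OF that] sets by (simp cong: measurable_cong_sets)
  have Fc: "continuous_on (ball 0 1) F" by (rule holomorphic_on_imp_continuous_on[OF F])
  have [measurable]: "F \<in> borel_measurable M" by (rule meas[OF Fc])
  have [measurable]: "(\<lambda>z. z) \<in> M \<rightarrow>\<^sub>M borel" by (rule meas) (rule continuous_on_id)
  have [measurable]: "cnj \<in> borel \<rightarrow>\<^sub>M borel" by (intro borel_measurable_continuous_onI continuous_intros)
  have "compact (F ` cball 0 \<rho>)"
    by (intro compact_continuous_image continuous_on_subset[OF Fc]) (use \<rho> in auto)
  from compact_imp_bounded[OF this] obtain B where "\<forall>z\<in>cball 0 \<rho>. cmod (F z) \<le> B"
    unfolding bounded_iff by blast
  hence B: "\<And>z. cmod z \<le> \<rho> \<Longrightarrow> cmod (F z) \<le> B" by simp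
  have B0: "B \<ge> 0" using B[of 0] \<rho> by (auto intro: order_trans[rotated])
  have int: "integrable M h" if "h \<in> borel_measurable M" "\<And>z. cmod z \<le> \<rho> \<Longrightarrow> norm (h z) \<le> C"
    for h :: "complex \<Rightarrow> 'b::{banach, second_countable_topology}" and C
  proof (rule integrable_const_bound)
    show "AE z in M. norm (h z) \<le> C" using supp by eventually_elim (rule that(2))
  qed (rule that(1))
  define X where "X = (\<integral>z. (cmod (F z))\<^sup>2 \<partial>M)"
  define L where "L = (\<integral>z. cmod (F z) \<partial>M)"
  have intF: "integrable M F" by (rule int[OF _ B]) auto
  have intF1: "integrable M (\<lambda>z. cmod (F z))" by (rule integrable_norm[OF intF])
  have intF2: "integrable M (\<lambda>z. (cmod (F z))\<^sup>2)"
    by (rule int[of _ "B\<^sup>2"]) (auto intro: power_mono B)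
  have X0: "X \<ge> 0" unfolding X_def by (intro integral_nonneg_AE) auto
  have nnX: "(\<integral>\<^sup>+ z. ennreal ((cmod (F z))\<^sup>2) \<partial>M) = ennreal X"
    unfolding X_def by (rule nn_integral_eq_integral[OF intF2]) auto
  have nnL: "(\<integral>\<^sup>+ z. ennreal (cmod (F z)) \<partial>M) = ennreal L"
    unfolding L_def by (rule nn_integral_eq_integral[OF intF1]) auto
  have L0: "L \<ge> 0" unfolding L_def by (intro integral_nonneg_AE) auto
  have zle: "cmod (z ^ n) \<le> 1" if "cmod z \<le> \<rho>" for z n
    using that \<rho> by (auto simp: norm_power intro: power_le_one)
  have zF: "cmod z ^ n * cmod (F z) \<le> B" if "cmod z \<le> \<rho>" for z n
    using mult_mono[OF zle[OF that, of n] B[OF that]] by (simp add: norm_power)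
  have intb: "integrable M (\<lambda>z. z ^ n * cnj (F z))" for n
    by (rule int[of _ B]) (auto simp: norm_mult norm_power zF)
  have intb': "integrable M (\<lambda>z. cnj z ^ n * F z)" for n
    by (rule int[of _ B]) (auto simp: norm_mult norm_power zF)
  \<comment> \<open>Duality: X is the limit of the sums of \<open>a n * b n\<close>. Cauchy-Schwarz
    with the weights \<open>c n\<close> separates the coefficients of F, which contribute S, from
    \<open>T N\<close>, the sum of \<open>c n\<close> times |b n|^2. The latter is a double integral
    of F against the partial kernel, and Schur's test bounds it by K X up to a vanishing error, so
    that X^2 \<le> S K X.\<close>
  define b where "b n = (\<integral>z. z ^ n * cnj (F z) \<partial>M)" for n
  have cnjb: "cnj (b n) = (\<integral>z. cnj z ^ n * F z \<partial>M)" for n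
    unfolding b_def using Bochner_Integration.integral_cnj[of M "\<lambda>z. z ^ n * cnj (F z)"] by simp
  define T where "T N = (\<Sum>n<N. c n * (cmod (b n))\<^sup>2)" for N
  have sums: "(\<lambda>n. a n * z ^ n) sums F z" if "cmod z < 1" for z
    using holomorphic_power_series[OF F, of z] that by (simp add: a_def)
  define P where "P N z = (\<Sum>n<N. a n * z ^ n)" for N z

  have lim: "(\<lambda>N. \<Sum>n<N. a n * b n) \<longlonglongrightarrow> of_real X"
  proof -
    define r where "r = (\<rho> + 1) / 2"
    have r: "\<rho> < r" "r < 1" using \<rho> by (auto simp: r_def)
    have "summable (\<lambda>n. a n * of_real r ^ n)"
      using sums_summable[OF sums, of "of_real r"] r \<rho> by simp
    hence "summable (\<lambda>n. cmod (a n * of_real \<rho> ^ n))"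
      by (rule powser_insidea) (use r \<rho> in auto)
    hence ab: "summable (\<lambda>n. cmod (a n) * \<rho> ^ n)" using \<rho> by (simp only: norm_mult norm_power norm_of_real abs_of_nonneg)
    define A where "A = (\<Sum>n. cmod (a n) * \<rho> ^ n)"
    have PA: "cmod (P N z) \<le> A" if "cmod z \<le> \<rho>" for N z
      unfolding P_def A_def by (rule norm_powser_partial_sum_le[OF ab that])
    have [measurable]: "P N \<in> borel_measurable M" for N
      unfolding P_def by (intro meas continuous_intros)
    have A0: "A \<ge> 0" using order_trans[OF norm_ge_zero PA[of 0 0]] \<rho> by simp
    have "(\<lambda>N. \<integral>z. P N z * cnj (F z) \<partial>M) \<longlonglongrightarrow> (\<integral>z. F z * cnj (F z) \<partial>M)"
    proof (rule integral_dominated_convergence[where w = "\<lambda>_. A * B"])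
      show "AE z in M. (\<lambda>N. P N z * cnj (F z)) \<longlonglongrightarrow> F z * cnj (F z)"
      proof (rule AE_I2)
        fix z assume "z \<in> space M"
        hence "(\<lambda>N. P N z) \<longlonglongrightarrow> F z" using sums[of z] sp by (simp add: P_def sums_def)
        thus "(\<lambda>N. P N z * cnj (F z)) \<longlonglongrightarrow> F z * cnj (F z)" by (intro tendsto_intros)
      qed
      show "AE z in M. norm (P N z * cnj (F z)) \<le> A * B" for N
        using supp by eventually_elim (auto simp: norm_mult intro!: mult_mono PA B A0)
    qed auto
    moreover have "(\<integral>z. P N z * cnj (F z) \<partial>M) = (\<Sum>n<N. a n * b n)" for N
    proof -
      have "P N z * cnj (F z) = (\<Sum>n<N. a n * (z ^ n * cnj (F z)))" for z
        by (simp add: P_def sum_distrib_right mult.assoc)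
      thus ?thesis unfolding b_def
        by (simp only: intb integrable_mult_right Bochner_Integration.integral_sum integral_mult_right_zero)
    qed
    moreover have "(\<integral>z. F z * cnj (F z) \<partial>M) = of_real X"
    proof -
      have "F z * cnj (F z) = of_real ((cmod (F z))\<^sup>2)" for z by (rule complex_norm_square[symmetric])
      thus ?thesis unfolding X_def by (simp only: integral_complex_of_real)
    qed
    ultimately show ?thesis by simp
  qed

  have CS: "(cmod (\<Sum>n<N. a n * b n))\<^sup>2 \<le> S * T N" for N
  proof -
    have T0: "T N \<ge> 0" unfolding T_def using c by (intro sum_nonneg mult_nonneg_nonneg) (auto intro: less_imp_le)
    have "cmod (\<Sum>n<N. a n * b n) \<le> (\<Sum>n<N. cmod (a n) * cmod (b n))"
      using norm_sum[of "\<lambda>n. a n * b n" "{..<N}"] by (simp add: norm_mult)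
    also have "\<dots> = (\<Sum>n<N. (cmod (a n) / sqrt (c n)) * (sqrt (c n) * cmod (b n)))"
      using c by (intro sum.cong refl) (simp add: less_imp_neq[symmetric])
    finally have "(cmod (\<Sum>n<N. a n * b n))\<^sup>2 \<le> (\<Sum>n<N. (cmod (a n) / sqrt (c n)) * (sqrt (c n) * cmod (b n)))\<^sup>2"
      by (rule power_mono) simp
    also have "\<dots> \<le> (\<Sum>n<N. (cmod (a n) / sqrt (c n))\<^sup>2) * (\<Sum>n<N. (sqrt (c n) * cmod (b n))\<^sup>2)"
      by (rule Cauchy_Schwarz_ineq_sum)
    also have "\<dots> = (\<Sum>n<N. (cmod (a n))\<^sup>2 / c n) * T N"
      unfolding T_def using c by (simp add: power_divide power_mult_distrib less_imp_le)
    also have "\<dots> \<le> S * T N" using S[of N] T0 unfolding a_def c_def by (intro mult_right_mono) auto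
    finally show ?thesis .
  qed

  have \<rho>2: "0 \<le> \<rho>\<^sup>2" "\<rho>\<^sup>2 < 1" using \<rho> by (auto simp: abs_square_less_1)
  obtain E where E: "E \<longlonglongrightarrow> 0" "\<And>N. E N \<ge> 0"
    "\<And>N x. cmod x \<le> \<rho>\<^sup>2 \<Longrightarrow> cmod (\<Sum>n<N. of_real (pochhammer s n / fact n) * x ^ n) \<le> cmod (1 - x) powr - s + E N"
    using binomial_kernel_partial_sum[OF s \<rho>2] by blast
  define k where "k w z = cmod (1 - cnj w * z) powr - s" for w z
  have k0: "k w z \<ge> 0" for w z by (simp add: k_def)
  have ksym: "k w z = k z w" for w z
  proof -
    have "cmod (1 - cnj w * z) = cmod (cnj (1 - cnj w * z))" by (simp only: complex_mod_cnj)
    thus ?thesis by (simp add: k_def mult.commute)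
  qed
  have [measurable]: "case_prod k \<in> borel_measurable (M \<Otimes>\<^sub>M M)"
    unfolding k_def case_prod_beta' by measurable
  have [measurable]: "k w \<in> borel_measurable M" for w
    unfolding k_def by measurable
  have Tle: "T N \<le> K * X + E N * L\<^sup>2" for N
  proof -
    \<comment> \<open>The partial kernel operator applied to cnj F; pairing it with F recovers
      \<open>T N\<close>.\<close>
    define Q where "Q w = (\<Sum>n<N. of_real (c n) * b n * cnj w ^ n)" for w
    have T1: "of_real (T N) = (\<integral>w. Q w * F w \<partial>M)"
    proof -
      have "(\<integral>w. Q w * F w \<partial>M) = (\<integral>w. (\<Sum>n<N. (of_real (c n) * b n) * (cnj w ^ n * F w)) \<partial>M)"
        by (simp add: Q_def sum_distrib_right mult.assoc)
      also have "\<dots> = (\<Sum>n<N. (of_real (c n) * b n) * cnj (b n))"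
        unfolding cnjb by (simp only: intb' integrable_mult_right Bochner_Integration.integral_sum integral_mult_right_zero)
      also have "\<dots> = of_real (T N)" unfolding T_def by (simp add: mult.assoc flip: complex_norm_square)
      finally show ?thesis ..
    qed
    have Q: "ennreal (cmod (Q w)) \<le> (\<integral>\<^sup>+ z. ennreal ((k w z + E N) * cmod (F z)) \<partial>M)" if w: "cmod w \<le> \<rho>" for w
    proof -
      define \<kappa> where "\<kappa> z = (\<Sum>n<N. of_real (c n) * (cnj w * z) ^ n)" for z
      have "Q w = (\<integral>z. (\<Sum>n<N. (of_real (c n) * cnj w ^ n) * (z ^ n * cnj (F z))) \<partial>M)"
        unfolding Q_def b_def
        by (simp only: intb integrable_mult_right Bochner_Integration.integral_sum integral_mult_right_zero)
           (simp add: mult_ac)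
      also have "\<dots> = (\<integral>z. \<kappa> z * cnj (F z) \<partial>M)"
        unfolding \<kappa>_def sum_distrib_right power_mult_distrib by (simp only: mult.assoc mult.left_commute)
      finally have "ennreal (cmod (Q w)) \<le> (\<integral>\<^sup>+ z. ennreal (cmod (\<kappa> z * cnj (F z))) \<partial>M)"
        using integral_norm_bound_ennreal[of M "\<lambda>z. \<kappa> z * cnj (F z)"]
        by (cases "integrable M (\<lambda>z. \<kappa> z * cnj (F z))") (auto simp: not_integrable_integral_eq)
      also have "\<dots> \<le> (\<integral>\<^sup>+ z. ennreal ((k w z + E N) * cmod (F z)) \<partial>M)"
      proof (rule nn_integral_mono_AE)
        show "AE z in M. ennreal (cmod (\<kappa> z * cnj (F z))) \<le> ennreal ((k w z + E N) * cmod (F z))"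
          using supp
        proof eventually_elim
          fix z assume z: "cmod z \<le> \<rho>"
          have "cmod (cnj w * z) \<le> \<rho> * \<rho>" unfolding norm_mult using w z \<rho> by (intro mult_mono) auto
          hence "cmod (\<kappa> z) \<le> k w z + E N" unfolding \<kappa>_def c_def k_def by (intro E(3)) (simp add: power2_eq_square)
          thus "ennreal (cmod (\<kappa> z * cnj (F z))) \<le> ennreal ((k w z + E N) * cmod (F z))"
            by (auto simp: norm_mult intro!: ennreal_leI mult_right_mono)
        qed
      qed
      finally show ?thesis .
    qed
    have half: "ennreal (1/2) + ennreal (1/2) = 1" by (subst ennreal_plus[symmetric]) auto
    have T0: "T N \<ge> 0" unfolding T_def using c by (intro sum_nonneg mult_nonneg_nonneg) (auto intro: less_imp_le)
    have "ennreal (T N) = ennreal (cmod (\<integral>w. Q w * F w \<partial>M))" using T0 by (simp flip: T1)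
    also have "\<dots> \<le> (\<integral>\<^sup>+ w. ennreal (cmod (Q w * F w)) \<partial>M)"
      using integral_norm_bound_ennreal[of M "\<lambda>w. Q w * F w"]
      by (cases "integrable M (\<lambda>w. Q w * F w)") (auto simp: not_integrable_integral_eq)
    also have "\<dots> \<le> (\<integral>\<^sup>+ w. \<integral>\<^sup>+ z. ennreal (1/2) * ennreal (k w z * (cmod (F z))\<^sup>2) + ennreal (1/2) * ennreal (k w z * (cmod (F w))\<^sup>2)
         + ennreal (E N * cmod (F w)) * ennreal (cmod (F z)) \<partial>M \<partial>M)"
    proof (rule nn_integral_mono_AE)
      show "AE w in M. ennreal (cmod (Q w * F w)) \<le>
        (\<integral>\<^sup>+ z. ennreal (1/2) * ennreal (k w z * (cmod (F z))\<^sup>2) + ennreal (1/2) * ennreal (k w z * (cmod (F w))\<^sup>2)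
         + ennreal (E N * cmod (F w)) * ennreal (cmod (F z)) \<partial>M)"
        using supp
      proof eventually_elim
        fix w assume w: "cmod w \<le> \<rho>"
        have "ennreal (cmod (Q w * F w)) = ennreal (cmod (F w)) * ennreal (cmod (Q w))"
          by (simp add: norm_mult ennreal_mult mult.commute)
        also have "\<dots> \<le> ennreal (cmod (F w)) * (\<integral>\<^sup>+ z. ennreal ((k w z + E N) * cmod (F z)) \<partial>M)"
          by (intro mult_left_mono Q[OF w]) auto
        also have "\<dots> = (\<integral>\<^sup>+ z. ennreal (cmod (F w)) * ennreal ((k w z + E N) * cmod (F z)) \<partial>M)"
          by (rule nn_integral_cmult[symmetric]) measurable
        also have "\<dots> \<le> (\<integral>\<^sup>+ z. ennreal (1/2) * ennreal (k w z * (cmod (F z))\<^sup>2) + ennreal (1/2) * ennreal (k w z * (cmod (F w))\<^sup>2)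
         + ennreal (E N * cmod (F w)) * ennreal (cmod (F z)) \<partial>M)"
        proof (rule nn_integral_mono)
          fix z
          \<comment> \<open>Schur's test with the constant function 1: the product is split into
            halves of squares, and by the symmetry of k both halves give the same double integral,
            whose inner integral is at most K.\<close>
          have "cmod (F w) * cmod (F z) \<le> 1/2 * (cmod (F z))\<^sup>2 + 1/2 * (cmod (F w))\<^sup>2"
            using sum_squares_bound[of "cmod (F z)" "cmod (F w)"] by (simp add: mult_ac)
          hence "k w z * (cmod (F w) * cmod (F z)) \<le> k w z * (1/2 * (cmod (F z))\<^sup>2 + 1/2 * (cmod (F w))\<^sup>2)"
            using k0 by (rule mult_left_mono)
          hence "cmod (F w) * ((k w z + E N) * cmod (F z)) \<le>
             (1/2 * (k w z * (cmod (F z))\<^sup>2) + 1/2 * (k w z * (cmod (F w))\<^sup>2)) + (E N * cmod (F w)) * cmod (F z)"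
            by (simp add: algebra_simps)
          hence "ennreal (cmod (F w) * ((k w z + E N) * cmod (F z))) \<le>
             ennreal ((1/2 * (k w z * (cmod (F z))\<^sup>2) + 1/2 * (k w z * (cmod (F w))\<^sup>2)) + (E N * cmod (F w)) * cmod (F z))"
            by (rule ennreal_leI)
          also have "\<dots> = ennreal (1/2) * ennreal (k w z * (cmod (F z))\<^sup>2) + ennreal (1/2) * ennreal (k w z * (cmod (F w))\<^sup>2)
             + ennreal (E N * cmod (F w)) * ennreal (cmod (F z))"
            using k0 E(2) by (simp only: ennreal_plus ennreal_mult' mult_nonneg_nonneg add_nonneg_nonneg zero_le_power2 norm_ge_zero zero_le_divide_1_iff zero_le_numeral)
          finally show "ennreal (cmod (F w)) * ennreal ((k w z + E N) * cmod (F z)) \<le> \<dots>"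
            by (simp add: ennreal_mult'[symmetric])
        qed
        finally show "ennreal (cmod (Q w * F w)) \<le>
          (\<integral>\<^sup>+ z. ennreal (1/2) * ennreal (k w z * (cmod (F z))\<^sup>2) + ennreal (1/2) * ennreal (k w z * (cmod (F w))\<^sup>2)
            + ennreal (E N * cmod (F w)) * ennreal (cmod (F z)) \<partial>M)" .
      qed
    qed
    also have "\<dots> = ennreal (1/2) * (\<integral>\<^sup>+ w. \<integral>\<^sup>+ z. ennreal (k w z * (cmod (F z))\<^sup>2) \<partial>M \<partial>M)
       + ennreal (1/2) * (\<integral>\<^sup>+ w. \<integral>\<^sup>+ z. ennreal (k w z * (cmod (F w))\<^sup>2) \<partial>M \<partial>M)
       + (\<integral>\<^sup>+ w. ennreal (E N * cmod (F w)) * (\<integral>\<^sup>+ z. ennreal (cmod (F z)) \<partial>M) \<partial>M)"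
      by (simp add: nn_integral_add nn_integral_cmult)
    also have "(\<integral>\<^sup>+ w. \<integral>\<^sup>+ z. ennreal (k w z * (cmod (F z))\<^sup>2) \<partial>M \<partial>M) =
        (\<integral>\<^sup>+ z. \<integral>\<^sup>+ w. ennreal (k w z * (cmod (F z))\<^sup>2) \<partial>M \<partial>M)"
      by (rule MM.Fubini') measurable
    also have "\<dots> = (\<integral>\<^sup>+ w. \<integral>\<^sup>+ z. ennreal (k w z * (cmod (F w))\<^sup>2) \<partial>M \<partial>M)"
      by (subst ksym) (rule refl)
    also have "ennreal (1/2) * (\<integral>\<^sup>+ w. \<integral>\<^sup>+ z. ennreal (k w z * (cmod (F w))\<^sup>2) \<partial>M \<partial>M)
       + ennreal (1/2) * (\<integral>\<^sup>+ w. \<integral>\<^sup>+ z. ennreal (k w z * (cmod (F w))\<^sup>2) \<partial>M \<partial>M)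
        = (\<integral>\<^sup>+ w. \<integral>\<^sup>+ z. ennreal (k w z * (cmod (F w))\<^sup>2) \<partial>M \<partial>M)"
      unfolding distrib_right[symmetric] half by (rule mult_1)
    also have "(\<integral>\<^sup>+ w. \<integral>\<^sup>+ z. ennreal (k w z * (cmod (F w))\<^sup>2) \<partial>M \<partial>M) \<le> (\<integral>\<^sup>+ w. ennreal K * ennreal ((cmod (F w))\<^sup>2) \<partial>M)"
    proof (rule nn_integral_mono)
      fix w assume "w \<in> space M"
      hence w: "cmod w < 1" using sp by simp
      have "(\<integral>\<^sup>+ z. ennreal (k w z * (cmod (F w))\<^sup>2) \<partial>M) = (\<integral>\<^sup>+ z. ennreal (k w z) \<partial>M) * ennreal ((cmod (F w))\<^sup>2)"
        using k0 by (simp add: ennreal_mult nn_integral_multc)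
      also have "\<dots> \<le> ennreal K * ennreal ((cmod (F w))\<^sup>2)"
        unfolding k_def by (intro mult_right_mono K(2)[OF w]) auto
      finally show "(\<integral>\<^sup>+ z. ennreal (k w z * (cmod (F w))\<^sup>2) \<partial>M) \<le> ennreal K * ennreal ((cmod (F w))\<^sup>2)" .
    qed
    also have "(\<integral>\<^sup>+ w. ennreal K * ennreal ((cmod (F w))\<^sup>2) \<partial>M) = ennreal (K * X)"
      using K X0 by (simp add: nn_integral_cmult nnX ennreal_mult)
    also have "(\<integral>\<^sup>+ w. ennreal (E N * cmod (F w)) * (\<integral>\<^sup>+ z. ennreal (cmod (F z)) \<partial>M) \<partial>M) = ennreal (E N * L\<^sup>2)"
      using E(2)[of N] L0 unfolding nnL
      by (simp add: nn_integral_multc ennreal_mult nn_integral_cmult nnL power2_eq_square mult.assoc)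
    also have "ennreal (K * X) + ennreal (E N * L\<^sup>2) = ennreal (K * X + E N * L\<^sup>2)"
      using K X0 E(2)[of N] by (simp add: ennreal_plus)
    finally have "ennreal (T N) \<le> ennreal (K * X + E N * L\<^sup>2)" by (simp add: add_right_mono)
    moreover have "K * X + E N * L\<^sup>2 \<ge> 0" using K X0 E(2)[of N] by simp
    ultimately show ?thesis by (simp only: ennreal_le_iff)
  qed
  have S0: "S \<ge> 0" using S[of 0] by simp
  have "X\<^sup>2 \<le> S * (K * X)"
  proof (rule LIMSEQ_le)
    show "(\<lambda>N. (cmod (\<Sum>n<N. a n * b n))\<^sup>2) \<longlonglongrightarrow> X\<^sup>2"
      using tendsto_power[OF tendsto_norm[OF lim], of 2] by simp
    show "(\<lambda>N. S * (K * X + E N * L\<^sup>2)) \<longlonglongrightarrow> S * (K * X)"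
      using tendsto_mult[OF tendsto_const[of S] tendsto_add[OF tendsto_const[of "K * X"] tendsto_mult[OF E(1) tendsto_const[of "L\<^sup>2"]]]] by simp
    show "\<exists>N0. \<forall>N\<ge>N0. (cmod (\<Sum>n<N. a n * b n))\<^sup>2 \<le> S * (K * X + E N * L\<^sup>2)"
      using CS Tle S0 by (meson mult_left_mono order_trans)
  qed
  hence "X * X \<le> (K * S) * X" by (simp add: power2_eq_square mult_ac)
  \<comment> \<open>Cancelling X is legitimate because it is a finite real: M is finite and F is
    bounded on \<open>cball 0 \<rho>\<close>, which carries M.\<close>
  hence "X \<le> K * S"
  proof (cases "X = 0")
    case False
    thus ?thesis using X0 \<open>X * X \<le> (K * S) * X\<close> by (simp add: mult_le_cancel_right)
  qed (use K S0 in simp)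
  thus ?thesis unfolding nnX by (rule ennreal_leI)
qed

text \<open>The coefficient of index n + 1 of F is the one of index n of F' divided by n + 1, so
  Bessel's inequality for F' controls every term but the constant one, which is |F(0)|^2.\<close>

lemma dirichlet_sum_le:
  assumes F: "F holomorphic_on ball 0 1" and s: "s > 0" and J: "qint s (deriv F) 0 \<le> ennreal J" "J \<ge> 0"
  shows "(\<Sum>n<N. (cmod ((deriv ^^ n) F 0 / fact n))\<^sup>2 / (pochhammer s n / fact n)) \<le> (cmod (F 0))\<^sup>2 + (1 + s) / s * J"
proof (cases N)
  case 0
  thus ?thesis using J s by simp
next
  case (Suc K)
  define b where "b n = (deriv ^^ n) (deriv F) 0 / fact n" for n
  have dF: "deriv F holomorphic_on ball 0 1" by (rule holomorphic_deriv[OF F open_ball])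
  have ab: "(deriv ^^ Suc n) F 0 / fact (Suc n) = b n / of_nat (Suc n)" for n
    unfolding b_def funpow_Suc_right o_def by (simp add: field_simps)
  have step: "(cmod ((deriv ^^ Suc n) F 0 / fact (Suc n)))\<^sup>2 / (pochhammer s (Suc n) / fact (Suc n))
      \<le> (1 + s) / s * ((cmod (b n))\<^sup>2 * Beta (real n + 1) (s + 1))" for n
  proof -
    have "(cmod ((deriv ^^ Suc n) F 0 / fact (Suc n)))\<^sup>2 / (pochhammer s (Suc n) / fact (Suc n)) =
       (cmod (b n))\<^sup>2 / (real (Suc n))\<^sup>2 * (fact (Suc n) / pochhammer s (Suc n))"
      unfolding ab by (simp only: norm_divide norm_of_nat power_divide divide_divide_eq_right times_divide_eq_right)
    also have "\<dots> \<le> (cmod (b n))\<^sup>2 / (real (Suc n))\<^sup>2 * ((1 + s) / s * ((real (Suc n))\<^sup>2 * Beta (real n + 1) (s + 1)))"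
      by (intro mult_left_mono dirichlet_coefficient_le s) auto
    also have "\<dots> = (1 + s) / s * ((cmod (b n))\<^sup>2 * Beta (real n + 1) (s + 1)) * ((real (Suc n))\<^sup>2 / (real (Suc n))\<^sup>2)"
      by (simp only: times_divide_eq_left times_divide_eq_right mult_ac)
    also have "(real (Suc n))\<^sup>2 / (real (Suc n))\<^sup>2 = 1" by simp
    finally show ?thesis by simp
  qed
  have "(\<Sum>n<N. (cmod ((deriv ^^ n) F 0 / fact n))\<^sup>2 / (pochhammer s n / fact n)) =
     (cmod (F 0))\<^sup>2 + (\<Sum>n<K. (cmod ((deriv ^^ Suc n) F 0 / fact (Suc n)))\<^sup>2 / (pochhammer s (Suc n) / fact (Suc n)))"
    unfolding Suc sum.lessThan_Suc_shift by simp
  also have "\<dots> \<le> (cmod (F 0))\<^sup>2 + (\<Sum>n<K. (1 + s) / s * ((cmod (b n))\<^sup>2 * Beta (real n + 1) (s + 1)))"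
    by (intro add_left_mono sum_mono step)
  also have "\<dots> = (cmod (F 0))\<^sup>2 + (1 + s) / s * (\<Sum>n<K. (cmod (b n))\<^sup>2 * Beta (real n + 1) (s + 1))"
    by (simp add: sum_distrib_left)
  also have "\<dots> \<le> (cmod (F 0))\<^sup>2 + (1 + s) / s * J"
    unfolding b_def using s by (intro add_left_mono mult_left_mono bessel_disc[OF dF s J]) auto
  finally show ?thesis .
qed

text \<open>The measure with density |h|^2 (1 - |z|^2)^s is cut off at radius r to make it compactly
  supported; the kernel bound K survives the cut-off, so the estimate is uniform in r and the discs
  exhaust.\<close>

lemma carleson_embedding_disc:
  assumes h: "h holomorphic_on ball 0 1" and s: "s > 0"
    and K: "K \<ge> 0" "\<And>w. cmod w < 1 \<Longrightarrow>
      (\<integral>\<^sup>+ z. ennreal ((cmod (h z))\<^sup>2 * (1 - (cmod z)\<^sup>2) powr s * cmod (1 - cnj w * z) powr - s) \<partial>disc_area) \<le> ennreal K"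
    and F: "F holomorphic_on ball 0 1"
    and J: "qint s (deriv F) 0 \<le> ennreal J" "J \<ge> 0"
  shows "(\<integral>\<^sup>+ z. ennreal ((cmod (h z))\<^sup>2 * (1 - (cmod z)\<^sup>2) powr s * (cmod (F z))\<^sup>2) \<partial>disc_area)
    \<le> ennreal (K * ((cmod (F 0))\<^sup>2 + (1 + s) / s * J))"
proof -
  define v where "v z = (cmod (h z))\<^sup>2 * (1 - (cmod z)\<^sup>2) powr s" for z
  have v0: "v z \<ge> 0" for z by (simp add: v_def)
  have vm[measurable]: "v \<in> borel_measurable disc_area" unfolding v_def
    by (intro measurable_disc_areaI continuous_intros continuous_on_radial_weight holomorphic_on_imp_continuous_on h)
  have Fm[measurable]: "F \<in> borel_measurable disc_area"
    by (intro measurable_disc_areaI holomorphic_on_imp_continuous_on F)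
  have "(\<integral>\<^sup>+ z. ennreal (v z * (cmod (F z))\<^sup>2) \<partial>disc_area) \<le> ennreal (K * ((cmod (F 0))\<^sup>2 + (1 + s) / s * J))"
  proof (rule nn_integral_disc_area_exhaust)
    show "(\<lambda>z. ennreal (v z * (cmod (F z))\<^sup>2)) \<in> borel_measurable disc_area"
      by (intro measurable_compose[OF _ measurable_ennreal] borel_measurable_times borel_measurable_power measurable_compose[OF Fm borel_measurable_norm] vm)
    fix r :: real assume r: "0 \<le> r" "r < 1"
    define u where "u z = ennreal (v z) * indicator (ball 0 r) z" for z
    have um: "u \<in> borel_measurable disc_area" unfolding u_def[abs_def]
      by (intro borel_measurable_times_ennreal measurable_compose[OF vm measurable_ennreal] measurable_disc_area_borel borel_measurable_indicator) simp
    define M where "M = density disc_area u"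
    have sets: "sets M = sets disc_area" by (simp add: M_def)
    have le: "(\<integral>\<^sup>+ z. f z \<partial>M) = (\<integral>\<^sup>+ z. u z * f z \<partial>disc_area)" if "f \<in> borel_measurable disc_area" for f
      unfolding M_def by (rule nn_integral_density[OF um that])
    have kern: "(\<integral>\<^sup>+ z. ennreal (cmod (1 - cnj w * z) powr - s) \<partial>M) \<le> ennreal K" if w: "cmod w < 1" for w
    proof -
      have "(\<integral>\<^sup>+ z. ennreal (cmod (1 - cnj w * z) powr - s) \<partial>M) = (\<integral>\<^sup>+ z. u z * ennreal (cmod (1 - cnj w * z) powr - s) \<partial>disc_area)"
        by (rule le) (rule measurable_disc_area_borel, measurable)
      also have "\<dots> \<le> (\<integral>\<^sup>+ z. ennreal (v z * cmod (1 - cnj w * z) powr - s) \<partial>disc_area)"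
        by (rule nn_integral_mono) (auto simp: u_def indicator_def ennreal_mult v0)
      also have "\<dots> \<le> ennreal K" unfolding v_def by (rule K(2)[OF w])
      finally show ?thesis .
    qed
    have fin: "finite_measure M"
    proof
      \<comment> \<open>For w = 0 the kernel is identically 1, so the Schur hypothesis already
        contains the finiteness of the measure.\<close>
      have "emeasure M (space M) = (\<integral>\<^sup>+ z. ennreal (cmod (1 - cnj 0 * z) powr - s) \<partial>M)" by simp
      also have "\<dots> \<le> ennreal K" by (rule kern) simp
      finally show "emeasure M (space M) \<noteq> \<infinity>" by (auto simp: top_unique)
    qed
    have supp: "AE z in M. cmod z \<le> r"
      unfolding M_def by (subst AE_density[OF um]) (auto simp: u_def indicator_def intro!: AE_I2 split: if_splits)
    have "(\<integral>\<^sup>+ z. ennreal (v z * (cmod (F z))\<^sup>2) * indicator (ball 0 r) z \<partial>disc_area) = (\<integral>\<^sup>+ z. u z * ennreal ((cmod (F z))\<^sup>2) \<partial>disc_area)"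
      by (rule nn_integral_cong) (auto simp: u_def indicator_def ennreal_mult v0)
    also have "\<dots> = (\<integral>\<^sup>+ z. ennreal ((cmod (F z))\<^sup>2) \<partial>M)"
      by (rule le[symmetric]) (intro measurable_compose[OF _ measurable_ennreal] borel_measurable_power measurable_compose[OF Fm borel_measurable_norm])
    also have "\<dots> \<le> ennreal (K * ((cmod (F 0))\<^sup>2 + (1 + s) / s * J))"
      by (rule carleson_embedding[OF fin sets supp r s K(1) kern F dirichlet_sum_le[OF F s J]])
    finally show "(\<integral>\<^sup>+ z. ennreal (v z * (cmod (F z))\<^sup>2) * indicator (ball 0 r) z \<partial>disc_area)
        \<le> ennreal (K * ((cmod (F 0))\<^sup>2 + (1 + s) / s * J))" .
  qed
  thus ?thesis by (simp add: v_def)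
qed

subsection \<open>Logarithmic Carleson measures\<close>

definition log_weight :: "complex \<Rightarrow> real" where
  "log_weight a = ln (2 / (1 - cmod a))"

lemma log_weight_ge:
  assumes "cmod a < 1"
  shows "ln 2 \<le> log_weight a" "log_weight a > 0"
proof -
  show "ln 2 \<le> log_weight a" unfolding log_weight_def using assms by (subst ln_le_cancel_iff) (auto simp: field_simps)
  thus "log_weight a > 0" using ln_gt_zero[of 2] by linarith
qed

definition in_Qlog :: "real \<Rightarrow> (complex \<Rightarrow> complex) \<Rightarrow> bool" where
  "in_Qlog s h \<longleftrightarrow> (\<exists>C\<ge>0. \<forall>a. cmod a < 1 \<longrightarrow> qint s h a \<le> ennreal (C / (log_weight a)\<^sup>2))"

lemma ennreal_mult_le_iff:
  assumes "r > 0" "C \<ge> 0"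
  shows "ennreal r * x \<le> ennreal C \<longleftrightarrow> x \<le> ennreal (C / r)"
proof
  assume "ennreal r * x \<le> ennreal C"
  hence "ennreal (1 / r) * (ennreal r * x) \<le> ennreal (1 / r) * ennreal C" by (rule mult_left_mono) simp
  thus "x \<le> ennreal (C / r)" using assms by (simp add: mult.assoc[symmetric] ennreal_mult'[symmetric])
next
  assume "x \<le> ennreal (C / r)"
  hence "ennreal r * x \<le> ennreal r * ennreal (C / r)" by (rule mult_left_mono) simp
  thus "ennreal r * x \<le> ennreal C" using assms by (simp add: ennreal_mult'[symmetric])
qed

lemma Q_log_space_iff:
  "g \<in> Q_log_space s 1 \<longleftrightarrow> g holomorphic_on ball 0 1 \<and> in_Qlog s (deriv g)"
proof -
  have e: "ennreal (ln (2 / (1 - cmod a)) powr (2 * 1)) * qint s (deriv g) a \<le> ennreal C \<longleftrightarrow>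
      qint s (deriv g) a \<le> ennreal (C / (log_weight a)\<^sup>2)" if "cmod a < 1" "C \<ge> 0" for a C
    using ennreal_mult_le_iff[of "(log_weight a)\<^sup>2" C "qint s (deriv g) a"] log_weight_ge(2)[OF that(1)] that(2)
    by (simp add: log_weight_def powr_numeral)
  show ?thesis
    unfolding Q_log_space_def qint_def[symmetric] SUP_less_top_iff in_Qlog_def using e by auto
qed

text \<open>For fixed w the disc is covered according to the size of x = |1 - cnj w z|. Where x is
  about 2^-k, the kernel times (1 - |z|^2)^s is at most 8^s times the Moebius weight at a_k = (1 -
  2^-k) w. Since 1 - |a_k| is at most 2 * 2^-k for every k that occurs with k > 0, the k-th piece is
  of order 1/(k + 1)^2 by the logarithmic condition at a_k.\<close>

lemma in_Qlog_schur:
  assumes s: "s > 0" and h: "h holomorphic_on ball 0 1" and q: "in_Qlog s h"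
  obtains K where "K \<ge> 0" "\<And>w. cmod w < 1 \<Longrightarrow>
      (\<integral>\<^sup>+ z. ennreal ((cmod (h z))\<^sup>2 * (1 - (cmod z)\<^sup>2) powr s * cmod (1 - cnj w * z) powr - s) \<partial>disc_area) \<le> ennreal K"
proof -
  obtain C where C: "C \<ge> 0" "\<And>a. cmod a < 1 \<Longrightarrow> qint s h a \<le> ennreal (C / (log_weight a)\<^sup>2)"
    using q unfolding in_Qlog_def by blast
  define c where "c k = 8 powr s * (4 * C / (ln 2)\<^sup>2) * (1 / (real k + 1)\<^sup>2)" for k :: nat
  have c0: "c k \<ge> 0" for k using C by (simp add: c_def)
  have sc: "summable c"
  proof -
    have "summable (\<lambda>k. 1 / (real (Suc k))\<^sup>2)" using inverse_squares_sums by (simp add: sums_iff add.commute)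
    thus ?thesis unfolding c_def by (intro summable_mult) (simp add: add.commute)
  qed
  have main: "(\<integral>\<^sup>+ z. ennreal ((cmod (h z))\<^sup>2 * (1 - (cmod z)\<^sup>2) powr s * cmod (1 - cnj w * z) powr - s) \<partial>disc_area)
      \<le> ennreal (\<Sum>k. c k)" if w: "cmod w < 1" for w
  proof -
    define t :: "nat \<Rightarrow> real" where "t k = 1 - 1 / 2 ^ k" for k
    define a :: "nat \<Rightarrow> complex" where "a k = of_real (t k) * w" for k
    have t: "0 \<le> t k" "t k < 1" "1 - t k = 1 / 2 ^ k" for k
      by (auto simp: t_def field_simps)
    have na: "cmod (a k) = t k * cmod w" for k using t(1)[of k] by (simp add: a_def norm_mult)
    have a1: "cmod (a k) < 1" for k
    proof -
      have "t k * cmod w \<le> 1 * cmod w" using t(2)[of k] by (intro mult_right_mono) auto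
      thus ?thesis using w na by simp
    qed
    have a2: "1 - cmod (a k) \<ge> 1 / 2 ^ k" for k
    proof -
      have "t k * cmod w \<le> t k * 1" using w t(1)[of k] by (intro mult_left_mono) auto
      thus ?thesis unfolding na using t(3)[of k] by simp
    qed
    \<comment> \<open>Since x \<ge> 1 - |w|, only these scales occur. Beyond them a_k approaches w,
      the logarithm at a_k stops growing, and the pieces would not be summable.\<close>
    define ok where "ok k \<longleftrightarrow> k = 0 \<or> 1 - cmod w < 1 / 2 ^ k" for k :: nat
    define g where "g k z = (if ok k then ennreal (8 powr s) * ennreal ((cmod (h z))\<^sup>2 * disc_weight (a k) z powr s) else 0)" for k z
    have hm: "(\<lambda>z. ennreal ((cmod (h z))\<^sup>2 * disc_weight (a k) z powr s)) \<in> borel_measurable disc_area" for k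
      by (intro measurable_compose[OF _ measurable_ennreal] measurable_disc_areaI continuous_intros continuous_on_weight a1
          holomorphic_on_imp_continuous_on h)
    show ?thesis
    proof (rule nn_integral_le_suminf[of g])
      show "g k \<in> borel_measurable disc_area" for k
        unfolding g_def[abs_def] using hm by (cases "ok k") (auto intro!: borel_measurable_times_ennreal)
      show "(\<integral>\<^sup>+ z. g k z \<partial>disc_area) \<le> ennreal (c k)" for k
      proof (cases "ok k")
        case True
        \<comment> \<open>The factor (k + 1)/2 covers both cases: for k = 0 the universal lower
          bound ln 2 is enough, and for k \<ge> 1 it is at most the k obtained from 1 - |a_k| \<le>
          2 / 2^k.\<close>
        have "log_weight (a k) \<ge> (real k + 1) / 2 * ln 2"
        proof (cases "k = 0")
          case True
          thus ?thesis using log_weight_ge[OF a1[of k]] by simp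
        next
          case False
          hence w1: "1 - cmod w < 1 / 2 ^ k" using \<open>ok k\<close> by (simp add: ok_def)
          have "1 - cmod (a k) = (1 - t k) + t k * (1 - cmod w)" unfolding na by (simp add: algebra_simps)
          also have "\<dots> \<le> 1 / 2 ^ k + 1 * (1 / 2 ^ k)"
            using w1 w t[of k] by (intro add_mono mult_mono) auto
          finally have "1 - cmod (a k) \<le> 2 / 2 ^ k" by simp
          hence "2 ^ k \<le> 2 / (1 - cmod (a k))" using a1[of k] by (simp add: field_simps)
          hence "ln (2 ^ k) \<le> log_weight (a k)" unfolding log_weight_def using a1[of k]
            by (subst ln_le_cancel_iff) (auto simp: field_simps)
          hence "real k * ln 2 \<le> log_weight (a k)" by (simp add: ln_realpow)
          moreover have "(real k + 1) / 2 * ln 2 \<le> real k * ln 2" using False by (intro mult_right_mono) auto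
          ultimately show ?thesis by linarith
        qed
        hence L: "((real k + 1) / 2 * ln 2)\<^sup>2 \<le> (log_weight (a k))\<^sup>2" by (intro power_mono) auto
        have "(\<integral>\<^sup>+ z. g k z \<partial>disc_area) = ennreal (8 powr s) * qint s h (a k)"
          using True unfolding g_def qint_def by (simp add: nn_integral_cmult hm)
        also have "\<dots> \<le> ennreal (8 powr s) * ennreal (C / (log_weight (a k))\<^sup>2)"
          by (intro mult_left_mono C(2) a1) auto
        also have "\<dots> \<le> ennreal (8 powr s) * ennreal (C / ((real k + 1) / 2 * ln 2)\<^sup>2)"
          using L C(1) log_weight_ge(2)[OF a1[of k]] by (intro mult_left_mono ennreal_leI divide_left_mono) auto
        also have "\<dots> = ennreal (c k)"
          by (simp add: c_def ennreal_mult'[symmetric] power_mult_distrib power_divide mult_ac)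
        finally show ?thesis .
      qed (simp add: g_def)
      show "ennreal ((cmod (h z))\<^sup>2 * (1 - (cmod z)\<^sup>2) powr s * cmod (1 - cnj w * z) powr - s) \<le> (\<Sum>k. g k z)"
        if "z \<in> space disc_area" for z
      proof -
        have z: "cmod z < 1" using that by simp
        define x where "x = cmod (1 - cnj w * z)"
        define v where "v = (1 - (cmod z)\<^sup>2) powr s"
        have x0: "x > 0" and xw: "1 - cmod w \<le> x" using norm_one_minus_cnj_mult[OF w z] by (auto simp: x_def)
        have "\<exists>k. ok k \<and> v * x powr - s \<le> 8 powr s * disc_weight (a k) z powr s"
        proof (cases "x \<ge> 1")
          \<comment> \<open>Here k = 0 serves: a_0 = 0, so the Moebius weight is (1 - |z|^2)^s
            itself.\<close>
          case True
          have "x powr - s \<le> 1 powr - s" using True s by (intro powr_mono2') auto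
          moreover have "(8::real) powr s \<ge> 1" using s by (simp add: ge_one_powr_ge_zero)
          ultimately have "x powr - s \<le> 8 powr s" by simp
          hence "v * x powr - s \<le> v * 8 powr s" by (rule mult_left_mono) (simp add: v_def)
          thus ?thesis by (intro exI[of _ 0]) (simp add: ok_def a_def t_def v_def mult.commute)
        next
          case False
          then obtain k where k: "1 / 2 ^ Suc k \<le> x" "x < 1 / 2 ^ k" using dyadic_below[of x 1] x0 by auto
          have "ok k" using xw k by (simp add: ok_def)
          have y0: "cmod (1 - cnj (a k) * z) > 0" by (rule norm_one_minus_cnj_mult(3)[OF a1 z])
          have e: "1 - cnj (a k) * z = (1 - cnj w * z) + of_real (1 - t k) * (cnj w * z)"
            by (simp add: a_def algebra_simps)
          have "cmod (cnj w * z) \<le> 1" using w z by (simp add: norm_mult mult_le_one)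
          have "cmod (1 - cnj (a k) * z) \<le> x + (1 - t k) * cmod (cnj w * z)"
            unfolding e x_def using norm_triangle_ineq[of "1 - cnj w * z" "of_real (1 - t k) * (cnj w * z)"] t(2)[of k]
            by (simp only: norm_mult norm_of_real)
          also have "\<dots> \<le> 1 / 2 ^ k + 1 / 2 ^ k * 1"
            using k \<open>cmod (cnj w * z) \<le> 1\<close> unfolding t(3) by (intro add_mono mult_left_mono) auto
          finally have y: "cmod (1 - cnj (a k) * z) \<le> 2 * (1 / 2 ^ k)" by simp
          define p where "p = (1 / 2 ^ k :: real)"
          have p0: "p > 0" by (simp add: p_def)
          have 1: "p powr s * v * (2 * p) powr (- 2 * s) \<le> disc_weight (a k) z powr s"
            unfolding weight_eq[OF a1 z] v_def
            using s p0 a2[of k] one_minus_norm_square(2)[OF a1[of k]] y y0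
            by (intro mult_mono powr_mono2 powr_mono2' order_refl) (auto simp: p_def)
          have "x powr - s \<le> (p / 2) powr - s" using k s p0 by (intro powr_mono2') (auto simp: p_def)
          also have "\<dots> = 8 powr s * (p powr s * (2 * p) powr (- 2 * s))"
          proof -
            have "(2 * p) powr (- 2 * s) = ((2 * p) powr 2) powr - s" by (simp add: powr_powr)
            also have "(2 * p) powr 2 = 4 * p * p" using p0 by (simp add: power2_eq_square)
            also have "(4 * p * p) powr - s = 4 powr - s * p powr - s * p powr - s" using p0 by (simp add: powr_mult)
            finally have A1: "(2 * p) powr (- 2 * s) = 4 powr - s * p powr - s * p powr - s" .
            have A2: "p powr s * p powr - s = 1" using p0 by (simp add: powr_add[symmetric])
            have "(8::real) powr s = (4 * 2) powr s" by simp
            also have "\<dots> = 4 powr s * 2 powr s" by (rule powr_mult)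
            finally have A3: "8 powr s * 4 powr - s = (2::real) powr s" by (simp add: powr_minus)
            have "8 powr s * (p powr s * (2 * p) powr (- 2 * s)) = (8 powr s * 4 powr - s) * ((p powr s * p powr - s) * p powr - s)"
              unfolding A1 by (simp only: mult_ac)
            hence "8 powr s * (p powr s * (2 * p) powr (- 2 * s)) = 2 powr s * p powr - s"
              unfolding A2 A3 by simp
            moreover have "(p / 2) powr - s = 2 powr s * p powr - s" using p0 by (simp add: powr_divide powr_minus_divide)
            ultimately show ?thesis by simp
          qed
          finally have "v * x powr - s \<le> v * (8 powr s * (p powr s * (2 * p) powr (- 2 * s)))"
            by (rule mult_left_mono) (simp add: v_def)
          also have "\<dots> = 8 powr s * (p powr s * v * (2 * p) powr (- 2 * s))" by (simp only: mult_ac)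
          also have "\<dots> \<le> 8 powr s * disc_weight (a k) z powr s" by (intro mult_left_mono 1) auto
          finally show ?thesis using \<open>ok k\<close> by blast
        qed
        then obtain k where k: "ok k" "v * x powr - s \<le> 8 powr s * disc_weight (a k) z powr s" by blast
        have "(cmod (h z))\<^sup>2 * (v * x powr - s) \<le> (cmod (h z))\<^sup>2 * (8 powr s * disc_weight (a k) z powr s)"
          by (intro mult_left_mono k) auto
        hence "ennreal ((cmod (h z))\<^sup>2 * v * x powr - s) \<le> g k z"
          using k(1) by (simp add: g_def ennreal_mult'[symmetric] ennreal_leI mult_ac)
        also have "\<dots> \<le> (\<Sum>k. g k z)" by (rule ennreal_le_suminf)
        finally show ?thesis by (simp add: v_def x_def)
      qed
    qed (use c0 sc in auto)
  qed
  show ?thesis by (rule that[OF _ main]) (use c0 sc in \<open>auto intro: suminf_nonneg\<close>)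
qed

subsection \<open>Sufficiency for the integral operators\<close>

lemma bloch_log_weight:
  assumes f: "f holomorphic_on ball 0 1" and B: "\<And>z. cmod z < 1 \<Longrightarrow> cmod (deriv f z) * (1 - cmod z) \<le> B"
    and a: "cmod a < 1"
  shows "cmod (f a) \<le> (cmod (f 0) / ln 2 + B) * log_weight a"
proof -
  have B0: "B \<ge> 0" using order_trans[OF _ B[of 0]] by simp
  have "cmod (f a) \<le> cmod (f 0) + cmod (f a - f 0)" using norm_triangle_ineq[of "f 0" "f a - f 0"] by simp
  also have "\<dots> \<le> cmod (f 0) / ln 2 * ln 2 + B * ln (1 / (1 - cmod a))"
    using bloch_growth[OF f B a] by simp
  also have "\<dots> \<le> cmod (f 0) / ln 2 * log_weight a + B * log_weight a"
    using log_weight_ge(1)[OF a] B0 a unfolding log_weight_def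
    by (intro add_mono mult_left_mono) (auto simp: field_simps)
  finally show ?thesis by (simp add: algebra_simps)
qed

text \<open>F' splits by the product rule. In the term with f' the power of 1 - cnj a z completes (1
  - |z|^2)^s to the Moebius weight at a, up to the factor (1 - |a|^2)^-s. In the other term |f -
  f(a)|^2 uses up half of that weight by the growth hypothesis D, and the remaining power s/2 is
  paired with the squared kernel, whose integral is at most k.\<close>

lemma in_Q_test_quotient:
  assumes f: "f holomorphic_on ball 0 1" and s: "0 < s" "s \<le> 1"
    and C: "C \<ge> 0" and a: "cmod a < 1" and qC: "qint s (deriv f) a \<le> ennreal C"
    and D: "D \<ge> 0" "\<And>z. cmod z < 1 \<Longrightarrow> (cmod (f z - f a))\<^sup>2 \<le> D * disc_weight a z powr - (s / 2)"
    and k: "k \<ge> 0" "qint (s / 2) (\<lambda>z. 1 / (1 - cnj a * z)) a \<le> ennreal k"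
  defines "F \<equiv> \<lambda>z. (f z - f a) * (1 - cnj a * z) powr of_real (- s)"
  shows "F holomorphic_on ball 0 1"
    and "qint s (deriv F) 0 \<le> ennreal ((1 - (cmod a)\<^sup>2) powr - s * (2 * C + 2 * (D * k)))"
proof -
  have nn: "1 - cnj a * z \<notin> \<real>\<^sub>\<le>\<^sub>0" if "cmod z < 1" for z
    using Re_one_minus_cnj_mult_pos[OF a that] by (auto simp: complex_nonpos_Reals_iff)
  show Fh: "F holomorphic_on ball 0 1"
    unfolding F_def using nn f by (intro holomorphic_intros) auto
  define F1 where "F1 z = deriv f z * (1 - cnj a * z) powr of_real (- s)" for z
  define F2 where "F2 z = (f z - f a) * (of_real s * cnj a * (1 - cnj a * z) powr of_real (- s - 1))" for z
  have dF: "deriv F z = F1 z + F2 z" if z: "cmod z < 1" for z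
  proof (rule DERIV_imp_deriv)
    have fd: "(f has_field_derivative deriv f z) (at z)" using holomorphic_derivI[OF f, of z] z by simp
    have g: "((\<lambda>z. 1 - cnj a * z) has_field_derivative - cnj a) (at z)" by (auto intro!: derivative_eq_intros)
    have "((\<lambda>w. (1 - cnj a * w) powr of_real (- s)) has_field_derivative
        of_real (- s) * (1 - cnj a * z) powr (of_real (- s) - 1) * - cnj a) (at z)"
      using DERIV_chain2[OF has_field_derivative_powr[OF nn[OF z], of "of_real (- s)"] g]
      by simp
    from DERIV_mult[OF DERIV_diff[OF fd DERIV_const[of "f a"]] this]
    show "(F has_field_derivative F1 z + F2 z) (at z)"
      unfolding F_def F1_def F2_def by (simp add: algebra_simps)
  qed
  let ?u = "(1 - (cmod a)\<^sup>2) powr - s"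
  have u1: "(1 - (cmod a)\<^sup>2) powr s * ?u = 1" using one_minus_norm_square(1)[OF a] by (simp flip: powr_add)
  have pn: "cmod ((1 - cnj a * z) powr of_real x) = cmod (1 - cnj a * z) powr x" if "cmod z < 1" for z x
    by (rule norm_powr_of_real[OF norm_one_minus_cnj_mult(4)[OF a that]])
  have w0: "(1 - (cmod z)\<^sup>2) powr s * cmod (1 - cnj a * z) powr (- 2 * s) = ?u * disc_weight a z powr s" if "cmod z < 1" for z
  proof -
    let ?v = "(1 - (cmod z)\<^sup>2) powr s" and ?y = "cmod (1 - cnj a * z) powr (- 2 * s)"
    have "?u * ((1 - (cmod a)\<^sup>2) powr s * ?v * ?y) = ((1 - (cmod a)\<^sup>2) powr s * ?u) * (?v * ?y)" by (simp only: mult_ac)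
    thus ?thesis unfolding weight_eq[OF a that] u1 by simp
  qed
  have sq: "(cmod (1 - cnj a * z) powr x)\<^sup>2 = cmod (1 - cnj a * z) powr (2 * x)" for z x
    by (simp add: power2_eq_square flip: powr_add)
  have dfm: "deriv f \<in> borel_measurable disc_area"
    by (intro measurable_disc_areaI holomorphic_on_imp_continuous_on holomorphic_deriv[OF f open_ball])
  have km: "(\<lambda>z. 1 / (1 - cnj a * z)) \<in> borel_measurable disc_area"
    using norm_one_minus_cnj_mult(4)[OF a] by (intro measurable_disc_areaI continuous_intros) auto
  have F1: "qint s F1 0 \<le> ennreal (?u * C)"
  proof -
    have "qint s F1 0 = (\<integral>\<^sup>+ z. ennreal ?u * ennreal ((cmod (deriv f z))\<^sup>2 * disc_weight a z powr s) \<partial>disc_area)"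
      unfolding qint_def
    proof (rule nn_integral_cong)
      fix z assume "z \<in> space disc_area"
      hence z: "cmod z < 1" by simp
      have "(cmod (F1 z))\<^sup>2 * disc_weight 0 z powr s =
          (cmod (deriv f z))\<^sup>2 * ((1 - (cmod z)\<^sup>2) powr s * cmod (1 - cnj a * z) powr (- 2 * s))"
        unfolding F1_def norm_mult pn[OF z] power_mult_distrib sq by simp
      thus "ennreal ((cmod (F1 z))\<^sup>2 * disc_weight 0 z powr s) =
         ennreal ?u * ennreal ((cmod (deriv f z))\<^sup>2 * disc_weight a z powr s)"
        unfolding w0[OF z] by (simp add: ennreal_mult'[symmetric] mult_ac)
    qed
    also have "\<dots> = ennreal ?u * qint s (deriv f) a" unfolding qint_def
      by (rule nn_integral_cmult)
         (intro measurable_compose[OF _ measurable_ennreal] borel_measurable_times borel_measurable_power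
           measurable_compose[OF dfm borel_measurable_norm] measurable_weight[OF a])
    also have "\<dots> \<le> ennreal ?u * ennreal C" by (intro mult_left_mono qC) auto
    finally show ?thesis using C by (simp add: ennreal_mult)
  qed
  have F2: "qint s F2 0 \<le> ennreal (?u * (D * k))"
  proof -
    have "qint s F2 0 \<le> (\<integral>\<^sup>+ z. ennreal (?u * D) * ennreal ((cmod (1 / (1 - cnj a * z)))\<^sup>2 * disc_weight a z powr (s / 2)) \<partial>disc_area)"
      unfolding qint_def
    proof (rule nn_integral_mono)
      fix z assume "z \<in> space disc_area"
      hence z: "cmod z < 1" by simp
      let ?y = "cmod (1 - cnj a * z)" and ?w = "1 - (cmod (disc_phi a z))\<^sup>2"
      have y: "?y > 0" by (rule norm_one_minus_cnj_mult(3)[OF a z])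
      have "s * cmod a \<le> 1 * 1" using s a by (intro mult_mono) auto
      hence sa: "(s * cmod a)\<^sup>2 \<le> 1" using s by (intro power_le_one) auto
      have "(cmod (F2 z))\<^sup>2 * disc_weight 0 z powr s =
          (s * cmod a)\<^sup>2 * ((cmod (f z - f a))\<^sup>2 * (?y powr (2 * (- s - 1)) * (1 - (cmod z)\<^sup>2) powr s))"
        unfolding F2_def norm_mult pn[OF z] power_mult_distrib sq using s by simp
      also have "\<dots> \<le> 1 * ((cmod (f z - f a))\<^sup>2 * (?y powr (2 * (- s - 1)) * (1 - (cmod z)\<^sup>2) powr s))"
        using sa by (intro mult_right_mono) auto
      also have "\<dots> = (cmod (f z - f a))\<^sup>2 * (?y powr - 2 * ((1 - (cmod z)\<^sup>2) powr s * ?y powr (- 2 * s)))"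
      proof -
        have "?y powr (2 * (- s - 1)) = ?y powr - 2 * ?y powr (- 2 * s)"
          by (simp only: powr_add[symmetric]) (rule arg_cong[where f = "\<lambda>t. ?y powr t"], simp)
        thus ?thesis by simp
      qed
      also have "\<dots> = (cmod (f z - f a))\<^sup>2 * (?y powr - 2 * (?u * ?w powr s))" unfolding w0[OF z] ..
      also have "\<dots> \<le> (D * ?w powr - (s / 2)) * (?y powr - 2 * (?u * ?w powr s))"
        by (intro mult_right_mono D(2)[OF z]) auto
      also have "\<dots> = (?u * D) * (?y powr - 2 * (?w powr - (s / 2) * ?w powr s))" by simp
      also have "?w powr - (s / 2) * ?w powr s = ?w powr (s / 2)" by (simp flip: powr_add)
      also have "?y powr - 2 = (cmod (1 / (1 - cnj a * z)))\<^sup>2" using y by (simp add: norm_divide power_divide powr_minus_divide)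
      finally show "ennreal ((cmod (F2 z))\<^sup>2 * disc_weight 0 z powr s) \<le>
        ennreal (?u * D) * ennreal ((cmod (1 / (1 - cnj a * z)))\<^sup>2 * ?w powr (s / 2))"
        using D(1) by (simp add: ennreal_mult'[symmetric] ennreal_leI)
    qed
    also have "\<dots> = ennreal (?u * D) * qint (s / 2) (\<lambda>z. 1 / (1 - cnj a * z)) a" unfolding qint_def
      by (rule nn_integral_cmult)
         (intro measurable_compose[OF _ measurable_ennreal] borel_measurable_times borel_measurable_power
           measurable_compose[OF km borel_measurable_norm] measurable_weight[OF a])
    also have "\<dots> \<le> ennreal (?u * D) * ennreal k" by (intro mult_left_mono k) auto
    finally show ?thesis using D(1) k(1) by (simp add: ennreal_mult'[symmetric] mult.assoc)
  qed
  have m1: "F1 \<in> borel_measurable disc_area" "F2 \<in> borel_measurable disc_area"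
    unfolding F1_def F2_def
    by (intro measurable_disc_areaI holomorphic_on_imp_continuous_on holomorphic_intros holomorphic_deriv[OF f open_ball] f; use nn in auto)+
  have "qint s (deriv F) 0 \<le> 2 * qint s F1 0 + 2 * qint s F2 0"
    by (rule qint_add) (use dF norm_triangle_ineq m1 in auto)
  also have "\<dots> \<le> 2 * ennreal (?u * C) + 2 * ennreal (?u * (D * k))"
    by (intro add_mono mult_left_mono F1 F2) auto
  also have "\<dots> = ennreal (2 * (?u * C) + 2 * (?u * (D * k)))"
    using C D(1) k(1) by (subst ennreal_plus) (auto simp: ennreal_mult')
  also have "2 * (?u * C) + 2 * (?u * (D * k)) = ?u * (2 * C + 2 * (D * k))" by (simp add: algebra_simps)
  finally show "qint s (deriv F) 0 \<le> ennreal (?u * (2 * C + 2 * (D * k)))" .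
qed

lemma in_Qlog_mult:
  assumes s: "0 < s" "s \<le> 1" and f: "f holomorphic_on ball 0 1" and fQ: "in_Q s (deriv f)"
    and h: "h holomorphic_on ball 0 1" and hQ: "in_Qlog s h"
  shows "in_Q s (\<lambda>z. h z * f z)"
proof -
  have df: "deriv f holomorphic_on ball 0 1" by (rule holomorphic_deriv[OF f open_ball])
  obtain B where B: "B \<ge> 0" "\<And>z. cmod z < 1 \<Longrightarrow> cmod (deriv f z) * (1 - cmod z) \<le> B"
    using in_Q_bloch[OF df s(1) fQ] by blast
  obtain Cf where Cf: "Cf \<ge> 0" "\<And>a. cmod a < 1 \<Longrightarrow> qint s (deriv f) a \<le> ennreal Cf"
    using in_QE[OF fQ] by blast
  obtain Ch where Ch: "Ch \<ge> 0" "\<And>a. cmod a < 1 \<Longrightarrow> qint s h a \<le> ennreal (Ch / (log_weight a)\<^sup>2)"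
    using hQ unfolding in_Qlog_def by blast
  obtain K where K: "K \<ge> 0" "\<And>w. cmod w < 1 \<Longrightarrow>
      (\<integral>\<^sup>+ z. ennreal ((cmod (h z))\<^sup>2 * (1 - (cmod z)\<^sup>2) powr s * cmod (1 - cnj w * z) powr - s) \<partial>disc_area) \<le> ennreal K"
    using in_Qlog_schur[OF s(1) h hQ] by blast
  have s2: "0 < s / 2" "s / 2 \<le> 2" using s by auto
  obtain k where k: "k \<ge> 0" "\<And>a b. cmod a < 1 \<Longrightarrow> cmod b < 1 \<Longrightarrow> qint (s / 2) (\<lambda>z. 1 / (1 - cnj a * z)) b \<le> ennreal k"
    using qint_kernel_le[OF s2] by blast
  define D where "D = (8 * B / s)\<^sup>2 * 2 powr (s / 2)"
  have D0: "D \<ge> 0" by (simp add: D_def)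
  have D: "(cmod (f z - f a))\<^sup>2 \<le> D * disc_weight a z powr - (s / 2)" if "cmod a < 1" "cmod z < 1" for a z
    unfolding D_def by (rule bloch_growth_power[OF f B(2) that s(1)])
  define A where "A = cmod (f 0) / ln 2 + B"
  have A0: "A \<ge> 0" using B by (simp add: A_def)
  define J where "J = 2 * Cf + 2 * (D * k)"
  have J0: "J \<ge> 0" using Cf D0 k by (simp add: J_def)
  define E where "E = K * (D + (1 + s) / s * J)"
  have E0: "E \<ge> 0" using K D0 J0 s by (simp add: E_def)
  have hm: "h \<in> borel_measurable disc_area" by (intro measurable_disc_areaI holomorphic_on_imp_continuous_on h)
  have fm: "f \<in> borel_measurable disc_area" by (intro measurable_disc_areaI holomorphic_on_imp_continuous_on f)
  have "qint s (\<lambda>z. h z * f z) a \<le> ennreal (2 * (A\<^sup>2 * Ch) + 2 * E)" if a: "cmod a < 1" for a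
  proof -
    let ?L = "log_weight a"
    have L: "?L > 0" by (rule log_weight_ge(2)[OF a])
    \<comment> \<open>The constant part: |f(a)| is at most A times the logarithm at a, and its
      square is cancelled by the decay in the logarithmic condition on h.\<close>
    have "qint s (\<lambda>z. h z * f a) a \<le> ennreal ((A * ?L)\<^sup>2) * qint s h a"
    proof (rule qint_mono)
      show "cmod (h z * f a) \<le> A * ?L * cmod (h z)" for z
        using mult_right_mono[OF bloch_log_weight[OF f B(2) a], of "cmod (h z)"] by (simp add: A_def norm_mult mult.commute)
    qed (use A0 L a hm in auto)
    also have "\<dots> \<le> ennreal ((A * ?L)\<^sup>2) * ennreal (Ch / ?L\<^sup>2)" by (intro mult_left_mono Ch(2) a) auto
    also have "\<dots> = ennreal (A\<^sup>2 * Ch)" using L Ch(1) by (simp add: ennreal_mult'[symmetric] power_mult_distrib)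
    finally have 1: "qint s (\<lambda>z. h z * f a) a \<le> ennreal (A\<^sup>2 * Ch)" .
    define F where "F = (\<lambda>z. (f z - f a) * (1 - cnj a * z) powr of_real (- s))"
    let ?u = "(1 - (cmod a)\<^sup>2) powr - s"
    have u1: "(1 - (cmod a)\<^sup>2) powr s * ?u = 1" using one_minus_norm_square(1)[OF a] by (simp flip: powr_add)
    note Fq = in_Q_test_quotient[OF f s Cf(1) a Cf(2)[OF a] D0 D[OF a] k(1) k(2)[OF a a], folded F_def J_def]
    have F0: "(cmod (F 0))\<^sup>2 \<le> ?u * D"
    proof -
      have "(cmod (F 0))\<^sup>2 \<le> D * (1 - (cmod a)\<^sup>2) powr - (s / 2)" using D[OF a, of 0] by (simp add: F_def disc_phi_def)
      also have "\<dots> \<le> D * ?u" using s D0 one_minus_norm_square[OF a] by (intro mult_left_mono powr_mono') auto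
      finally show ?thesis by (simp add: mult.commute)
    qed
    have "qint s (\<lambda>z. h z * (f z - f a)) a = (\<integral>\<^sup>+ z. ennreal ((1 - (cmod a)\<^sup>2) powr s) * ennreal ((cmod (h z))\<^sup>2 * (1 - (cmod z)\<^sup>2) powr s * (cmod (F z))\<^sup>2) \<partial>disc_area)"
      unfolding qint_def
    proof (rule nn_integral_cong)
      fix z assume "z \<in> space disc_area"
      hence z: "cmod z < 1" by simp
      have "(cmod (F z))\<^sup>2 = (cmod (f z - f a))\<^sup>2 * cmod (1 - cnj a * z) powr (- 2 * s)"
        unfolding F_def norm_mult norm_powr_of_real[OF norm_one_minus_cnj_mult(4)[OF a z]] power_mult_distrib
        by (simp add: power2_eq_square flip: powr_add)
      thus "ennreal ((cmod (h z * (f z - f a)))\<^sup>2 * disc_weight a z powr s) =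
         ennreal ((1 - (cmod a)\<^sup>2) powr s) * ennreal ((cmod (h z))\<^sup>2 * (1 - (cmod z)\<^sup>2) powr s * (cmod (F z))\<^sup>2)"
        unfolding weight_eq[OF a z] by (simp add: ennreal_mult'[symmetric] norm_mult power_mult_distrib mult_ac)
    qed
    also have "\<dots> = ennreal ((1 - (cmod a)\<^sup>2) powr s) * (\<integral>\<^sup>+ z. ennreal ((cmod (h z))\<^sup>2 * (1 - (cmod z)\<^sup>2) powr s * (cmod (F z))\<^sup>2) \<partial>disc_area)"
    proof (rule nn_integral_cmult)
      show "(\<lambda>z. ennreal ((cmod (h z))\<^sup>2 * (1 - (cmod z)\<^sup>2) powr s * (cmod (F z))\<^sup>2)) \<in> borel_measurable disc_area"
        by (intro measurable_compose[OF _ measurable_ennreal] measurable_disc_areaI continuous_on_mult continuous_on_power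
            continuous_on_norm continuous_on_radial_weight holomorphic_on_imp_continuous_on Fq(1) h)
    qed
    also have "\<dots> \<le> ennreal ((1 - (cmod a)\<^sup>2) powr s) * ennreal (K * ((cmod (F 0))\<^sup>2 + (1 + s) / s * (?u * J)))"
      by (intro mult_left_mono carleson_embedding_disc[OF h s(1) K Fq]) (use J0 in auto)
    also have "\<dots> \<le> ennreal ((1 - (cmod a)\<^sup>2) powr s) * ennreal (K * (?u * D + (1 + s) / s * (?u * J)))"
      using F0 K(1) by (intro mult_left_mono ennreal_leI add_right_mono) auto
    \<comment> \<open>Both parts of the Dirichlet-type norm of F carry the factor (1 - |a|^2)^-s,
      which cancels against the prefactor, so the bound E is independent of a.\<close>
    also have "\<dots> = ennreal (((1 - (cmod a)\<^sup>2) powr s * ?u) * E)"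
      unfolding E_def by (simp add: ennreal_mult'[symmetric] algebra_simps)
    also have "\<dots> = ennreal E" unfolding u1 by simp
    finally have 2: "qint s (\<lambda>z. h z * (f z - f a)) a \<le> ennreal E" .
    have "qint s (\<lambda>z. h z * f z) a \<le> 2 * qint s (\<lambda>z. h z * f a) a + 2 * qint s (\<lambda>z. h z * (f z - f a)) a"
    proof (rule qint_add)
      show "cmod (h z * f z) \<le> cmod (h z * f a) + cmod (h z * (f z - f a))" for z
        using norm_triangle_ineq[of "h z * f a" "h z * (f z - f a)"] by (simp add: algebra_simps)
    qed (use a hm fm in auto)
    also have "\<dots> \<le> 2 * ennreal (A\<^sup>2 * Ch) + 2 * ennreal E" by (intro add_mono mult_left_mono 1 2) auto
    also have "\<dots> = ennreal (2 * (A\<^sup>2 * Ch) + 2 * E)" using Ch(1) E0 by (subst ennreal_plus) (auto simp: ennreal_mult')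
    finally show ?thesis .
  qed
  thus ?thesis unfolding in_Q_def using Ch(1) E0 by (intro exI[of _ "2 * (A\<^sup>2 * Ch) + 2 * E"]) auto
qed

subsection \<open>Test functions\<close>

lemma dyadic_series_holomorphic:
  fixes F :: "nat \<Rightarrow> complex \<Rightarrow> complex"
  assumes F: "\<And>n. F n holomorphic_on ball 0 1"
    and bd: "\<And>r. r < 1 \<Longrightarrow> \<exists>B. \<forall>n z. cmod z \<le> r \<longrightarrow> cmod (F n z) \<le> B"
  obtains f where "f holomorphic_on ball 0 1"
    "\<And>z. cmod z < 1 \<Longrightarrow> (\<lambda>n. F n z / 2 ^ n) sums f z"
    "\<And>z. cmod z < 1 \<Longrightarrow> (\<lambda>n. deriv (F n) z / 2 ^ n) sums deriv f z"
proof -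
  have "\<exists>f f'. \<forall>z\<in>ball 0 1. ((\<lambda>n. F n z / 2 ^ n) sums f z) \<and> ((\<lambda>n. deriv (F n) z / 2 ^ n) sums f' z) \<and> (f has_field_derivative f' z) (at z)"
  proof (rule series_and_derivative_comparison_complex)
    show "open (ball 0 1 :: complex set)" by (rule open_ball)
    show "((\<lambda>z. F n z / 2 ^ n) has_field_derivative deriv (F n) z / 2 ^ n) (at z)" if "z \<in> ball 0 1" for n z
      by (intro DERIV_cdivide holomorphic_derivI[OF F open_ball that])
    fix x :: complex assume x: "x \<in> ball 0 1"
    define d where "d = (1 - cmod x) / 2"
    have d: "d > 0" using x by (simp add: d_def)
    have "cmod x + d < 1" using x by (simp add: d_def field_simps)
    from bd[OF this] obtain B where B: "\<And>n z. cmod z \<le> cmod x + d \<Longrightarrow> cmod (F n z) \<le> B" by blast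
    have B0: "B \<ge> 0" using order_trans[OF norm_ge_zero B[of 0]] d by simp
    have sm: "summable (\<lambda>n. complex_of_real (B * (1 / 2) ^ n))"
      by (intro summable_of_real summable_mult summable_geometric) simp
    have "cmod (F n z / 2 ^ n) \<le> cmod (of_real (B * (1 / 2) ^ n))" if "z \<in> ball x d \<inter> ball 0 1" for n z
    proof -
      have "cmod z \<le> cmod x + cmod (z - x)" using norm_triangle_ineq[of x "z - x"] by simp
      hence "cmod (F n z) \<le> B" using that by (intro B) (simp add: dist_norm norm_minus_commute)
      hence "cmod (F n z) / 2 ^ n \<le> B / 2 ^ n" by (intro divide_right_mono) auto
      thus ?thesis using B0 by (simp add: norm_divide norm_power norm_mult power_one_over)
    qed
    thus "\<exists>d h. 0 < d \<and> summable h \<and> range h \<subseteq> \<real>\<^sub>\<ge>\<^sub>0 \<and>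
        (\<forall>\<^sub>F n in sequentially. \<forall>y\<in>ball x d \<inter> ball 0 1. cmod (F n y / 2 ^ n) \<le> cmod (h n))"
      using d sm B0 by (intro exI[of _ d] exI[of _ "\<lambda>n. complex_of_real (B * (1 / 2) ^ n)"]) auto
  qed
  then obtain f f' where ff: "\<forall>z\<in>ball 0 1. ((\<lambda>n. F n z / 2 ^ n) sums f z) \<and> ((\<lambda>n. deriv (F n) z / 2 ^ n) sums f' z) \<and> (f has_field_derivative f' z) (at z)"
    by blast
  have f: "(\<lambda>n. F n z / 2 ^ n) sums f z" "(\<lambda>n. deriv (F n) z / 2 ^ n) sums f' z" "(f has_field_derivative f' z) (at z)"
    if "cmod z < 1" for z
    using ff that by auto
  show thesis
  proof
    have "\<exists>f'. (f has_field_derivative f') (at z)" if "z \<in> ball 0 1" for z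
      using f(3)[of z] that by auto
    thus "f holomorphic_on ball 0 1" unfolding holomorphic_on_open[OF open_ball] by blast
    show "(\<lambda>n. F n z / 2 ^ n) sums f z" if "cmod z < 1" for z by (rule f(1)[OF that])
    show "(\<lambda>n. deriv (F n) z / 2 ^ n) sums deriv f z" if "cmod z < 1" for z
      using f(2)[OF that] DERIV_imp_deriv[OF f(3)[OF that]] by simp
  qed
qed

text \<open>Cauchy-Schwarz for the weights 2^-n of total mass 2. The square moves onto the single
  terms while the summable weight stays, so quadratic integrals of a series can be estimated term by
  term.\<close>

lemma dyadic_sum_square_le:
  fixes x :: "nat \<Rightarrow> real"
  assumes x: "\<And>n. 0 \<le> x n" "\<And>n. x n \<le> B"
  shows "summable (\<lambda>n. x n / 2 ^ n)" "summable (\<lambda>n. (x n)\<^sup>2 / 2 ^ n)"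
    "(\<Sum>n. x n / 2 ^ n)\<^sup>2 \<le> 2 * (\<Sum>n. (x n)\<^sup>2 / 2 ^ n)"
proof -
  have g: "(\<lambda>n. 1 / 2 ^ n :: real) sums 2" using geometric_sums[of "1 / 2 :: real"] by (simp add: power_one_over)
  have sB: "summable (\<lambda>n. C / 2 ^ n)" for C :: real
    using summable_mult[OF sums_summable[OF g], of C] by simp
  show s1: "summable (\<lambda>n. x n / 2 ^ n)"
    by (rule summable_comparison_test'[OF sB[of B], of 0]) (use x in \<open>auto intro: divide_right_mono\<close>)
  show s2: "summable (\<lambda>n. (x n)\<^sup>2 / 2 ^ n)"
    by (rule summable_comparison_test'[OF sB[of "B\<^sup>2"], of 0]) (use x in \<open>auto intro!: divide_right_mono power_mono\<close>)
  show "(\<Sum>n. x n / 2 ^ n)\<^sup>2 \<le> 2 * (\<Sum>n. (x n)\<^sup>2 / 2 ^ n)"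
  proof (rule LIMSEQ_le)
    show "(\<lambda>N. (\<Sum>n<N. x n / 2 ^ n)\<^sup>2) \<longlonglongrightarrow> (\<Sum>n. x n / 2 ^ n)\<^sup>2"
      by (intro tendsto_power summable_LIMSEQ s1)
    show "(\<lambda>N. 2 * (\<Sum>n<N. (x n)\<^sup>2 / 2 ^ n)) \<longlonglongrightarrow> 2 * (\<Sum>n. (x n)\<^sup>2 / 2 ^ n)"
      by (intro tendsto_mult tendsto_const summable_LIMSEQ s2)
    have "(\<Sum>n<N. x n / 2 ^ n)\<^sup>2 \<le> 2 * (\<Sum>n<N. (x n)\<^sup>2 / 2 ^ n)" for N
    proof -
      define q where "q n = sqrt (1 / 2 ^ n)" for n :: nat
      have q2: "(q n)\<^sup>2 = 1 / 2 ^ n" for n unfolding q_def by (rule real_sqrt_pow2) simp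
      have "(\<Sum>n<N. x n / 2 ^ n) = (\<Sum>n<N. q n * (q n * x n))"
        by (intro sum.cong refl) (simp add: mult.assoc[symmetric] q2 flip: power2_eq_square)
      hence "(\<Sum>n<N. x n / 2 ^ n)\<^sup>2 \<le> (\<Sum>n<N. (q n)\<^sup>2) * (\<Sum>n<N. (q n * x n)\<^sup>2)"
        by (simp only: Cauchy_Schwarz_ineq_sum)
      also have "\<dots> = (\<Sum>n<N. 1 / 2 ^ n) * (\<Sum>n<N. (x n)\<^sup>2 / 2 ^ n)"
        by (simp add: power_mult_distrib q2)
      also have "\<dots> \<le> 2 * (\<Sum>n<N. (x n)\<^sup>2 / 2 ^ n)"
        using sum_le_suminf[OF sums_summable[OF g], of "{..<N}"] sums_unique[OF g]
        by (intro mult_right_mono sum_nonneg) auto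
      finally show ?thesis .
    qed
    thus "\<exists>N0. \<forall>N\<ge>N0. (\<Sum>n<N. x n / 2 ^ n)\<^sup>2 \<le> 2 * (\<Sum>n<N. (x n)\<^sup>2 / 2 ^ n)" by blast
  qed
qed

text \<open>The kernels satisfy a bound C that is uniform in their poles, so their superposition
  with weights 2^-n does too; one factor 2 comes from squaring the sum, the other is the total mass
  of the weights.\<close>

lemma in_Q_kernel_series:
  fixes a :: "nat \<Rightarrow> complex"
  assumes s: "0 < s" "s \<le> 2" and a: "\<And>n. cmod (a n) < 1"
    and h: "\<And>z. cmod z < 1 \<Longrightarrow> cmod (h z) \<le> (\<Sum>n. cmod (1 / (1 - cnj (a n) * z)) / 2 ^ n)"
  shows "in_Q s h"
proof -
  obtain C where C: "C \<ge> 0" "\<And>a b. cmod a < 1 \<Longrightarrow> cmod b < 1 \<Longrightarrow> qint s (\<lambda>z. 1 / (1 - cnj a * z)) b \<le> ennreal C"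
    using qint_kernel_le[OF s] by blast
  have g: "(\<lambda>n. 2 * C * (1 / 2 ^ n) :: real) sums (2 * C * 2)"
    using sums_mult[OF geometric_sums[of "1 / 2 :: real"], of "2 * C"] by (simp add: power_one_over)
  have "qint s h b \<le> ennreal (2 * C * 2)" if b: "cmod b < 1" for b
  proof -
    let ?w = "\<lambda>z. disc_weight b z powr s"
    let ?x = "\<lambda>n z. cmod (1 / (1 - cnj (a n) * z))"
    define G where "G n z = ennreal (2 / 2 ^ n) * ennreal ((?x n z)\<^sup>2 * ?w z)" for n z
    have km: "(\<lambda>z. ennreal ((?x n z)\<^sup>2 * ?w z)) \<in> borel_measurable disc_area" for n
    proof -
      have "continuous_on (ball 0 1) (\<lambda>z. 1 / (1 - cnj (a n) * z))"
        using norm_one_minus_cnj_mult(4)[OF a] by (intro continuous_intros) auto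
      thus ?thesis
        by (intro measurable_compose[OF _ measurable_ennreal] measurable_disc_areaI continuous_on_mult continuous_on_power
            continuous_on_norm continuous_on_weight b)
    qed
    have "qint s h b \<le> ennreal (\<Sum>n. 2 * C * (1 / 2 ^ n))"
      unfolding qint_def
    proof (rule nn_integral_le_suminf[of G])
      show "G n \<in> borel_measurable disc_area" for n
        unfolding G_def[abs_def] by (intro borel_measurable_times_ennreal km) auto
      show "(\<integral>\<^sup>+ z. G n z \<partial>disc_area) \<le> ennreal (2 * C * (1 / 2 ^ n))" for n
      proof -
        have "(\<integral>\<^sup>+ z. G n z \<partial>disc_area) = ennreal (2 / 2 ^ n) * qint s (\<lambda>z. 1 / (1 - cnj (a n) * z)) b"
          unfolding G_def qint_def by (rule nn_integral_cmult[OF km])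
        also have "\<dots> \<le> ennreal (2 / 2 ^ n) * ennreal C" by (intro mult_left_mono C a b) auto
        also have "\<dots> = ennreal (2 * C * (1 / 2 ^ n))" using C(1) by (simp add: ennreal_mult'[symmetric])
        finally show ?thesis .
      qed
      show "2 * C * (1 / 2 ^ n) \<ge> 0" for n using C by simp
      show "summable (\<lambda>n. 2 * C * (1 / 2 ^ n))" by (rule sums_summable[OF g])
      fix z assume "z \<in> space disc_area"
      hence z: "cmod z < 1" by simp
      have xb: "?x n z \<le> 1 / (1 - cmod z)" for n
        using norm_one_minus_cnj_mult(2)[OF a z] z by (simp add: norm_divide frac_le)
      note D = dyadic_sum_square_le[of "\<lambda>n. ?x n z", OF norm_ge_zero xb]
      have "(cmod (h z))\<^sup>2 \<le> (\<Sum>n. ?x n z / 2 ^ n)\<^sup>2" by (intro power_mono h z) auto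
      also note D(3)
      finally have "(cmod (h z))\<^sup>2 * ?w z \<le> (2 * (\<Sum>n. (?x n z)\<^sup>2 / 2 ^ n)) * ?w z" by (rule mult_right_mono) auto
      also have "\<dots> = (\<Sum>n. (?x n z)\<^sup>2 / 2 ^ n) * (2 * ?w z)" by simp
      also have "\<dots> = (\<Sum>n. (?x n z)\<^sup>2 / 2 ^ n * (2 * ?w z))" by (rule suminf_mult2[OF D(2)])
      finally have "ennreal ((cmod (h z))\<^sup>2 * ?w z) \<le> ennreal (\<Sum>n. (?x n z)\<^sup>2 / 2 ^ n * (2 * ?w z))" by (rule ennreal_leI)
      also have "\<dots> = (\<Sum>n. ennreal ((?x n z)\<^sup>2 / 2 ^ n * (2 * ?w z)))"
        by (rule suminf_ennreal2[symmetric], simp, rule summable_mult2[OF D(2)])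
      also have "\<dots> = (\<Sum>n. G n z)"
        unfolding G_def by (intro suminf_cong) (simp add: ennreal_mult'[symmetric] mult_ac)
      finally show "ennreal ((cmod (h z))\<^sup>2 * ?w z) \<le> (\<Sum>n. G n z)" .
    qed
    thus ?thesis using sums_unique[OF g] by simp
  qed
  thus ?thesis unfolding in_Q_def using C(1) by (intro exI[of _ "2 * C * 2"]) auto
qed

lemma suminf_ge_term:
  fixes x :: "nat \<Rightarrow> real"
  assumes "x sums S" "\<And>n. x n \<ge> 0"
  shows "x n \<le> S"
  using sum_le_suminf[OF sums_summable[OF assms(1)], of "{n}"] assms(2) sums_unique[OF assms(1)] by simp

text \<open>The summands are ln 4 - Ln (1 - cnj (a n) z); the branch is safe because 1 - cnj (a n) z
  has positive real part. As its modulus is below 2, the constant 4 makes each summand have real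
  part above ln 2, so the real part of the sum dominates every single term. The same 4 gives at
  least the logarithmic weight of \<open>a n\<close> wherever |1 - cnj (a n) z| \<le> 2 (1 - |a
  n|).\<close>

lemma logarithmic_test_function:
  fixes a :: "nat \<Rightarrow> complex"
  assumes a: "\<And>n. cmod (a n) < 1"
  obtains f where "f holomorphic_on ball 0 1" "\<And>s. 0 < s \<Longrightarrow> s \<le> 1 \<Longrightarrow> in_Q s (deriv f)"
    "\<And>n z. cmod z < 1 \<Longrightarrow> ln (4 / cmod (1 - cnj (a n) * z)) / 2 ^ n \<le> cmod (f z)"
proof -
  define F where "F n z = of_real (ln 4) - Ln (1 - cnj (a n) * z)" for n z
  have nn: "1 - cnj (a n) * z \<notin> \<real>\<^sub>\<le>\<^sub>0" if "cmod z < 1" for n z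
    using Re_one_minus_cnj_mult_pos[OF a that, of n] by (auto simp: complex_nonpos_Reals_iff)
  have Fh: "F n holomorphic_on ball 0 1" for n
    unfolding F_def using nn by (intro holomorphic_intros) auto
  have ReF: "Re (F n z) = ln (4 / cmod (1 - cnj (a n) * z))" if "cmod z < 1" for n z
    using norm_one_minus_cnj_mult(3,4)[OF a that, of n] by (simp add: F_def ln_div)
  have dF: "deriv (F n) z = cnj (a n) / (1 - cnj (a n) * z)" if "cmod z < 1" for n z
    unfolding F_def by (rule DERIV_imp_deriv) (auto intro!: derivative_eq_intros nn[OF that], simp add: divide_inverse mult.commute)
  have bd: "\<exists>B. \<forall>n z. cmod z \<le> r \<longrightarrow> cmod (F n z) \<le> B" if r: "r < 1" for r
  proof (intro exI allI impI)
    fix n z assume zr: "cmod z \<le> r"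
    hence z: "cmod z < 1" using r by simp
    let ?y = "cmod (1 - cnj (a n) * z)"
    have y: "1 - r \<le> ?y" "0 < ?y" "?y < 2"
      using norm_one_minus_cnj_mult[OF a z, of n] zr by auto
    have "cmod (F n z) \<le> \<bar>Re (F n z)\<bar> + \<bar>Im (F n z)\<bar>" by (rule cmod_le)
    also have "\<bar>Im (F n z)\<bar> \<le> pi"
      using mpi_less_Im_Ln[of "1 - cnj (a n) * z"] Im_Ln_le_pi[of "1 - cnj (a n) * z"] y by (simp add: F_def)
    also have "\<bar>Re (F n z)\<bar> \<le> ln (4 / (1 - r))"
    proof -
      have "1 \<le> 4 / ?y" using y by simp
      moreover have "4 / ?y \<le> 4 / (1 - r)" using y r by (intro divide_left_mono) auto
      ultimately show ?thesis unfolding ReF[OF z] using y by (simp add: ln_mono)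
    qed
    finally show "cmod (F n z) \<le> ln (4 / (1 - r)) + pi" by simp
  qed
  obtain f where f: "f holomorphic_on ball 0 1"
    "\<And>z. cmod z < 1 \<Longrightarrow> (\<lambda>n. F n z / 2 ^ n) sums f z"
    "\<And>z. cmod z < 1 \<Longrightarrow> (\<lambda>n. deriv (F n) z / 2 ^ n) sums deriv f z"
    using dyadic_series_holomorphic[of F, OF Fh bd] by blast
  show thesis
  proof (rule that[OF f(1)])
    show "in_Q s (deriv f)" if "0 < s" "s \<le> 1" for s
    proof (rule in_Q_kernel_series[where a = a])
      fix z :: complex assume z: "cmod z < 1"
      let ?x = "\<lambda>n. cmod (1 / (1 - cnj (a n) * z))"
      have xb: "?x n \<le> 1 / (1 - cmod z)" for n
        using norm_one_minus_cnj_mult(2)[OF a z] z by (simp add: norm_divide frac_le)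
      note D = dyadic_sum_square_le[of ?x, OF norm_ge_zero xb]
      have le: "cmod (deriv (F n) z / 2 ^ n) \<le> ?x n / 2 ^ n" for n
        unfolding dF[OF z] using a[of n] by (simp add: norm_divide norm_mult norm_power divide_right_mono)
      have "cmod (deriv f z) = cmod (\<Sum>n. deriv (F n) z / 2 ^ n)" using sums_unique[OF f(3)[OF z]] by simp
      also have "\<dots> \<le> (\<Sum>n. ?x n / 2 ^ n)"
        by (rule norm_suminf_le[OF le D(1)])
      finally show "cmod (deriv f z) \<le> (\<Sum>n. ?x n / 2 ^ n)" .
    qed (use that a in auto)
    show "ln (4 / cmod (1 - cnj (a n) * z)) / 2 ^ n \<le> cmod (f z)" if z: "cmod z < 1" for n z
    proof -
      have "(\<lambda>n. Re (F n z / 2 ^ n)) sums Re (f z)" by (rule sums_Re[OF f(2)[OF z]])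
      moreover have "Re (F n z / 2 ^ n) = ln (4 / cmod (1 - cnj (a n) * z)) / 2 ^ n" for n
      proof -
        have "Re (F n z / 2 ^ n) = Re (F n z / of_real (2 ^ n))" by simp
        thus ?thesis by (simp only: Re_divide_of_real ReF[OF z])
      qed
      ultimately have "(\<lambda>n. ln (4 / cmod (1 - cnj (a n) * z)) / 2 ^ n) sums Re (f z)" by simp
      moreover have "0 \<le> ln (4 / cmod (1 - cnj (a n) * z)) / 2 ^ n" for n
        using norm_one_minus_cnj_mult(3,5)[OF a z, of n] by simp
      ultimately have "ln (4 / cmod (1 - cnj (a n) * z)) / 2 ^ n \<le> Re (f z)" by (rule suminf_ge_term)
      also have "\<dots> \<le> cmod (f z)" by (rule complex_Re_le_cmod)
      finally show ?thesis .
    qed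
  qed
qed

text \<open>Here f is a primitive of the sum of the kernels 1 / (1 - cnj (a n) z) with weights 2^-n.
  All of these have positive real part, and the n-th equals 1 / (1 - |a n|^2) \<ge> 1 / (2 (1 - |a
  n|)) at \<open>a n\<close>, so f' reaches the Bloch growth rate there up to the factor
  2^-n.\<close>

lemma kernel_test_function:
  fixes a :: "nat \<Rightarrow> complex"
  assumes a: "\<And>n. cmod (a n) < 1"
  obtains f where "f holomorphic_on ball 0 1" "\<And>s. 0 < s \<Longrightarrow> s \<le> 1 \<Longrightarrow> in_Q s (deriv f)"
    "\<And>n. 1 / (2 * 2 ^ n) \<le> cmod (deriv f (a n)) * (1 - cmod (a n))"
proof -
  define F where "F n z = 1 / (1 - cnj (a n) * z)" for n z
  have Fh: "F n holomorphic_on ball 0 1" for n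
    unfolding F_def using norm_one_minus_cnj_mult(4)[OF a] by (intro holomorphic_intros) auto
  have xb: "cmod (F n z) \<le> 1 / (1 - cmod z)" if "cmod z < 1" for n z
    using norm_one_minus_cnj_mult(2)[OF a that] that by (simp add: F_def norm_divide frac_le)
  have bd: "\<exists>B. \<forall>n z. cmod z \<le> r \<longrightarrow> cmod (F n z) \<le> B" if r: "r < 1" for r
  proof (intro exI allI impI)
    fix n z assume zr: "cmod z \<le> r"
    hence z: "cmod z < 1" using r by simp
    have "cmod (F n z) \<le> 1 / (1 - cmod z)" by (rule xb[OF z])
    also have "\<dots> \<le> 1 / (1 - r)" using zr r by (intro divide_left_mono) auto
    finally show "cmod (F n z) \<le> 1 / (1 - r)" .
  qed
  obtain h where h: "h holomorphic_on ball 0 1" "\<And>z. cmod z < 1 \<Longrightarrow> (\<lambda>n. F n z / 2 ^ n) sums h z"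
    "\<And>z. cmod z < 1 \<Longrightarrow> (\<lambda>n. deriv (F n) z / 2 ^ n) sums deriv h z"
    using dyadic_series_holomorphic[of F, OF Fh bd] by blast
  obtain f where f: "\<And>z. z \<in> ball 0 1 \<Longrightarrow> (f has_field_derivative h z) (at z within ball 0 1)"
    using holomorphic_convex_primitive'[OF convex_ball open_ball h(1)] by blast
  have f': "(f has_field_derivative h z) (at z)" if "cmod z < 1" for z
    using f[of z] that by (simp add: at_within_open[OF _ open_ball])
  have df: "deriv f z = h z" if "cmod z < 1" for z by (rule DERIV_imp_deriv[OF f'[OF that]])
  show thesis
  proof
    have "\<exists>f'. (f has_field_derivative f') (at z)" if "z \<in> ball 0 1" for z
      using f'[of z] that by auto
    thus "f holomorphic_on ball 0 1" unfolding holomorphic_on_open[OF open_ball] by blast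
    show "in_Q s (deriv f)" if "0 < s" "s \<le> 1" for s
    proof (rule in_Q_kernel_series[where a = a])
      fix z :: complex assume z: "cmod z < 1"
      note D = dyadic_sum_square_le[of "\<lambda>n. cmod (F n z)", OF norm_ge_zero xb[OF z]]
      have le: "cmod (F n z / 2 ^ n) \<le> cmod (F n z) / 2 ^ n" for n by (simp add: norm_divide norm_power)
      have "cmod (deriv f z) = cmod (\<Sum>n. F n z / 2 ^ n)" using sums_unique[OF h(2)[OF z]] df[OF z] by simp
      also have "\<dots> \<le> (\<Sum>n. cmod (F n z) / 2 ^ n)"
        by (rule norm_suminf_le[OF le D(1)])
      finally show "cmod (deriv f z) \<le> (\<Sum>n. cmod (1 / (1 - cnj (a n) * z)) / 2 ^ n)" unfolding F_def .
    qed (use that a in auto)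
    show "1 / (2 * 2 ^ n) \<le> cmod (deriv f (a n)) * (1 - cmod (a n))" for n
    proof -
      let ?z = "a n"
      have Re: "Re (F k ?z / 2 ^ k) = Re (F k ?z) / 2 ^ k" for k
      proof -
        have "Re (F k ?z / 2 ^ k) = Re (F k ?z / of_real (2 ^ k))" by simp
        thus ?thesis by (simp only: Re_divide_of_real)
      qed
      have "(\<lambda>k. Re (F k ?z) / 2 ^ k) sums Re (h ?z)" using sums_Re[OF h(2)[OF a[of n]]] unfolding Re .
      moreover have "0 \<le> Re (F k ?z) / 2 ^ k" for k
        using Re_one_minus_cnj_mult_pos[OF a[of k] a[of n]] by (simp add: F_def Re_divide)
      ultimately have "Re (F n ?z) / 2 ^ n \<le> Re (h ?z)" by (rule suminf_ge_term)
      also have "\<dots> \<le> cmod (h ?z)" by (rule complex_Re_le_cmod)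
      finally have 1: "Re (F n ?z) / 2 ^ n \<le> cmod (deriv f ?z)" unfolding df[OF a] .
      have eq: "1 - cnj ?z * ?z = of_real (1 - (cmod ?z)\<^sup>2)"
        using complex_norm_square[of ?z] by (simp add: mult.commute)
      have "F n ?z = of_real (1 / (1 - (cmod ?z)\<^sup>2))" unfolding F_def eq by simp
      hence e: "Re (F n ?z) = 1 / (1 - (cmod ?z)\<^sup>2)" by (simp only: Re_complex_of_real)
      have "1 / (2 * 2 ^ n) = 1 / (2 * (1 - cmod ?z)) / 2 ^ n * (1 - cmod ?z)" using a[of n] by (simp add: field_simps)
      also have "\<dots> \<le> 1 / (1 - (cmod ?z)\<^sup>2) / 2 ^ n * (1 - cmod ?z)"
        using one_minus_norm_square[OF a[of n]] a[of n] by (intro mult_right_mono divide_right_mono divide_left_mono) auto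
      also have "\<dots> \<le> cmod (deriv f ?z) * (1 - cmod ?z)" using 1 a[of n] unfolding e by (intro mult_right_mono) auto
      finally show ?thesis .
    qed
  qed
qed

subsection \<open>From Carleson boxes to the full weights\<close>

text \<open>The region is a Carleson box written as a nonisotropic ball. It is the set on which the
  logarithmic test function peaking at a is bounded below by \<open>log_weight a\<close>, up to its
  series coefficient.\<close>

definition box_int :: "real \<Rightarrow> (complex \<Rightarrow> complex) \<Rightarrow> complex \<Rightarrow> ennreal" where
  "box_int s h a = (\<integral>\<^sup>+ z. ennreal ((cmod (h z))\<^sup>2 * disc_weight a z powr s) *
     indicator {z. cmod (1 - cnj a * z) \<le> 2 * (1 - cmod a)} z \<partial>disc_area)"

lemma measurable_box_integrand:
  assumes h: "h holomorphic_on ball 0 1" and a: "cmod a < 1"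
  shows "(\<lambda>z. ennreal ((cmod (h z))\<^sup>2 * disc_weight a z powr s) *
    indicator {z. cmod (1 - cnj a * z) \<le> 2 * (1 - cmod a)} z) \<in> borel_measurable disc_area"
proof (rule borel_measurable_times_ennreal)
  show "(\<lambda>z. ennreal ((cmod (h z))\<^sup>2 * disc_weight a z powr s)) \<in> borel_measurable disc_area"
    by (intro measurable_compose[OF _ measurable_ennreal] measurable_disc_areaI continuous_on_mult continuous_on_power
        continuous_on_norm continuous_on_weight a holomorphic_on_imp_continuous_on h)
  have "closed {z. cmod (1 - cnj a * z) \<le> 2 * (1 - cmod a)}"
    by (intro closed_Collect_le continuous_intros)
  thus "indicator {z. cmod (1 - cnj a * z) \<le> 2 * (1 - cmod a)} \<in> borel_measurable disc_area"
    by (intro measurable_disc_area_borel borel_measurable_indicator borel_closed)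
qed

text \<open>Differentiating the geometric series twice gives the coefficients (k + 1)(k + 2), which
  dominate half of (k + 2)^2.\<close>

lemma summable_square_geometric:
  fixes r :: real
  assumes "0 \<le> r" "r < 1"
  shows "summable (\<lambda>k. (real k + 2)\<^sup>2 * r ^ k)"
proof -
  have "summable (\<lambda>n. diffs (\<lambda>_. 1) n * x ^ n)" if "norm x < 1" for x :: real
    by (rule termdiff_converges[of x 1]) (use that in \<open>auto intro: summable_geometric\<close>)
  hence "summable (\<lambda>n. diffs (diffs (\<lambda>_. 1)) n * r ^ n)"
    using assms by (intro termdiff_converges[of r 1]) auto
  hence "summable (\<lambda>n. 2 * (diffs (diffs (\<lambda>_. 1)) n * r ^ n))" by (rule summable_mult)
  thus ?thesis
  proof (rule summable_comparison_test'[of _ 0])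
    fix k :: nat
    have "(real k + 2)\<^sup>2 \<le> 2 * ((real k + 1) * (real k + 2))" by (simp add: power2_eq_square algebra_simps)
    also have "(real k + 1) * (real k + 2) = diffs (diffs (\<lambda>_. 1)) k" by (simp add: diffs_def algebra_simps)
    finally have "(real k + 2)\<^sup>2 * r ^ k \<le> (2 * diffs (diffs (\<lambda>_. 1)) k) * r ^ k" using assms by (intro mult_right_mono) auto
    thus "norm ((real k + 2)\<^sup>2 * r ^ k) \<le> 2 * (diffs (diffs (\<lambda>_. 1)) k * r ^ k)" using assms by (simp add: mult.assoc)
  qed
qed

text \<open>The point b_k lies on the radius through a, pulled inwards so that its box contains all
  z with |1 - cnj a z| \<le> 2^k (1 - |a|). Once 2^k (1 - |a|) exceeds 1, the maximum with 0 places
  it at the origin, where the box is the whole disc.\<close>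

lemma dyadic_center:
  assumes a: "cmod a < 1"
  defines "t \<equiv> \<lambda>k::nat. max 0 (1 - 2 ^ k * (1 - cmod a))"
  defines "b \<equiv> \<lambda>k. of_real (t k) * a"
  shows "cmod (b k) < 1" "1 - cmod (b k) \<le> 2 * 2 ^ k * (1 - cmod a)"
    "cmod z < 1 \<Longrightarrow> cmod (1 - cnj a * z) \<le> 2 ^ k * (1 - cmod a) \<Longrightarrow> cmod (1 - cnj (b k) * z) \<le> 2 * (1 - cmod (b k))"
proof -
  define d where "d = 1 - cmod a"
  have d: "0 < d" "d \<le> 1" using a by (auto simp: d_def)
  have t: "0 \<le> t k" "t k \<le> 1" "t k < 1" using d by (auto simp: t_def d_def[symmetric])
  have nb: "cmod (b k) = t k * cmod a" using t by (simp add: b_def norm_mult)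
  have "t k * cmod a \<le> 1 * cmod a" using t by (intro mult_right_mono) auto
  thus b1: "cmod (b k) < 1" using a nb by simp
  have p1: "(1::real) \<le> 2 ^ k" by simp
  have dp: "d \<le> 2 ^ k * d" using mult_right_mono[OF p1, of d] d by simp
  have nb': "1 - cmod (b k) = (1 - t k) + t k * d" unfolding nb d_def by (simp add: algebra_simps)
  have td: "t k * d \<le> 1 * d" using t d by (intro mult_right_mono) auto
  have tk: "1 - t k \<le> 2 ^ k * d" by (simp add: t_def d_def)
  show "1 - cmod (b k) \<le> 2 * 2 ^ k * (1 - cmod a)"
    unfolding nb' d_def[symmetric] using td dp tk by linarith
  show "cmod (1 - cnj (b k) * z) \<le> 2 * (1 - cmod (b k))"
    if z: "cmod z < 1" and le: "cmod (1 - cnj a * z) \<le> 2 ^ k * (1 - cmod a)"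
  proof (cases "2 ^ k * d \<le> 1")
    case True
    hence tk': "1 - t k = 2 ^ k * d" by (simp add: t_def d_def)
    have e: "1 - cnj (b k) * z = (1 - cnj a * z) + of_real (1 - t k) * (cnj a * z)"
      by (simp add: b_def algebra_simps)
    have "cmod (cnj a * z) \<le> 1" using a z by (simp add: norm_mult mult_le_one)
    hence m: "(1 - t k) * cmod (cnj a * z) \<le> (1 - t k) * 1" using t by (intro mult_left_mono) auto
    have "cmod (1 - cnj (b k) * z) \<le> cmod (1 - cnj a * z) + (1 - t k) * cmod (cnj a * z)"
      unfolding e using norm_triangle_ineq[of "1 - cnj a * z" "of_real (1 - t k) * (cnj a * z)"] t
      by (simp only: norm_mult norm_of_real abs_of_nonneg diff_ge_0_iff_ge)
    also have "\<dots> \<le> 2 ^ k * d + 2 ^ k * d"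
    proof (rule add_mono)
      show "cmod (1 - cnj a * z) \<le> 2 ^ k * d" using le by (simp only: d_def)
      show "(1 - t k) * cmod (cnj a * z) \<le> 2 ^ k * d" using m by (simp only: tk' mult_1_right)
    qed
    also have "\<dots> \<le> 2 * (1 - cmod (b k))" unfolding nb' tk' using t d by simp
    finally show ?thesis .
  next
    case False
    hence "t k = 0" by (simp add: t_def d_def)
    thus ?thesis by (simp add: b_def)
  qed
qed

text \<open>Where |1 - cnj a z| is about 2^k (1 - |a|), the weight at a is at most 64^s 2^(-ks)
  times the weight at b_k, and z lies in the box of b_k. Passing from b_k to a costs at most the
  factor k + 2 in the logarithm, because 1 - |b_k| \<le> 2^(k+1) (1 - |a|) and
  \<open>log_weight (b k)\<close> is at least ln 2. The series of (k + 2)^2 2^(-ks)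
  converges.\<close>

lemma box_int_imp_in_Qlog:
  assumes s: "s > 0" and h: "h holomorphic_on ball 0 1"
    and M: "M \<ge> 0" "\<And>a. cmod a < 1 \<Longrightarrow> box_int s h a \<le> ennreal (M / (log_weight a)\<^sup>2)"
  shows "in_Qlog s h"
proof -
  define c where "c k = (64 powr s * M) * ((real k + 2)\<^sup>2 * (2 powr - s) ^ k)" for k :: nat
  have r: "0 \<le> 2 powr - s" "2 powr - s < (1::real)" using s powr_less_mono[of "- s" 0 2] by auto
  have c0: "c k \<ge> 0" for k using M by (simp add: c_def)
  have sc: "summable c" unfolding c_def by (intro summable_mult summable_square_geometric r)
  have main: "qint s h a \<le> ennreal ((\<Sum>k. c k) / (log_weight a)\<^sup>2)" if a: "cmod a < 1" for a
  proof -
    let ?L = "log_weight a"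
    have L: "?L > 0" by (rule log_weight_ge(2)[OF a])
    define d where "d = 1 - cmod a"
    have d: "0 < d" "d \<le> 1" using a by (auto simp: d_def)
    define b where "b k = of_real (max 0 (1 - 2 ^ k * (1 - cmod a))) * a" for k :: nat
    note bk = dyadic_center[OF a, folded b_def]
    have b1: "cmod (b k) < 1" for k by (rule bk(1))
    have b2: "1 - cmod (b k) \<le> 2 * 2 ^ k * d" for k using bk(2)[of k] by (simp add: d_def)
    define B where "B k z = ennreal ((cmod (h z))\<^sup>2 * disc_weight (b k) z powr s) *
     indicator {z. cmod (1 - cnj (b k) * z) \<le> 2 * (1 - cmod (b k))} z" for k z
    have Bm: "B k \<in> borel_measurable disc_area" for k
      unfolding B_def[abs_def] by (rule measurable_box_integrand[OF h b1])
    define e where "e k = 64 powr s * (2 powr - s) ^ k" for k :: nat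
    have e0: "e k \<ge> 0" for k by (simp add: e_def)
    have "qint s h a \<le> ennreal (\<Sum>k. c k / ?L\<^sup>2)"
      unfolding qint_def
    proof (rule nn_integral_le_suminf[of "\<lambda>k z. ennreal (e k) * B k z"])
      show "(\<lambda>z. ennreal (e k) * B k z) \<in> borel_measurable disc_area" for k
        by (intro borel_measurable_times_ennreal Bm) auto
      show "c k / ?L\<^sup>2 \<ge> 0" for k using c0 by simp
      show "summable (\<lambda>k. c k / ?L\<^sup>2)" by (rule summable_divide[OF sc])
      show "(\<integral>\<^sup>+ z. ennreal (e k) * B k z \<partial>disc_area) \<le> ennreal (c k / ?L\<^sup>2)" for k
      proof -
        let ?Lb = "log_weight (b k)"
        have Lb: "?Lb > 0" "ln 2 \<le> ?Lb" using log_weight_ge[OF b1] by auto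
        have "?L \<le> (real k + 2) * ?Lb"
        proof -
          have x: "1 - cmod (b k) > 0" using b1[of k] by simp
          have "2 / d \<le> 2 / (1 - cmod (b k)) * (2 * 2 ^ k)"
            using b2[of k] x d by (simp add: field_simps)
          hence "ln (2 / d) \<le> ln (2 / (1 - cmod (b k)) * (2 ^ Suc k))"
            using x d by (subst ln_le_cancel_iff) auto
          also have "\<dots> = ?Lb + real (Suc k) * ln 2"
            using x by (subst ln_mult) (auto simp: log_weight_def ln_realpow simp del: power_Suc)
          also have "\<dots> \<le> ?Lb + real (Suc k) * ?Lb" using Lb by (intro add_left_mono mult_left_mono) auto
          finally show ?thesis by (simp add: log_weight_def d_def algebra_simps)
        qed
        hence "?L\<^sup>2 \<le> ((real k + 2) * ?Lb)\<^sup>2" using L by (intro power_mono) auto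
        hence "(real k + 2)\<^sup>2 / ((real k + 2) * ?Lb)\<^sup>2 \<le> (real k + 2)\<^sup>2 / ?L\<^sup>2"
          using L by (intro divide_left_mono mult_pos_pos zero_less_power) (use Lb in auto)
        moreover have "real k + 2 \<noteq> 0" by linarith
        ultimately have q: "1 / ?Lb\<^sup>2 \<le> (real k + 2)\<^sup>2 / ?L\<^sup>2" by (simp add: power_mult_distrib)
        have "(\<integral>\<^sup>+ z. ennreal (e k) * B k z \<partial>disc_area) = ennreal (e k) * box_int s h (b k)"
          unfolding B_def box_int_def by (rule nn_integral_cmult[OF Bm[unfolded B_def[abs_def]]])
        also have "\<dots> \<le> ennreal (e k) * ennreal (M / ?Lb\<^sup>2)" by (intro mult_left_mono M b1) auto
        also have "\<dots> = ennreal (e k * M * (1 / ?Lb\<^sup>2))" using e0 M(1) by (simp add: ennreal_mult'[symmetric])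
        also have "\<dots> \<le> ennreal (e k * M * ((real k + 2)\<^sup>2 / ?L\<^sup>2))" using q e0 M(1) by (intro ennreal_leI mult_left_mono) auto
        also have "e k * M * ((real k + 2)\<^sup>2 / ?L\<^sup>2) = c k / ?L\<^sup>2" by (simp add: c_def e_def)
        finally show ?thesis .
      qed
      fix z assume "z \<in> space disc_area"
      hence z: "cmod z < 1" by simp
      define y where "y = cmod (1 - cnj a * z)"
      have y0: "y > 0" and yd: "d \<le> y" using norm_one_minus_cnj_mult[OF a z] by (auto simp: y_def d_def)
      define v where "v = (1 - (cmod z)\<^sup>2) powr s"
      have v0: "v \<ge> 0" by (simp add: v_def)
      \<comment> \<open>The shell is indexed by its outer radius, because it is the upper bound on y
        that puts z into the box of b_k.\<close>
      obtain k where k: "2 ^ k * d / 2 \<le> y" "y \<le> 2 ^ k * d"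
      proof -
        obtain j where j: "2 ^ j * d \<le> y" "y < 2 ^ Suc j * d" using dyadic_above[OF d(1) yd] by blast
        thus ?thesis by (intro that[of "Suc j"]) auto
      qed
      define p where "p = (2 ^ k :: real)"
      have p0: "p > 0" by (simp add: p_def)
      let ?x = "1 - cmod (b k)" and ?yb = "cmod (1 - cnj (b k) * z)"
      have x0: "?x > 0" using b1[of k] by simp
      have x2: "?x \<le> 2 * p * d" using b2[of k] by (simp add: p_def)
      have R: "?yb \<le> 2 * ?x" using bk(3)[OF z, of k] k(2) by (simp add: y_def d_def)
      have yb0: "?yb > 0" by (rule norm_one_minus_cnj_mult(3)[OF b1 z])
      have "disc_weight a z powr s = (1 - (cmod a)\<^sup>2) powr s * v * y powr (- 2 * s)"
        unfolding weight_eq[OF a z] v_def y_def ..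
      also have "\<dots> \<le> (2 * d) powr s * v * (p * d / 2) powr (- 2 * s)"
        using one_minus_norm_square[OF a] s d k(1) v0 p0
        by (intro mult_mono powr_mono2 powr_mono2' order_refl) (auto simp: d_def p_def)
      also have "\<dots> = v * (8 / (p\<^sup>2 * d)) powr s"
      proof -
        have "(p * d / 2) powr (- 2 * s) = ((p * d / 2) powr - 2) powr s" by (simp add: powr_powr)
        also have "(p * d / 2) powr - 2 = 4 / (p * d)\<^sup>2" using p0 d by (simp add: powr_minus_divide power_divide)
        finally have "(2 * d) powr s * (p * d / 2) powr (- 2 * s) = (2 * d * (4 / (p * d)\<^sup>2)) powr s" by (simp only: powr_mult)
        also have "2 * d * (4 / (p * d)\<^sup>2) = 8 / (p\<^sup>2 * d)" using d p0 by (simp add: field_simps power2_eq_square)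
        finally show ?thesis by (simp add: mult_ac)
      qed
      \<comment> \<open>With x = 1 - |b_k|, the quantity 1/(4x) is x / (2x)^2, that is, the lower
        bound which the box condition gives for the weight at b_k apart from (1 - |z|^2)^s. The
        constant 64 is what x \<le> 2 p d requires.\<close>
      also have "\<dots> \<le> v * ((64 / p) * (1 / (4 * ?x))) powr s"
      proof -
        have "8 * (p * (4 * ?x)) \<le> 8 * (p * (4 * (2 * p * d)))" using x2 p0 by (intro mult_left_mono) auto
        hence "8 / (p\<^sup>2 * d) \<le> (64 / p) * (1 / (4 * ?x))"
          using p0 d x0 by (simp add: field_simps power2_eq_square)
        thus ?thesis using s p0 d v0 by (intro mult_left_mono powr_mono2) auto
      qed
      also have "\<dots> = e k * (v * (1 / (4 * ?x)) powr s)"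
      proof -
        have "e k = (64 / p) powr s"
          unfolding e_def p_def by (simp add: powr_divide powr_minus_divide powr_realpow[symmetric] powr_powr power_one_over mult.commute flip: powr_realpow)
        thus ?thesis by (simp only: powr_mult mult_ac)
      qed
      also have "\<dots> \<le> e k * disc_weight (b k) z powr s"
      proof (intro mult_left_mono e0)
        have "1 / (4 * q) = q * (2 * q) powr - 2" if "q > 0" for q :: real
          using that by (simp add: powr_minus_divide power2_eq_square)
        from this[OF x0] have "1 / (4 * ?x) = ?x * (2 * ?x) powr - 2" .
        hence "(1 / (4 * ?x)) powr s = ?x powr s * (2 * ?x) powr (- 2 * s)" by (simp only: powr_mult powr_powr)
        hence "v * (1 / (4 * ?x)) powr s = ?x powr s * v * (2 * ?x) powr (- 2 * s)" by simp
        also have "\<dots> \<le> (1 - (cmod (b k))\<^sup>2) powr s * v * ?yb powr (- 2 * s)"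
          using one_minus_norm_square[OF b1[of k]] s x0 R yb0 v0
          by (intro mult_mono powr_mono2 powr_mono2' order_refl) auto
        also have "\<dots> = disc_weight (b k) z powr s" unfolding weight_eq[OF b1 z] v_def ..
        finally show "v * (1 / (4 * ?x)) powr s \<le> disc_weight (b k) z powr s" .
      qed
      finally have "(cmod (h z))\<^sup>2 * disc_weight a z powr s \<le> (cmod (h z))\<^sup>2 * (e k * disc_weight (b k) z powr s)"
        by (rule mult_left_mono) simp
      hence "ennreal ((cmod (h z))\<^sup>2 * disc_weight a z powr s) \<le> ennreal (e k) * B k z"
        using R e0[of k] by (simp add: B_def ennreal_mult'[symmetric] ennreal_leI mult_ac)
      also have "\<dots> \<le> (\<Sum>k. ennreal (e k) * B k z)" by (rule ennreal_le_suminf)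
      finally show "ennreal ((cmod (h z))\<^sup>2 * disc_weight a z powr s) \<le> (\<Sum>k. ennreal (e k) * B k z)" .
    qed
    also have "(\<Sum>k. c k / ?L\<^sup>2) = (\<Sum>k. c k) / ?L\<^sup>2" by (rule suminf_divide[OF sc])
    finally show ?thesis .
  qed
  show ?thesis unfolding in_Qlog_def
    by (intro exI[of _ "\<Sum>k. c k"] conjI allI impI main) (use c0 sc in \<open>auto intro: suminf_nonneg\<close>)
qed

subsection \<open>Necessity\<close>

lemma exists_power2_ge: "\<exists>n::nat. x < 2 ^ n" for x :: real
  using real_arch_pow[of 2 x] by auto

lemma in_Qlog_if_multiplier:
  assumes s1: "0 < s1" "s1 \<le> 1" and s: "s > 0" and h: "h holomorphic_on ball 0 1"
    and mult: "\<And>f. f holomorphic_on ball 0 1 \<Longrightarrow> in_Q s1 (deriv f) \<Longrightarrow> in_Q s (\<lambda>z. h z * f z)"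
  shows "in_Qlog s h"
proof -
  \<comment> \<open>The rate 8^n: on the n-th box the test function retains only the fraction 2^-n
    of the logarithm, whose square costs 4^n, and a further 2^n eventually exceeds the constant C of
    the image function.\<close>
  have "\<exists>n::nat. \<forall>a. cmod a < 1 \<longrightarrow> box_int s h a \<le> ennreal (8 ^ n / (log_weight a)\<^sup>2)"
  proof (rule ccontr)
    assume "\<not> ?thesis"
    hence "\<forall>n::nat. \<exists>a. cmod a < 1 \<and> \<not> box_int s h a \<le> ennreal (8 ^ n / (log_weight a)\<^sup>2)" by blast
    then obtain a where a: "\<And>n. cmod (a n) < 1" and big: "\<And>n. \<not> box_int s h (a n) \<le> ennreal (8 ^ n / (log_weight (a n))\<^sup>2)"
      by metis
    obtain f where f: "f holomorphic_on ball 0 1" "\<And>s. 0 < s \<Longrightarrow> s \<le> 1 \<Longrightarrow> in_Q s (deriv f)"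
      "\<And>n z. cmod z < 1 \<Longrightarrow> ln (4 / cmod (1 - cnj (a n) * z)) / 2 ^ n \<le> cmod (f z)"
      using logarithmic_test_function[of a, OF a] by blast
    obtain C where C: "C \<ge> 0" "\<And>a. cmod a < 1 \<Longrightarrow> qint s (\<lambda>z. h z * f z) a \<le> ennreal C"
      using in_QE[OF mult[OF f(1) f(2)[OF s1]]] by blast
    obtain n :: nat where n: "C < 2 ^ n" using exists_power2_ge by blast
    let ?a = "a n" and ?L = "log_weight (a n)"
    have L: "?L > 0" by (rule log_weight_ge(2)[OF a])
    have "ennreal ((?L / 2 ^ n)\<^sup>2) * box_int s h ?a = (\<integral>\<^sup>+ z. ennreal ((?L / 2 ^ n)\<^sup>2) *
        (ennreal ((cmod (h z))\<^sup>2 * disc_weight ?a z powr s) *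
        indicator {z. cmod (1 - cnj ?a * z) \<le> 2 * (1 - cmod ?a)} z) \<partial>disc_area)"
      unfolding box_int_def by (rule nn_integral_cmult[OF measurable_box_integrand[OF h a], symmetric])
    also have "\<dots> \<le> qint s (\<lambda>z. h z * f z) ?a"
      unfolding qint_def
    proof (rule nn_integral_mono)
      fix z assume "z \<in> space disc_area"
      hence z: "cmod z < 1" by simp
      let ?w = "disc_weight ?a z powr s"
      show "ennreal ((?L / 2 ^ n)\<^sup>2) * (ennreal ((cmod (h z))\<^sup>2 * ?w) * indicator {z. cmod (1 - cnj ?a * z) \<le> 2 * (1 - cmod ?a)} z)
         \<le> ennreal ((cmod (h z * f z))\<^sup>2 * ?w)"
      proof (cases "cmod (1 - cnj ?a * z) \<le> 2 * (1 - cmod ?a)")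
        case True
        have y: "cmod (1 - cnj ?a * z) > 0" by (rule norm_one_minus_cnj_mult(3)[OF a z])
        have "2 / (1 - cmod ?a) \<le> 4 / cmod (1 - cnj ?a * z)" using True y a[of n] by (simp add: field_simps)
        hence "?L \<le> ln (4 / cmod (1 - cnj ?a * z))" unfolding log_weight_def
          using y a[of n] by (subst ln_le_cancel_iff) auto
        hence "?L / 2 ^ n \<le> cmod (f z)" using f(3)[OF z, of n] by (smt (verit) divide_right_mono zero_le_power)
        hence "(?L / 2 ^ n)\<^sup>2 \<le> (cmod (f z))\<^sup>2" using L by (intro power_mono) auto
        hence "(?L / 2 ^ n)\<^sup>2 * ((cmod (h z))\<^sup>2 * ?w) \<le> (cmod (f z))\<^sup>2 * ((cmod (h z))\<^sup>2 * ?w)"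
          by (rule mult_right_mono) simp
        also have "\<dots> = (cmod (h z * f z))\<^sup>2 * ?w" by (simp only: norm_mult power_mult_distrib mult_ac)
        finally have "ennreal ((?L / 2 ^ n)\<^sup>2 * ((cmod (h z))\<^sup>2 * ?w)) \<le> ennreal ((cmod (h z * f z))\<^sup>2 * ?w)" by (rule ennreal_leI)
        thus ?thesis using True by (simp add: ennreal_mult')
      qed simp
    qed
    also have "\<dots> \<le> ennreal C" by (rule C(2)[OF a])
    finally have "box_int s h ?a \<le> ennreal (C / (?L / 2 ^ n)\<^sup>2)"
      using L C(1) by (subst (asm) ennreal_mult_le_iff) auto
    also have "C / (?L / 2 ^ n)\<^sup>2 = C * 4 ^ n / ?L\<^sup>2"
      by (simp add: power_divide power_mult[symmetric] mult.commute[of n 2]) (simp add: power_mult)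
    also have "ennreal \<dots> \<le> ennreal (2 ^ n * 4 ^ n / ?L\<^sup>2)"
      using n by (intro ennreal_leI divide_right_mono mult_right_mono) auto
    also have "(2::real) ^ n * 4 ^ n = 8 ^ n" by (simp flip: power_mult_distrib)
    finally show False using big[of n] by contradiction
  qed
  then obtain n :: nat where "\<And>a. cmod a < 1 \<Longrightarrow> box_int s h a \<le> ennreal (8 ^ n / (log_weight a)\<^sup>2)" by blast
  thus ?thesis by (intro box_int_imp_in_Qlog[OF s h, of "8 ^ n"]) auto
qed

text \<open>An unbounded g exceeds 4^n at suitable points; this rate still diverges after the loss
  of 2^n caused by the coefficients of a test series.\<close>

lemma bounded_if_not_sequence:
  assumes "\<And>a. (\<And>n. cmod (a n) < 1) \<Longrightarrow> (\<And>n. cmod (g (a n)) > 4 ^ n) \<Longrightarrow> False"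
  shows "bounded (g ` ball 0 1)"
proof (rule ccontr)
  assume nb: "\<not> bounded (g ` ball 0 1)"
  have "\<exists>a. cmod a < 1 \<and> cmod (g a) > 4 ^ n" for n :: nat
  proof (rule ccontr)
    assume "\<not> ?thesis"
    hence "cmod (g x) \<le> 4 ^ n" if "cmod x < 1" for x using that by (meson not_less)
    hence "\<forall>x\<in>g ` ball 0 1. cmod x \<le> 4 ^ n" by auto
    hence "bounded (g ` ball 0 1)" unfolding bounded_iff by blast
    with nb show False by contradiction
  qed
  then obtain a where "\<And>n. cmod (a n) < 1 \<and> cmod (g (a n)) > 4 ^ n" by metis
  thus False using assms[of a] by blast
qed

text \<open>Membership of g f' forces the Bloch bound on it, while f' attains that growth at
  \<open>a n\<close> up to 2^-n; comparing the two bounds |g(a n)| by a multiple of 2^n.\<close>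

lemma bounded_if_derivative_multiplier:
  assumes s1: "0 < s1" "s1 \<le> 1" and s: "s > 0" and g: "g holomorphic_on ball 0 1"
    and mult: "\<And>f. f holomorphic_on ball 0 1 \<Longrightarrow> in_Q s1 (deriv f) \<Longrightarrow> in_Q s (\<lambda>z. g z * deriv f z)"
  shows "bounded (g ` ball 0 1)"
proof (rule bounded_if_not_sequence)
  fix a :: "nat \<Rightarrow> complex"
  assume a: "\<And>n. cmod (a n) < 1" and big: "\<And>n. cmod (g (a n)) > 4 ^ n"
  obtain f where f: "f holomorphic_on ball 0 1" "\<And>s. 0 < s \<Longrightarrow> s \<le> 1 \<Longrightarrow> in_Q s (deriv f)"
    "\<And>n. 1 / (2 * 2 ^ n) \<le> cmod (deriv f (a n)) * (1 - cmod (a n))"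
    using kernel_test_function[of a, OF a] by blast
  have "(\<lambda>z. g z * deriv f z) holomorphic_on ball 0 1"
    by (intro holomorphic_on_mult g holomorphic_deriv[OF f(1) open_ball])
  from in_Q_bloch[OF this s mult[OF f(1) f(2)[OF s1]]]
  obtain B where B: "B \<ge> 0" "\<And>z. cmod z < 1 \<Longrightarrow> cmod (g z * deriv f z) * (1 - cmod z) \<le> B" by blast
  obtain n :: nat where n: "2 * B < 2 ^ n" using exists_power2_ge by blast
  have "4 ^ n * (1 / (2 * 2 ^ n)) \<le> cmod (g (a n)) * (cmod (deriv f (a n)) * (1 - cmod (a n)))"
    using big[of n] by (intro mult_mono f(3)) auto
  also have "\<dots> \<le> B" using B(2)[OF a[of n]] by (simp add: norm_mult mult.assoc)
  finally have "(2 * 2) ^ n / (2 * 2 ^ n) \<le> B" by simp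
  hence "2 ^ n \<le> 2 * B" unfolding power_mult_distrib by simp
  thus False using n by simp
qed

text \<open>The same contradiction one level up: g f grows at most logarithmically as a Bloch
  function, whereas f alone already attains the logarithm at \<open>a n\<close> up to 2^-n.\<close>

lemma bounded_if_pointwise_multiplier:
  assumes s1: "0 < s1" "s1 \<le> 1" and s: "s > 0" and g: "g holomorphic_on ball 0 1"
    and mult: "\<And>f. f holomorphic_on ball 0 1 \<Longrightarrow> in_Q s1 (deriv f) \<Longrightarrow> in_Q s (deriv (\<lambda>z. g z * f z))"
  shows "bounded (g ` ball 0 1)"
proof (rule bounded_if_not_sequence)
  fix a :: "nat \<Rightarrow> complex"
  assume a: "\<And>n. cmod (a n) < 1" and big: "\<And>n. cmod (g (a n)) > 4 ^ n"
  obtain f where f: "f holomorphic_on ball 0 1" "\<And>s. 0 < s \<Longrightarrow> s \<le> 1 \<Longrightarrow> in_Q s (deriv f)"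
    "\<And>n z. cmod z < 1 \<Longrightarrow> ln (4 / cmod (1 - cnj (a n) * z)) / 2 ^ n \<le> cmod (f z)"
    using logarithmic_test_function[of a, OF a] by blast
  have gf: "(\<lambda>z. g z * f z) holomorphic_on ball 0 1" by (intro holomorphic_on_mult g f)
  from in_Q_bloch[OF holomorphic_deriv[OF gf open_ball] s mult[OF f(1) f(2)[OF s1]]]
  obtain B where B: "B \<ge> 0" "\<And>z. cmod z < 1 \<Longrightarrow> cmod (deriv (\<lambda>z. g z * f z) z) * (1 - cmod z) \<le> B" by blast
  define A where "A = cmod (g 0 * f 0) / ln 2 + B"
  obtain n :: nat where n: "A < 2 ^ n" using exists_power2_ge by blast
  let ?L = "log_weight (a n)"
  have L: "?L > 0" by (rule log_weight_ge(2)[OF a])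
  have "cmod (1 - cnj (a n) * a n) \<le> 2 * (1 - cmod (a n))"
  proof -
    have "1 - cnj (a n) * a n = of_real (1 - (cmod (a n))\<^sup>2)" using complex_norm_square[of "a n"] by (simp add: mult.commute)
    thus ?thesis using one_minus_norm_square[OF a[of n]] by (simp only: norm_of_real)
  qed
  moreover have y: "cmod (1 - cnj (a n) * a n) > 0" by (rule norm_one_minus_cnj_mult(3)[OF a a])
  ultimately have "2 / (1 - cmod (a n)) \<le> 4 / cmod (1 - cnj (a n) * a n)" using a[of n] by (simp add: field_simps)
  hence "?L \<le> ln (4 / cmod (1 - cnj (a n) * a n))" unfolding log_weight_def
    using y a[of n] by (subst ln_le_cancel_iff) auto
  hence fL: "?L / 2 ^ n \<le> cmod (f (a n))" using f(3)[OF a[of n], of n] by (smt (verit) divide_right_mono zero_le_power)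
  have "4 ^ n * (?L / 2 ^ n) \<le> cmod (g (a n)) * cmod (f (a n))"
    using big[of n] fL L by (intro mult_mono) auto
  also have "\<dots> \<le> A * ?L" using bloch_log_weight[OF gf B(2) a[of n]] by (simp add: A_def norm_mult)
  finally have "(2 * 2) ^ n * (?L / 2 ^ n) \<le> A * ?L" by simp
  hence "2 ^ n * ?L \<le> A * ?L" unfolding power_mult_distrib by simp
  hence "2 ^ n \<le> A" using L by simp
  thus False using n by simp
qed

subsection \<open>The operators\<close>

lemma has_field_derivative_segment_integral:
  assumes p: "p holomorphic_on ball 0 1" and z: "cmod z < 1"
  shows "((\<lambda>z. contour_integral (linepath 0 z) p) has_field_derivative p z) (at z)"
proof -
  obtain P where P: "\<And>z. z \<in> ball 0 1 \<Longrightarrow> (P has_field_derivative p z) (at z within ball 0 1)"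
    using holomorphic_convex_primitive'[OF convex_ball open_ball p] by blast
  have e: "contour_integral (linepath 0 w) p = P w - P 0" if w: "w \<in> ball 0 1" for w
  proof -
    have "closed_segment 0 w \<subseteq> ball 0 1" using w by (intro closed_segment_subset) auto
    hence "(p has_contour_integral (P (pathfinish (linepath 0 w)) - P (pathstart (linepath 0 w)))) (linepath 0 w)"
      by (intro contour_integral_primitive[of "ball 0 1" P p] P) auto
    thus ?thesis by (simp add: contour_integral_unique)
  qed
  have "((\<lambda>w. P w - P 0) has_field_derivative p z) (at z)"
    using P[of z] z by (auto simp: at_within_open[OF _ open_ball] intro!: derivative_eq_intros)
  thus ?thesis
    by (rule has_field_derivative_transform_within_open[of _ _ _ "ball 0 1"]) (use z e in auto)
qed

lemma in_Q_cong:
  assumes "\<And>z. cmod z < 1 \<Longrightarrow> h z = k z"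
  shows "in_Q s h \<longleftrightarrow> in_Q s k"
proof -
  have "qint s h a = qint s k a" for a unfolding qint_def by (rule nn_integral_cong) (simp add: assms)
  thus ?thesis by (simp add: in_Q_def)
qed

lemma in_Q_sum:
  assumes h: "\<And>z. cmod z < 1 \<Longrightarrow> cmod (h z) \<le> cmod (k z) + cmod (l z)"
    and kl: "k holomorphic_on ball 0 1" "l holomorphic_on ball 0 1" "in_Q s k" "in_Q s l"
  shows "in_Q s h"
proof -
  obtain A where A: "A \<ge> 0" "\<And>a. cmod a < 1 \<Longrightarrow> qint s k a \<le> ennreal A" using in_QE[OF kl(3)] by blast
  obtain B where B: "B \<ge> 0" "\<And>a. cmod a < 1 \<Longrightarrow> qint s l a \<le> ennreal B" using in_QE[OF kl(4)] by blast
  have "qint s h a \<le> ennreal (2 * A + 2 * B)" if a: "cmod a < 1" for a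
  proof -
    have "qint s h a \<le> 2 * qint s k a + 2 * qint s l a"
      by (rule qint_add[OF h a]) (use kl in \<open>auto intro!: measurable_disc_areaI holomorphic_on_imp_continuous_on simp del: sets_disc_area\<close>)
    also have "\<dots> \<le> 2 * ennreal A + 2 * ennreal B" by (intro add_mono mult_left_mono A B a) auto
    also have "\<dots> = ennreal (2 * A + 2 * B)" using A(1) B(1) by (subst ennreal_plus) (auto simp: ennreal_mult')
    finally show ?thesis .
  qed
  thus ?thesis unfolding in_Q_def using A(1) B(1) by (intro exI[of _ "2 * A + 2 * B"]) auto
qed

lemma in_Q_bounded_mult:
  assumes s: "s1 \<le> s" and h: "h holomorphic_on ball 0 1" "in_Q s1 h"
    and g: "bounded (g ` ball 0 1)"
  shows "in_Q s (\<lambda>z. g z * h z)"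
proof -
  obtain C where C: "C \<ge> 0" "\<And>a. cmod a < 1 \<Longrightarrow> qint s1 h a \<le> ennreal C" using in_QE[OF h(2)] by blast
  obtain B0 where B0: "\<forall>x\<in>g ` ball 0 1. cmod x \<le> B0" using g unfolding bounded_iff by blast
  define B where "B = max 0 B0"
  have B: "B \<ge> 0" "\<And>z. cmod z < 1 \<Longrightarrow> cmod (g z) \<le> B" using B0 by (auto simp: B_def le_max_iff_disj)
  have "qint s (\<lambda>z. g z * h z) a \<le> ennreal (B\<^sup>2 * C)" if a: "cmod a < 1" for a
  proof -
    have "qint s (\<lambda>z. g z * h z) a \<le> ennreal (B\<^sup>2) * qint s h a"
    proof (rule qint_mono[OF _ B(1) a])
      show "cmod (g z * h z) \<le> B * cmod (h z)" if "cmod z < 1" for z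
        unfolding norm_mult by (intro mult_right_mono B that) auto
      show "h \<in> borel_measurable disc_area" by (intro measurable_disc_areaI holomorphic_on_imp_continuous_on h)
    qed
    also have "\<dots> \<le> ennreal (B\<^sup>2) * ennreal C"
      by (intro mult_left_mono order_trans[OF qint_exponent_mono[OF s a] C(2)[OF a]]) auto
    finally show ?thesis using C by (simp add: ennreal_mult)
  qed
  thus ?thesis unfolding in_Q_def using C B by (intro exI[of _ "B\<^sup>2 * C"]) auto
qed

theorem theorem3p1:
  fixes s1 s2 :: real and g :: "complex \<Rightarrow> complex"
  assumes "0 < s1" and "s1 \<le> s2" and "s2 \<le> 1"
    and "g holomorphic_on ball 0 1"
  shows "(T_op g ` Q_space s1 \<subseteq> Q_space s2 \<longleftrightarrow> g \<in> Q_log_space s2 1) \<and>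
    (I_op g ` Q_space s1 \<subseteq> Q_space s2 \<longleftrightarrow> g \<in> H_infinity) \<and>
    (M_op g ` Q_space s1 \<subseteq> Q_space s2 \<longleftrightarrow> g \<in> Q_log_space s2 1 \<inter> H_infinity)"
proof -
  note g = assms(4)
  have s1: "0 < s1" "s1 \<le> 1" and s2: "0 < s2" "s2 \<le> 1" using assms by auto
  have dg: "deriv g holomorphic_on ball 0 1" by (rule holomorphic_deriv[OF g open_ball])
  \<comment> \<open>Membership in a Q space depends on a holomorphic function only through its
    derivative, so each operator turns into a multiplication statement about D f.\<close>
  have sub: "(T ` Q_space s1 \<subseteq> Q_space s2) \<longleftrightarrow>
      (\<forall>f. f holomorphic_on ball 0 1 \<longrightarrow> in_Q s1 (deriv f) \<longrightarrow> in_Q s2 (D f))"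
    if der: "\<And>f z. f holomorphic_on ball 0 1 \<Longrightarrow> cmod z < 1 \<Longrightarrow> (T f has_field_derivative D f z) (at z)"
    for T D :: "(complex \<Rightarrow> complex) \<Rightarrow> complex \<Rightarrow> complex"
  proof -
    have "T f \<in> Q_space s2 \<longleftrightarrow> in_Q s2 (D f)" if f: "f holomorphic_on ball 0 1" for f
    proof -
      have "T f holomorphic_on ball 0 1"
        unfolding holomorphic_on_open[OF open_ball]
      proof
        fix z :: complex assume "z \<in> ball 0 1"
        hence "cmod z < 1" by simp
        from der[OF f this] show "\<exists>f'. (T f has_field_derivative f') (at z)" by blast
      qed
      moreover have "in_Q s2 (deriv (T f)) \<longleftrightarrow> in_Q s2 (D f)"
        by (rule in_Q_cong) (rule DERIV_imp_deriv[OF der[OF f]])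
      ultimately show ?thesis unfolding Q_space_iff[OF s2] by simp
    qed
    thus ?thesis unfolding image_subset_iff by (auto simp: Q_space_iff[OF s1])
  qed
  have fd: "(f has_field_derivative deriv f z) (at z)" if "f holomorphic_on ball 0 1" "cmod z < 1" for f z
    using holomorphic_derivI[OF that(1) open_ball, of z] that(2) by simp
  have T: "(T_op g ` Q_space s1 \<subseteq> Q_space s2) \<longleftrightarrow>
      (\<forall>f. f holomorphic_on ball 0 1 \<longrightarrow> in_Q s1 (deriv f) \<longrightarrow> in_Q s2 (\<lambda>z. deriv g z * f z))"
    by (rule sub) (unfold T_op_def[abs_def], intro has_field_derivative_segment_integral holomorphic_on_mult dg)
  have I: "(I_op g ` Q_space s1 \<subseteq> Q_space s2) \<longleftrightarrow>
      (\<forall>f. f holomorphic_on ball 0 1 \<longrightarrow> in_Q s1 (deriv f) \<longrightarrow> in_Q s2 (\<lambda>z. g z * deriv f z))"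
    by (rule sub) (unfold I_op_def[abs_def], intro has_field_derivative_segment_integral holomorphic_on_mult g holomorphic_deriv open_ball)
  have dM: "((\<lambda>z. g z * f z) has_field_derivative deriv g z * f z + g z * deriv f z) (at z)"
    if "f holomorphic_on ball 0 1" "cmod z < 1" for f z
    using DERIV_mult[OF fd[OF g that(2)] fd[OF that]] by (simp add: add.commute mult.commute)
  have M: "(M_op g ` Q_space s1 \<subseteq> Q_space s2) \<longleftrightarrow>
      (\<forall>f. f holomorphic_on ball 0 1 \<longrightarrow> in_Q s1 (deriv f) \<longrightarrow> in_Q s2 (\<lambda>z. deriv g z * f z + g z * deriv f z))"
    by (rule sub) (unfold M_op_def[abs_def], rule dM)
  have Qlog: "g \<in> Q_log_space s2 1 \<longleftrightarrow> in_Qlog s2 (deriv g)" using g by (simp add: Q_log_space_iff)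
  have Hinf: "g \<in> H_infinity \<longleftrightarrow> bounded (g ` ball 0 1)" using g by (simp add: H_infinity_def)
  \<comment> \<open>The inclusion of Q_{s1} in Q_{s2}, read off from multiplication by the constant
    1.\<close>
  have Qmono: "in_Q s2 (deriv f)" if "f holomorphic_on ball 0 1" "in_Q s1 (deriv f)" for f
    using in_Q_bounded_mult[OF assms(2) holomorphic_deriv[OF that(1) open_ball] that(2), of "\<lambda>_. 1"] by (simp add: image_constant_conv)
  have Tsuff: "in_Q s2 (\<lambda>z. deriv g z * f z)"
    if "in_Qlog s2 (deriv g)" "f holomorphic_on ball 0 1" "in_Q s1 (deriv f)" for f
    by (rule in_Qlog_mult[OF s2 that(2) Qmono[OF that(2,3)] dg that(1)])
  have Isuff: "in_Q s2 (\<lambda>z. g z * deriv f z)"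
    if "bounded (g ` ball 0 1)" "f holomorphic_on ball 0 1" "in_Q s1 (deriv f)" for f
    by (rule in_Q_bounded_mult[OF assms(2) holomorphic_deriv[OF that(2) open_ball] that(3,1)])
  have hT: "(\<lambda>z. deriv g z * f z) holomorphic_on ball 0 1" and hI: "(\<lambda>z. g z * deriv f z) holomorphic_on ball 0 1"
    if "f holomorphic_on ball 0 1" for f
    by (intro holomorphic_on_mult dg g that holomorphic_deriv open_ball)+
  have "T_op g ` Q_space s1 \<subseteq> Q_space s2 \<longleftrightarrow> in_Qlog s2 (deriv g)"
    unfolding T using in_Qlog_if_multiplier[OF s1 s2(1) dg] Tsuff by blast
  moreover have "I_op g ` Q_space s1 \<subseteq> Q_space s2 \<longleftrightarrow> bounded (g ` ball 0 1)"
    unfolding I using bounded_if_derivative_multiplier[OF s1 s2(1) g] Isuff by blast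
  moreover have "M_op g ` Q_space s1 \<subseteq> Q_space s2 \<longleftrightarrow> in_Qlog s2 (deriv g) \<and> bounded (g ` ball 0 1)"
    unfolding M
  proof
    assume L: "\<forall>f. f holomorphic_on ball 0 1 \<longrightarrow> in_Q s1 (deriv f) \<longrightarrow> in_Q s2 (\<lambda>z. deriv g z * f z + g z * deriv f z)"
    have bd: "bounded (g ` ball 0 1)"
    proof (rule bounded_if_pointwise_multiplier[OF s1 s2(1) g])
      fix f assume f: "f holomorphic_on ball 0 1" "in_Q s1 (deriv f)"
      have "in_Q s2 (deriv (\<lambda>z. g z * f z)) \<longleftrightarrow> in_Q s2 (\<lambda>z. deriv g z * f z + g z * deriv f z)"
        by (rule in_Q_cong) (rule DERIV_imp_deriv[OF dM[OF f(1)]])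
      thus "in_Q s2 (deriv (\<lambda>z. g z * f z))" using L f by blast
    qed
    \<comment> \<open>Boundedness had to come first: it puts g f' into the target class, and
      subtracting it from (g f)' isolates g' f, which reduces the claim to the case of T_g.\<close>
    have "in_Qlog s2 (deriv g)"
    proof (rule in_Qlog_if_multiplier[OF s1 s2(1) dg])
      fix f assume f: "f holomorphic_on ball 0 1" "in_Q s1 (deriv f)"
      have le: "cmod (deriv g z * f z) \<le> cmod (deriv g z * f z + g z * deriv f z) + cmod (g z * deriv f z)" for z
        using norm_triangle_ineq4[of "deriv g z * f z + g z * deriv f z" "g z * deriv f z"] by simp
      show "in_Q s2 (\<lambda>z. deriv g z * f z)"
        by (rule in_Q_sum[OF le]) (use L f Isuff[OF bd f] hT hI in \<open>auto intro!: holomorphic_on_add\<close>)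
    qed
    with bd show "in_Qlog s2 (deriv g) \<and> bounded (g ` ball 0 1)" by blast
  next
    assume R: "in_Qlog s2 (deriv g) \<and> bounded (g ` ball 0 1)"
    show "\<forall>f. f holomorphic_on ball 0 1 \<longrightarrow> in_Q s1 (deriv f) \<longrightarrow> in_Q s2 (\<lambda>z. deriv g z * f z + g z * deriv f z)"
    proof (intro allI impI)
      fix f assume f: "f holomorphic_on ball 0 1" "in_Q s1 (deriv f)"
      show "in_Q s2 (\<lambda>z. deriv g z * f z + g z * deriv f z)"
        by (rule in_Q_sum[OF norm_triangle_ineq hT[OF f(1)] hI[OF f(1)]]) (use R Tsuff Isuff f in auto)
    qed
  qed
  ultimately show ?thesis unfolding Qlog Hinf Int_iff by blast
qed

end
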